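(* Let $0\le p<q\le n-1$ be integers with $\dim G(p,n)<\dim G(q,n)$. Let $\mathcal O\subset\mathbb R^n$ be a subset, with complement $\mathcal O^c=\mathbb R^n\setminus\mathcal O$, satisfying the condition: for every $\ell\in G(p,n)$ with $\ell\subset\mathcal O^c$ there exists an affine hyperplane $L\subset\mathbb R^n$ such that $\ell\subset L\subset\mathcal O^c$. Suppose that $f\in\mathcal S(G(p,n))$. If $\mathcal R^{(p,q)}f(\xi)=0$ for all $\xi\in G(q,n)$ with $\xi\subset\mathcal O^c$, then $f(\ell)=0$ for all $\ell\in G(p,n)$ with $\ell\subset\mathcal O^c$.
   Context: For $0\le d\le n-1$, $G_{d,n}$ is the compact Grassmann manifold of $d$-dimensional linear subspaces of $\mathbb R^n$, and $G(d,n)$ is the manifold of all $d$-dimensional affine planes in $\mathbb R^n$, of dimension $(d+1)(n-d)$. A plane $\ell\in G(d,n)$ is written uniquely as $\ell=(\sigma,x)$, where $\sigma\in G_{d,n}$ is the parallel translate of $\ell$ through the origin and $\{x\}=\sigma^\perp\cap\ell$. Let $M(n)=O(n)\rtimes\mathbb R^n$ be the Euclidean motion group, with Lie algebra $\mathfrak m(n)$. It acts on $G(d,n)$, and $Y\in\mathfrak m(n)$ acts on $C^\infty(G(d,n))$ by $Y\cdot g(\ell)=\frac{d}{dt}g(\exp(-tY)\cdot\ell)|_{t=0}$. The Schwartz space $\mathcal S(G(d,n))$ consists of the $g\in C^\infty(G(d,n))$ such that $\sup_{(\sigma,x)}\|x\|^N|(Y_1\cdots Y_m\cdot g)(\sigma,x)|<\infty$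 for all integers $N,m\ge0$ and all $Y_1,\dots,Y_m\in\mathfrak m(n)$. The Radon transform $\mathcal R^{(p,q)}:\mathcal S(G(p,n))\to\mathcal S(G(q,n))$ is $$\mathcal R^{(p,q)}f(\eta,v)=\int_{\sigma\subset\eta}\Big(\int_{\sigma^\perp\cap\eta}f(\sigma,v+x)\,dx\Big)d\sigma,\qquad (\eta,v)\in G(q,n),$$ where $dx$ is Lebesgue measure and $d\sigma$ is the normalized (total mass 1) measure on $\{\sigma\in G_{p,n}:\sigma\subset\eta\}$ invariant under all elements of $O(n)$ preserving $\eta$. *)

theory Defs
  imports "HOL-Probability.Probability"
begin

section \<open>Linear and affine Grassmannians\<close>

text \<open>Euclidean \<open>n\<close>-space is \<^typ>\<open>real^'n\<close>, so \<open>n = CARD('n)\<close>. Planes are the sets of their points.\<close>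

definition linear_grassmannian :: "nat \<Rightarrow> (real^'n) set set" where
  "linear_grassmannian d = {\<sigma>. subspace \<sigma> \<and> dim \<sigma> = d}"

definition affine_grassmannian :: "nat \<Rightarrow> (real^'n) set set" where
  "affine_grassmannian d = {l. affine l \<and> aff_dim l = int d}"

definition affine_grassmannian_dim :: "nat \<Rightarrow> nat \<Rightarrow> nat" where
  "affine_grassmannian_dim d n = (d + 1) * (n - d)"

text \<open>The plane \<open>(\<sigma>, x)\<close>, and the components \<open>\<sigma>\<close> and \<open>x\<close> of a given plane.\<close>

definition plane :: "(real^'n) set \<Rightarrow> real^'n \<Rightarrow> (real^'n) set" where
  "plane \<sigma> x = (\<lambda>u. x + u) ` \<sigma>"

definition direction :: "(real^'n) set \<Rightarrow> (real^'n) set" where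
  "direction l = {y - z | y z. y \<in> l \<and> z \<in> l}"

definition foot :: "(real^'n) set \<Rightarrow> real^'n" where
  "foot l = (THE x. {x} = orthogonal_comp (direction l) \<inter> l)"


section \<open>Smooth functions on the affine Grassmannian\<close>

primrec Ck :: "nat \<Rightarrow> ('a::real_normed_vector \<Rightarrow> 'b::real_normed_vector) \<Rightarrow> bool" where
  "Ck 0 g \<longleftrightarrow> continuous_on UNIV g"
| "Ck (Suc k) g \<longleftrightarrow> (\<forall>x. g differentiable (at x)) \<and>
     (\<forall>v. Ck k (\<lambda>x. frechet_derivative g (at x) v))"

text \<open>
  The standard chart of the manifold \<open>G(d,n)\<close> centred at a linear \<open>d\<close>-plane \<open>\<sigma>\<close> has the model
  space \<open>Hom(\<sigma>, \<sigma>\<^sup>\<bottom>) \<times> \<sigma>\<^sup>\<bottom>\<close> and sends \<open>(A, y)\<close> to the graph \<open>{u + A u + y | u \<in> \<sigma>}\<close>.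
  To have one domain for all \<open>\<sigma>\<close>, we let \<open>A\<close> range over all square matrices and \<open>y\<close> over all
  vectors, and project onto \<open>\<sigma>\<^sup>\<bottom>\<close>. As \<open>(A, y)\<close> then enters only through its image under a linear
  surjection onto the model space, this does not affect smoothness. (For a subspace \<open>\<sigma>\<close>,
  \<^term>\<open>closest_point \<sigma>\<close> is the orthogonal projection onto \<open>\<sigma>\<close>.)
\<close>

definition graph_chart :: "(real^'n) set \<Rightarrow> (real^'n^'n) \<times> (real^'n) \<Rightarrow> (real^'n) set" where
  "graph_chart \<sigma> = (\<lambda>(A, y). (\<lambda>u. u + ((A *v u + y) - closest_point \<sigma> (A *v u + y))) ` \<sigma>)"

definition smooth_on_grassmannian :: "nat \<Rightarrow> ((real^'n) set \<Rightarrow> complex) \<Rightarrow> bool" where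
  "smooth_on_grassmannian d g \<longleftrightarrow>
     (\<forall>\<sigma> \<in> linear_grassmannian d. \<forall>k. Ck k (g \<circ> graph_chart \<sigma>))"


section \<open>The Lie algebra of the motion group and the Schwartz space\<close>

text \<open>An element \<open>(A, b)\<close> of the Lie algebra is the infinitesimal motion \<open>x \<mapsto> A x + b\<close>.\<close>

definition motion_lie_algebra :: "((real^'n^'n) \<times> (real^'n)) set" where
  "motion_lie_algebra = {(A, b). transpose A = - A}"

text \<open>
  Motions embed in the linear group of \<open>\<real>\<^sup>n \<times> \<real>\<close> by \<open>x \<mapsto> (x, 1)\<close>; under this embedding \<open>(A, b)\<close>
  is the block matrix with rows \<open>(A, b)\<close> and \<open>(0, 0)\<close>, and the exponential of the motion group is
  the matrix exponential, here evaluated at a point of \<open>\<real>\<^sup>n\<close>.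
\<close>

definition homogenize :: "(real^'n^'n) \<times> (real^'n) \<Rightarrow> (real^'n) \<times> real \<Rightarrow> (real^'n) \<times> real" where
  "homogenize = (\<lambda>(A, b) (x, s). (A *v x + s *\<^sub>R b, 0))"

definition motion_exp :: "(real^'n^'n) \<times> (real^'n) \<Rightarrow> real^'n \<Rightarrow> real^'n" where
  "motion_exp Y x = fst (\<Sum>k. (1 / fact k) *\<^sub>R (homogenize Y ^^ k) (x, 1))"

definition lie_act ::
  "(real^'n^'n) \<times> (real^'n) \<Rightarrow> ((real^'n) set \<Rightarrow> complex) \<Rightarrow> (real^'n) set \<Rightarrow> complex" where
  "lie_act Y g l = vector_derivative (\<lambda>t. g (motion_exp ((- t) *\<^sub>R Y) ` l)) (at 0)"

definition schwartz_space :: "nat \<Rightarrow> ((real^'n) set \<Rightarrow> complex) set" where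
  "schwartz_space d = {g. smooth_on_grassmannian d g \<and>
     (\<forall>N. \<forall>Ys \<in> lists motion_lie_algebra.
        bdd_above ((\<lambda>l. norm (foot l) ^ N * norm (foldr lie_act Ys g l)) ` affine_grassmannian d))}"


section \<open>The Radon transform\<close>

text \<open>
  Lebesgue measure on a linear subspace, as a measure on the ambient space; compare
  \<open>lborel_def\<close>. It does not depend on the chosen orthonormal basis.
\<close>

definition orthonormal_basis_of :: "(real^'n) set \<Rightarrow> (real^'n) set \<Rightarrow> bool" where
  "orthonormal_basis_of W B \<longleftrightarrow>
     pairwise orthogonal B \<and> (\<forall>b\<in>B. norm b = 1) \<and> span B = W"

definition subspace_lborel :: "(real^'n) set \<Rightarrow> (real^'n) measure" where
  "subspace_lborel W = (let B = (SOME B. orthonormal_basis_of W B) in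
     distr (\<Pi>\<^sub>M b\<in>B. lborel) borel (\<lambda>c. \<Sum>b\<in>B. c b *\<^sub>R b))"

text \<open>
  The Borel \<open>\<sigma>\<close>-algebra of \<open>{\<sigma> \<in> G\<^bsub>p,n\<^esub>. \<sigma> \<subseteq> \<eta>}\<close>: the topology of the Grassmannian is
  the one induced by the embedding that sends a subspace to the matrix of its orthogonal projection.
\<close>

definition sub_grassmannian_algebra :: "nat \<Rightarrow> (real^'n) set \<Rightarrow> (real^'n) set measure" where
  "sub_grassmannian_algebra p \<eta> =
     vimage_algebra {\<sigma> \<in> linear_grassmannian p. \<sigma> \<subseteq> \<eta>} (\<lambda>\<sigma>. matrix (closest_point \<sigma>)) borel"

definition is_invariant_prob :: "nat \<Rightarrow> (real^'n) set \<Rightarrow> (real^'n) set measure \<Rightarrow> bool" where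
  "is_invariant_prob p \<eta> \<mu> \<longleftrightarrow>
     sets \<mu> = sets (sub_grassmannian_algebra p \<eta>) \<and> prob_space \<mu> \<and>
     (\<forall>k. orthogonal_transformation k \<and> k ` \<eta> = \<eta> \<longrightarrow> distr \<mu> \<mu> (\<lambda>\<sigma>. k ` \<sigma>) = \<mu>)"

text \<open>
  The group of orthogonal transformations preserving \<open>\<eta>\<close> is compact and acts transitively on the
  \<open>p\<close>-dimensional subspaces of \<open>\<eta>\<close>, so for \<open>p \<le> dim \<eta>\<close> there is exactly one such measure.
\<close>

definition sub_grassmannian_measure :: "nat \<Rightarrow> (real^'n) set \<Rightarrow> (real^'n) set measure" where
  "sub_grassmannian_measure p \<eta> = (SOME \<mu>. is_invariant_prob p \<eta> \<mu>)"

definition radon :: "nat \<Rightarrow> ((real^'n) set \<Rightarrow> complex) \<Rightarrow> (real^'n) set \<Rightarrow> complex" where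
  "radon p f \<xi> = (let \<eta> = direction \<xi>; v = foot \<xi> in
     LINT \<sigma> | sub_grassmannian_measure p \<eta>.
       (LINT x | subspace_lborel (orthogonal_comp \<sigma> \<inter> \<eta>). f (plane \<sigma> (v + x))))"

end

theory Submission
  imports Defs
begin

text \<open>
  Let \<open>W\<close> be the direction of a hyperplane \<open>L\<close> in the complement of \<open>\<O>\<close>, let \<open>\<sigma> \<subseteq> W\<close> be a linear
  \<open>p\<close>-plane and \<open>V = \<sigma>\<^sup>\<bottom> \<inter> W\<close>. Draw \<open>g\<close> from the Haar measure of the orthogonal group of \<open>W\<close>, and
  let \<open>z\<^sub>0, \<dots>, z\<^sub>m\<close> be \<open>dim W - q\<close> independent vectors in \<open>V\<close>. Given the vectors \<open>g z\<^sub>j\<close>, the plane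
  \<open>g \<sigma>\<close> is uniformly distributed among the \<open>p\<close>-planes in the \<open>q\<close>-plane \<open>\<eta>\<close> of the vectors of \<open>W\<close>
  orthogonal to all \<open>g z\<^sub>j\<close>. As the Radon transform vanishes on the translates of \<open>\<eta>\<close> in \<open>L\<close>, the
  slice theorem shows that the mean of \<open>exp (i \<Sum>\<^sub>j \<langle>g z\<^sub>j, x\<^sub>j\<rangle>)\<close> times the Fourier transform of
  \<open>y \<mapsto> f (g (\<sigma>, y))\<close> at \<open>z\<^sub>0\<close> is zero, for all \<open>x\<^sub>j\<close>. A Gaussian average over the \<open>z\<^sub>j\<close> turns this into
  the vanishing of the integrals of \<open>f (g (\<sigma>, y))\<close> against the kernels
  \<open>exp (- r (\<parallel>P\<^sub>V (g\<^sup>-\<^sup>1 x\<^sub>0 - y)\<parallel>\<^sup>2 + \<Sum>\<^sub>j\<^sub>>\<^sub>0 \<parallel>P\<^sub>V g\<^sup>-\<^sup>1 x\<^sub>j\<parallel>\<^sup>2))\<close> for all \<open>r > 0\<close>. The assumption on the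
  dimensions says \<open>p + q + 1 \<le> dim W\<close>, so that there are at least \<open>p\<close> vectors \<open>x\<^sub>j\<close> with \<open>j > 0\<close> and they can be
  chosen to span \<open>\<sigma>\<close>. Then the kernels concentrate at \<open>g (\<sigma>, y) = (\<sigma>, x\<^sub>0)\<close> as \<open>r \<rightarrow> \<infinity>\<close>, and
  \<open>f (\<sigma>, x\<^sub>0) = 0\<close> follows.
\<close>

section \<open>Orthogonal projections\<close>

text \<open>The hyperplane costs exactly one dimension: (q+1)(n-q) - (p+1)(n-p) = (q-p)(n-1-p-q), so
  the strict inequality in \<real>^n is what leaves p + 1 vectors x_j inside \<open>W\<close>, one
  for the position of the plane and p for its direction. Averaging over a group instead of a
  Grassmannian keeps all domains of integration fixed: V, its Lebesgue measure and the z_j do not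
  move with the plane. It also makes the phases free. They depend on g only through the g z_j, hence
  do not change when g is multiplied from the right by an isometry fixing the z_j, and such
  multiplications rotate the p-plane inside the q-plane just as the Radon transform does. The Radon
  transform controls independent z_j only, whereas the Gaussian average runs over all of them;
  density and dominated convergence close this gap. No asymptotic expansion is computed in the limit
  r \<rightarrow> \<infinity>. If the value c at the given plane were not zero, the real part of
  conj(c) f would be bounded below where the exponent is small, and multiplying the integral by exp
  (r \<delta>) would make this part grow without bound while the rest stays bounded.\<close>

lemma closest_point_subspace:
  fixes V :: "'a::euclidean_space set"
  assumes "subspace V"
  shows closest_point_subspace_in: "closest_point V x \<in> V"
    and closest_point_subspace_orth: "y \<in> V \<Longrightarrow> (x - closest_point V x) \<bullet> y = 0"
proof -
  have cl: "closed V" and ne: "V \<noteq> {}" and cv: "convex V"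
    using assms closed_subspace subspace_0 subspace_imp_convex by blast+
  show in1: "closest_point V x \<in> V"
    by (rule closest_point_in_set[OF cl ne])
  \<comment> \<open>The variational inequality for the projection onto a convex set, tested at the
    point P x + y. In a subspace -y may be tested as well, which turns it into an equality.\<close>
  have le: "(x - closest_point V x) \<bullet> y \<le> 0" if "y \<in> V" for y
    using closest_point_dot[OF cv cl, of "y + closest_point V x" x] that in1 assms
    by (simp add: subspace_add)
  show "(x - closest_point V x) \<bullet> y = 0" if "y \<in> V"
    using le[OF that] le[of "- y"] that assms by (simp add: subspace_neg)
qed

lemma closest_point_subspace_eqI:
  fixes V :: "'a::euclidean_space set"
  assumes "subspace V" "a \<in> V" "\<And>y. y \<in> V \<Longrightarrow> (x - a) \<bullet> y = 0"
  shows "closest_point V x = a"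
proof -
  let ?d = "closest_point V x - a"
  have d: "?d \<in> V"
    using assms closest_point_subspace_in[OF assms(1)] by (simp add: subspace_diff)
  have "?d \<bullet> ?d = (x - a) \<bullet> ?d - (x - closest_point V x) \<bullet> ?d"
    by (simp add: inner_diff_left)
  also have "\<dots> = 0"
    using assms(3)[OF d] closest_point_subspace_orth[OF assms(1) d] by simp
  finally show ?thesis by simp
qed

lemma linear_closest_point:
  fixes V :: "'a::euclidean_space set"
  assumes V: "subspace V"
  shows "linear (closest_point V)"
proof (rule linearI)
  note s = closest_point_subspace_in[OF V] closest_point_subspace_orth[OF V]
  show "closest_point V (x + y) = closest_point V x + closest_point V y" for x y
  proof (rule closest_point_subspace_eqI[OF V])
    show "(x + y - (closest_point V x + closest_point V y)) \<bullet> z = 0" if "z \<in> V" for z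
      using s(2)[OF that, of x] s(2)[OF that, of y] by (simp add: algebra_simps)
  qed (simp add: s(1) V subspace_add)
  show "closest_point V (c *\<^sub>R x) = c *\<^sub>R closest_point V x" for c x
  proof (rule closest_point_subspace_eqI[OF V])
    show "(c *\<^sub>R x - c *\<^sub>R closest_point V x) \<bullet> z = 0" if "z \<in> V" for z
      using s(2)[OF that, of x] by (simp flip: scaleR_diff_right)
  qed (simp add: s(1) V subspace_scale)
qed

lemma closest_point_subspace_self_adjoint:
  fixes V :: "'a::euclidean_space set"
  assumes V: "subspace V"
  shows "closest_point V x \<bullet> y = x \<bullet> closest_point V y"
  using closest_point_subspace_orth[OF V closest_point_subspace_in[OF V, of y], of x]
    closest_point_subspace_orth[OF V closest_point_subspace_in[OF V, of x], of y]
  by (simp add: inner_diff_left) (metis inner_commute)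

lemma closest_point_subspace_refl:
  fixes V :: "'a::euclidean_space set"
  assumes "subspace V" "x \<in> V"
  shows "closest_point V x = x"
  by (rule closest_point_self[OF assms(2)])

lemma closest_point_subspace_pythagoras:
  fixes V :: "'a::euclidean_space set"
  assumes V: "subspace V"
  shows "(norm x)\<^sup>2 = (norm (closest_point V x))\<^sup>2 + (norm (x - closest_point V x))\<^sup>2"
  using closest_point_subspace_orth[OF V closest_point_subspace_in[OF V, of x], of x]
  unfolding power2_norm_eq_inner by (simp add: algebra_simps inner_commute)

lemma norm_closest_point_subspace_le:
  fixes V :: "'a::euclidean_space set"
  assumes V: "subspace V"
  shows "norm (closest_point V x) \<le> norm x"
  using closest_point_subspace_pythagoras[OF V, of x]
  by (metis le_add_same_cancel1 norm_ge_zero power2_le_imp_le zero_le_power2)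

lemma matrix_closest_point_mult:
  fixes V :: "(real^'n) set"
  assumes V: "subspace V"
  shows "matrix (closest_point V) *v x = closest_point V x"
  using linear_closest_point[OF V] by (simp add: matrix_works)

lemma closest_point_orthogonal_comp:
  fixes V :: "'a::euclidean_space set"
  assumes V: "subspace V"
  shows "closest_point (V\<^sup>\<bottom>) x = x - closest_point V x"
proof (rule closest_point_subspace_eqI)
  show "x - closest_point V x \<in> V\<^sup>\<bottom>"
    using closest_point_subspace_orth[OF V]
    by (auto simp: orthogonal_comp_def orthogonal_def inner_commute)
  show "(x - (x - closest_point V x)) \<bullet> y = 0" if "y \<in> V\<^sup>\<bottom>" for y
    using that closest_point_subspace_in[OF V, of x]
    by (auto simp: orthogonal_comp_def orthogonal_def)
qed (rule subspace_orthogonal_comp)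

text \<open>As V lies in U, projecting to U first does not change the projection onto V. Hence P_U -
  P_V takes values in U and kills the component along V.\<close>

lemma closest_point_relative_orthogonal_comp:
  fixes V :: "'a::euclidean_space set"
  assumes V: "subspace V" and U: "subspace U" and VU: "V \<subseteq> U"
  shows "closest_point (V\<^sup>\<bottom> \<inter> U) x = closest_point U x - closest_point V x"
proof (rule closest_point_subspace_eqI)
  have "closest_point V (closest_point U x) = closest_point V x"
  proof (rule closest_point_subspace_eqI[OF V closest_point_subspace_in[OF V]])
    show "(closest_point U x - closest_point V x) \<bullet> y = 0" if "y \<in> V" for y
      using closest_point_subspace_orth[OF V that, of x]
        closest_point_subspace_orth[OF U subsetD[OF VU that], of x]
      by (simp add: algebra_simps)
  qed
  then have *: "(closest_point U x - closest_point V x) \<bullet> y = 0" if "y \<in> V" for y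
    using closest_point_subspace_orth[OF V that, of "closest_point U x"] by simp
  then show "closest_point U x - closest_point V x \<in> V\<^sup>\<bottom> \<inter> U"
    using closest_point_subspace_in[OF U, of x] closest_point_subspace_in[OF V, of x] VU U
    by (auto simp: orthogonal_comp_def orthogonal_def inner_commute subspace_diff)
  show "(x - (closest_point U x - closest_point V x)) \<bullet> y = 0" if "y \<in> V\<^sup>\<bottom> \<inter> U" for y
    using that closest_point_subspace_orth[OF U, of y x] closest_point_subspace_in[OF V, of x]
    by (auto simp: orthogonal_comp_def orthogonal_def algebra_simps)
qed (simp add: subspace_inter subspace_orthogonal_comp U)

lemma dim_relative_orthogonal_comp:
  fixes V :: "'a::euclidean_space set"
  assumes "subspace V" "subspace U" "V \<subseteq> U"
  shows "dim (V\<^sup>\<bottom> \<inter> U) + dim V = dim U"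
proof -
  have "V\<^sup>\<bottom> \<inter> U = {y \<in> U. \<forall>x\<in>V. orthogonal x y}"
    by (auto simp: orthogonal_comp_def)
  then show ?thesis using dim_subspace_orthogonal_to_vectors[OF assms] by simp
qed

section \<open>Orthogonal groups of subspaces\<close>

text \<open>As a rewrite rule it replaces \<open>transpose A *v x\<close> by \<open>x v* A\<close>;
  here the transpose is the inverse isometry and has to stay visible as a matrix acting on
  vectors.\<close>

declare transpose_matrix_vector [simp del]

lemma orthogonal_matrix_inverse:
  fixes A :: "real^'n^'n"
  assumes "orthogonal_matrix A"
  shows "transpose A *v (A *v x) = x" "A *v (transpose A *v x) = x"
  using assms by (simp_all add: matrix_vector_mul_assoc orthogonal_matrix_def)

lemma orthogonal_matrix_inner:
  fixes A :: "real^'n^'n"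
  assumes "orthogonal_matrix A"
  shows "(A *v x) \<bullet> (A *v y) = x \<bullet> y" "x \<bullet> (A *v y) = (transpose A *v x) \<bullet> y"
proof -
  show *: "x \<bullet> (A *v y) = (transpose A *v x) \<bullet> y" for x y
    by (metis dot_lmul_matrix transpose_matrix_vector)
  have "(A *v x) \<bullet> (A *v y) = (transpose A *v (A *v x)) \<bullet> y" by (rule *)
  then show "(A *v x) \<bullet> (A *v y) = x \<bullet> y"
    unfolding orthogonal_matrix_inverse(1)[OF assms] .
qed

lemma orthogonal_matrix_norm:
  fixes A :: "real^'n^'n"
  assumes "orthogonal_matrix A"
  shows "norm (A *v x) = norm x"
  by (simp add: norm_eq_sqrt_inner orthogonal_matrix_inner(1)[OF assms])

lemma orthogonal_matrixI_norm:
  fixes A :: "real^'n^'n"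
  assumes "\<And>x. norm (A *v x) = norm x"
  shows "orthogonal_matrix A"
  using assms orthogonal_transformation_matrix[of "(*v) A"] by (simp add: orthogonal_transformation)

lemma closest_point_orthogonal_image:
  fixes A :: "real^'n^'n"
  assumes A: "orthogonal_matrix A" and V: "subspace V"
  shows "closest_point ((*v) A ` V) x = A *v closest_point V (transpose A *v x)"
proof (rule closest_point_subspace_eqI)
  show "(x - A *v closest_point V (transpose A *v x)) \<bullet> y = 0" if y: "y \<in> (*v) A ` V" for y
  proof -
    obtain z where z: "z \<in> V" "y = A *v z" using y by blast
    show ?thesis
      using closest_point_subspace_orth[OF V z(1), of "transpose A *v x"]
      by (simp add: z(2) inner_diff_left orthogonal_matrix_inner[OF A] flip: orthogonal_matrix_inner(2)[OF A])
  qed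
qed (use V closest_point_subspace_in[OF V] in \<open>auto intro: linear_subspace_image\<close>)

lemma matrix_closest_point_orthogonal_image:
  fixes A :: "real^'n^'n"
  assumes A: "orthogonal_matrix A" and V: "subspace V"
  shows "matrix (closest_point ((*v) A ` V)) = A ** matrix (closest_point V) ** transpose A"
  using A V linear_subspace_image[OF matrix_vector_mul_linear, of V A]
  by (simp add: matrix_eq matrix_closest_point_mult closest_point_orthogonal_image
      flip: matrix_vector_mul_assoc)

text \<open>The isometry group of \<open>U\<close>, realised inside the orthogonal matrices of the
  whole space by letting it act trivially on \<open>U\<^sup>\<bottom>\<close>. In this form nested
  subspaces have nested groups, and the group of the vectors of \<open>W\<close> orthogonal to a
  family consists of isometries that fix the family.\<close>

definition orthogonal_group :: "(real^'n) set \<Rightarrow> (real^'n^'n) set" where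
  "orthogonal_group U = {A. orthogonal_matrix A \<and> (\<forall>x \<in> U\<^sup>\<bottom>. A *v x = x)}"

lemma orthogonal_groupD:
  assumes "A \<in> orthogonal_group U"
  shows "orthogonal_matrix A" "x \<in> U\<^sup>\<bottom> \<Longrightarrow> A *v x = x"
  using assms by (auto simp: orthogonal_group_def)

lemma mat_1_in_orthogonal_group: "mat 1 \<in> orthogonal_group U"
  by (simp add: orthogonal_group_def orthogonal_matrix_id)

lemma orthogonal_group_mult:
  "A \<in> orthogonal_group U \<Longrightarrow> B \<in> orthogonal_group U \<Longrightarrow> A ** B \<in> orthogonal_group U"
  by (auto simp: orthogonal_group_def orthogonal_matrix_mul simp flip: matrix_vector_mul_assoc)

lemma orthogonal_group_transpose:
  assumes "A \<in> orthogonal_group U"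
  shows "transpose A \<in> orthogonal_group U"
  using assms orthogonal_matrix_inverse(1)[of A] unfolding orthogonal_group_def
  by simp metis

lemma orthogonal_group_mono: "U \<subseteq> U' \<Longrightarrow> orthogonal_group U \<subseteq> orthogonal_group U'"
  using orthogonal_comp_anti_mono[of U U'] by (auto simp: orthogonal_group_def)

lemma orthogonal_group_image_subset:
  assumes "A \<in> orthogonal_group U" "subspace U" "x \<in> U"
  shows "A *v x \<in> U"
proof -
  \<comment> \<open>\<open>U\<close> is its own double complement, so it suffices to test against
    \<open>U\<^sup>\<bottom>\<close>, where \<open>A\<close> is the identity.\<close>
  have "A *v x \<in> U\<^sup>\<bottom>\<^sup>\<bottom>"
    unfolding orthogonal_comp_def orthogonal_def
  proof safe
    fix y assume y: "\<forall>z\<in>U. z \<bullet> y = 0"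
    then have "y \<in> U\<^sup>\<bottom>" by (auto simp: orthogonal_comp_def orthogonal_def)
    then have "y \<bullet> (A *v x) = (A *v y) \<bullet> (A *v x)"
      using orthogonal_groupD(2)[OF assms(1)] by simp
    also have "\<dots> = y \<bullet> x" using orthogonal_matrix_inner orthogonal_groupD(1)[OF assms(1)] by blast
    finally show "y \<bullet> (A *v x) = 0" using y assms(3) by (simp add: inner_commute)
  qed
  then show ?thesis using orthogonal_comp_self[OF assms(2)] by simp
qed

lemma orthogonal_group_image:
  assumes "A \<in> orthogonal_group U" "subspace U"
  shows "(*v) A ` U = U"
proof
  show "(*v) A ` U \<subseteq> U" using orthogonal_group_image_subset[OF assms] by blast
  show "U \<subseteq> (*v) A ` U"
  proof
    fix x assume "x \<in> U"
    then have "transpose A *v x \<in> U"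
      using orthogonal_group_image_subset[OF orthogonal_group_transpose[OF assms(1)] assms(2)] by blast
    moreover have "x = A *v (transpose A *v x)"
      using orthogonal_matrix_inverse orthogonal_groupD(1)[OF assms(1)] by metis
    ultimately show "x \<in> (*v) A ` U" by blast
  qed
qed

lemma dim_orthogonal_matrix_image:
  fixes A :: "real^'n^'n"
  assumes "orthogonal_matrix A"
  shows "dim ((*v) A ` V) = dim V"
  using assms orthogonal_matrix_inverse(1)[OF assms]
  by (intro dim_image_eq matrix_vector_mul_linear) (metis inj_on_def)

lemma orthogonal_matrix_image_orthogonal_comp:
  fixes A :: "real^'n^'n"
  assumes A: "orthogonal_matrix A"
  shows "(*v) A ` (V\<^sup>\<bottom>) = ((*v) A ` V)\<^sup>\<bottom>"
proof
  show "(*v) A ` (V\<^sup>\<bottom>) \<subseteq> ((*v) A ` V)\<^sup>\<bottom>"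
    using orthogonal_matrix_inner(1)[OF A] by (auto simp: orthogonal_comp_def orthogonal_def)
  show "((*v) A ` V)\<^sup>\<bottom> \<subseteq> (*v) A ` (V\<^sup>\<bottom>)"
  proof
    fix x assume x: "x \<in> ((*v) A ` V)\<^sup>\<bottom>"
    have "transpose A *v x \<in> V\<^sup>\<bottom>"
      using x by (auto simp: orthogonal_comp_def orthogonal_def inner_commute orthogonal_matrix_inner(2)[OF A])
    then show "x \<in> (*v) A ` (V\<^sup>\<bottom>)"
      using orthogonal_matrix_inverse(2)[OF A, of x] by (metis image_eqI)
  qed
qed

lemma compact_orthogonal_group: "compact (orthogonal_group U :: (real^'n^'n) set)"
proof -
  have "orthogonal_group U = {A. transpose A ** A = mat 1} \<inter> (\<Inter>x\<in>U\<^sup>\<bottom>. {A. A *v x = x})"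
    by (auto simp: orthogonal_group_def orthogonal_matrix)
  moreover have "closed {A :: real^'n^'n. transpose A ** A = mat 1}"
    by (intro closed_Collect_eq continuous_intros)
      (auto simp: matrix_matrix_mult_def transpose_def intro!: continuous_intros)
  moreover have "closed {A :: real^'n^'n. A *v x = x}" for x
    by (intro closed_Collect_eq continuous_intros)
      (auto simp: matrix_vector_mult_def intro!: continuous_intros)
  ultimately have "closed (orthogonal_group U)" by (auto intro!: closed_Int closed_INT)
  moreover have "norm A \<le> real CARD('n)" if "orthogonal_matrix A" for A :: "real^'n^'n"
  proof -
    have "norm A \<le> (\<Sum>i\<in>UNIV. norm (A $ i))" by (simp add: norm_vec_def L2_set_le_sum)
    also have "\<dots> = (\<Sum>i\<in>(UNIV::'n set). 1)"
      using that by (intro sum.cong) (auto simp: orthogonal_matrix_orthonormal_rows row_def vec_nth_inverse)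
    finally show ?thesis by simp
  qed
  then have "bounded (orthogonal_group U :: (real^'n^'n) set)"
    by (auto simp: bounded_iff orthogonal_group_def)
  ultimately show ?thesis by (simp add: compact_eq_bounded_closed)
qed

text \<open>Three isometries are glued: one from S to T, one between the relative complements of S
  and T in U, which have equal dimension, and the identity on \<open>U\<^sup>\<bottom>\<close>. The
  summands are orthogonal on both sides, so the norm is preserved by Pythagoras.\<close>

lemma orthogonal_group_transitive:
  fixes U :: "(real^'n) set"
  assumes U: "subspace U" and S: "subspace S" "S \<subseteq> U" and T: "subspace T" "T \<subseteq> U"
    and d: "dim S = dim T"
  obtains A where "A \<in> orthogonal_group U" "(*v) A ` S = T"
proof -
  obtain f where f: "linear f" "f ` S = T" "\<And>x. x \<in> S \<Longrightarrow> norm (f x) = norm x"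
    using isometries_subspaces[OF S(1) T(1) d] by metis
  have "dim (S\<^sup>\<bottom> \<inter> U) = dim (T\<^sup>\<bottom> \<inter> U)"
    using dim_relative_orthogonal_comp[OF S(1) U S(2)] dim_relative_orthogonal_comp[OF T(1) U T(2)] d
    by simp
  then obtain g where g: "linear g" "g ` (S\<^sup>\<bottom> \<inter> U) = T\<^sup>\<bottom> \<inter> U"
      "\<And>x. x \<in> S\<^sup>\<bottom> \<inter> U \<Longrightarrow> norm (g x) = norm x"
    using isometries_subspaces[of "S\<^sup>\<bottom> \<inter> U" "T\<^sup>\<bottom> \<inter> U"] U
    by (metis subspace_inter subspace_orthogonal_comp)
  define h where "h x = f (closest_point S x) + g (closest_point (S\<^sup>\<bottom> \<inter> U) x) + closest_point (U\<^sup>\<bottom>) x" for x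
  have SU: "subspace (S\<^sup>\<bottom> \<inter> U)" using U by (simp add: subspace_inter subspace_orthogonal_comp)
  have "linear h" unfolding h_def
    by (intro linear_compose_add linear_closest_point S SU subspace_orthogonal_comp
        linear_compose[unfolded o_def, OF _ f(1)] linear_compose[unfolded o_def, OF _ g(1)])
  have in1: "f (closest_point S x) \<in> T" for x
    using f(2) closest_point_subspace_in[OF S(1)] by blast
  have in2: "g (closest_point (S\<^sup>\<bottom> \<inter> U) x) \<in> T\<^sup>\<bottom> \<inter> U" for x
    using g(2) closest_point_subspace_in[OF SU] by blast
  have in3: "closest_point (U\<^sup>\<bottom>) x \<in> U\<^sup>\<bottom>" for x
    using closest_point_subspace_in[OF subspace_orthogonal_comp] by blast
  have sq: "(norm (a + b + c))\<^sup>2 = (norm a)\<^sup>2 + (norm b)\<^sup>2 + (norm c)\<^sup>2"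
    if "R \<subseteq> U" "a \<in> R" "b \<in> R\<^sup>\<bottom> \<inter> U" "c \<in> U\<^sup>\<bottom>" for a b c :: "real^'n" and R
  proof -
    have "a \<bullet> b = 0" "a \<bullet> c = 0" "b \<bullet> c = 0"
      using that by (auto simp: orthogonal_comp_def orthogonal_def)
    then show ?thesis unfolding power2_norm_eq_inner by (simp add: algebra_simps inner_commute)
  qed
  have "norm (h x) = norm x" for x
  proof -
    have x: "x = closest_point S x + closest_point (S\<^sup>\<bottom> \<inter> U) x + closest_point (U\<^sup>\<bottom>) x"
      by (simp add: closest_point_relative_orthogonal_comp[OF S(1) U S(2)] closest_point_orthogonal_comp[OF U])
    have "(norm (h x))\<^sup>2 = (norm (f (closest_point S x)))\<^sup>2 + (norm (g (closest_point (S\<^sup>\<bottom> \<inter> U) x)))\<^sup>2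
        + (norm (closest_point (U\<^sup>\<bottom>) x))\<^sup>2"
      unfolding h_def by (rule sq[OF T(2) in1 in2 in3])
    also have "\<dots> = (norm x)\<^sup>2"
      by (subst (4) x, subst sq[OF S(2) _ _ in3])
        (use f(3) g(3) closest_point_subspace_in[OF S(1)] closest_point_subspace_in[OF SU] in auto)
    finally show ?thesis by simp
  qed
  then have "orthogonal_matrix (matrix h)"
    using \<open>linear h\<close> by (intro orthogonal_matrixI_norm) (simp add: matrix_works)
  moreover have "h x = x" if "x \<in> U\<^sup>\<bottom>" for x
  proof -
    have "closest_point S x = 0" "closest_point (S\<^sup>\<bottom> \<inter> U) x = 0"
      using that S SU by (intro closest_point_subspace_eqI;
          auto simp: subspace_0 orthogonal_comp_def orthogonal_def inner_commute)+
    then show ?thesis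
      using that f(1) g(1) closest_point_subspace_refl[OF subspace_orthogonal_comp that]
      by (simp add: h_def linear_0)
  qed
  ultimately have A: "matrix h \<in> orthogonal_group U"
    using \<open>linear h\<close> by (auto simp: orthogonal_group_def matrix_works)
  have "h x = f x" if "x \<in> S" for x
  proof -
    have "closest_point S x = x" "closest_point U x = x" using that S(2) by (auto intro: closest_point_self)
    then show ?thesis
      using g(1) by (simp add: h_def linear_0 closest_point_relative_orthogonal_comp[OF S(1) U S(2)]
        closest_point_orthogonal_comp[OF U])
  qed
  then have "(*v) (matrix h) ` S = T"
    using f(2) \<open>linear h\<close> by (simp add: matrix_works cong: image_cong_simp)
  with A show thesis using that by blast
qed

text \<open>The reflection in the hyperplane orthogonal to \<open>u\<close>. It is not normalised:
  the formula is Borel in \<open>u\<close> and gives the identity at \<open>u = 0\<close>, so it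
  provides a measurable choice of an isometry moving one unit vector to another.\<close>

definition householder :: "real^'n \<Rightarrow> real^'n^'n" where
  "householder u = matrix (\<lambda>x. x - (2 * (u \<bullet> x) / (u \<bullet> u)) *\<^sub>R u)"

lemma householder_mult: "householder u *v x = x - (2 * (u \<bullet> x) / (u \<bullet> u)) *\<^sub>R u"
proof -
  have "linear (\<lambda>x. x - (2 * (u \<bullet> x) / (u \<bullet> u)) *\<^sub>R u)"
    by (rule linearI) (auto simp: algebra_simps add_divide_distrib)
  then show ?thesis by (simp add: householder_def matrix_works)
qed

lemma householder_in_orthogonal_group:
  assumes "u \<in> U"
  shows "householder u \<in> orthogonal_group U"
proof -
  have "norm (householder u *v x) = norm x" for x
  proof (cases "u = 0")
    case False
    define a where "a = 2 * (u \<bullet> x) / (u \<bullet> u)"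
    have a: "a * (u \<bullet> u) = 2 * (u \<bullet> x)" using False by (simp add: a_def)
    have "(norm (x - a *\<^sub>R u))\<^sup>2 = x \<bullet> x - 2 * a * (u \<bullet> x) + a * (a * (u \<bullet> u))"
      unfolding power2_norm_eq_inner by (simp add: algebra_simps inner_commute)
    also have "\<dots> = (norm x)\<^sup>2" unfolding a by (simp add: power2_norm_eq_inner)
    finally show ?thesis by (simp add: householder_mult a_def)
  qed (simp add: householder_mult)
  then show ?thesis
    using assms by (auto simp: orthogonal_group_def householder_mult orthogonal_comp_def orthogonal_def
        intro!: orthogonal_matrixI_norm)
qed

text \<open>Equal norms give 2 (x - y) \<bullet> y = - (x - y) \<bullet> (x - y), so the reflection
  adds exactly x - y to y.\<close>

lemma householder_swap:
  assumes "norm x = norm y"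
  shows "householder (x - y) *v y = x"
proof (cases "x = y")
  case False
  have "2 * ((x - y) \<bullet> y) = - ((x - y) \<bullet> (x - y))"
    using assms by (simp add: algebra_simps inner_commute norm_eq)
  then show ?thesis using False by (simp add: householder_mult)
qed (simp add: householder_mult)

section \<open>Lebesgue measure on subspaces\<close>

text \<open>The push-forward of \<open>subspace_lborel\<close> with the basis as an argument. The
  choice made there becomes harmless once \<open>basis_lborel_cong\<close> shows that only the span
  of an orthonormal basis matters.\<close>

definition basis_lborel :: "'a::euclidean_space set \<Rightarrow> 'a measure" where
  "basis_lborel B = distr (\<Pi>\<^sub>M b\<in>B. lborel) borel (\<lambda>c. \<Sum>b\<in>B. c b *\<^sub>R b)"

definition orthonormal :: "'a::euclidean_space set \<Rightarrow> bool" where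
  "orthonormal B \<longleftrightarrow> pairwise orthogonal B \<and> (\<forall>b\<in>B. norm b = 1)"

lemma orthonormal_independent: "orthonormal B \<Longrightarrow> independent B"
  unfolding orthonormal_def by (intro pairwise_orthogonal_independent) auto

lemma orthonormal_finite: "orthonormal B \<Longrightarrow> finite B"
  by (rule independent_imp_finite[OF orthonormal_independent])

lemma orthonormal_card: "orthonormal B \<Longrightarrow> card B = dim (span B)"
  by (simp add: dim_eq_card_independent orthonormal_independent)

lemma orthonormal_inner:
  "orthonormal B \<Longrightarrow> b \<in> B \<Longrightarrow> b' \<in> B \<Longrightarrow> b \<bullet> b' = (if b = b' then 1 else 0)"
  by (auto simp: orthonormal_def pairwise_def orthogonal_def norm_eq_1)

lemma orthonormal_sum_inner:
  assumes "orthonormal B" "b \<in> B"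
  shows "(\<Sum>b\<in>B. c b *\<^sub>R b) \<bullet> b = c b"
proof -
  have "(\<Sum>b\<in>B. c b *\<^sub>R b) \<bullet> b = (\<Sum>b'\<in>B. if b' = b then c b else 0)"
    unfolding inner_sum_left by (intro sum.cong) (auto simp: orthonormal_inner[OF assms(1) _ assms(2)])
  then show ?thesis using assms(2) orthonormal_finite[OF assms(1)] by simp
qed

lemma orthonormal_norm_sum:
  assumes "orthonormal B"
  shows "(norm (\<Sum>b\<in>B. c b *\<^sub>R b))\<^sup>2 = (\<Sum>b\<in>B. (c b)\<^sup>2)"
  unfolding power2_norm_eq_inner inner_sum_right inner_scaleR_right
  by (intro sum.cong refl) (simp add: orthonormal_sum_inner[OF assms] power2_eq_square)

lemma orthonormal_expand:
  assumes "orthonormal B" "x \<in> span B"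
  shows "x = (\<Sum>b\<in>B. (x \<bullet> b) *\<^sub>R b)"
proof -
  obtain c where c: "x = (\<Sum>b\<in>B. c b *\<^sub>R b)"
    using assms(2) span_finite[OF orthonormal_finite[OF assms(1)]] by auto
  then have "x \<bullet> b = c b" if "b \<in> B" for b
    using orthonormal_sum_inner[OF assms(1) that, of c] by simp
  then show ?thesis using c by simp
qed

section \<open>Coordinates: images, translations, decay and the mass of balls\<close>

interpretation lborel_product: product_sigma_finite "\<lambda>_. lborel :: real measure"
  by standard

text \<open>Serves two purposes: renaming the coordinates along \<open>k\<close>, for images of
  bases, and shifting each coordinate, for translations. Boxes determine the product measure, and
  the preimage of a box is a box with sides of the same measure.\<close>

lemma distr_PiM_lborel:
  fixes t :: "'b \<Rightarrow> real \<Rightarrow> real"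
  assumes C: "finite C" and k: "bij_betw k C B"
    and t: "\<And>y. y \<in> C \<Longrightarrow> t y \<in> borel_measurable borel"
      "\<And>y. y \<in> C \<Longrightarrow> distr lborel borel (t y) = lborel"
  shows "distr (\<Pi>\<^sub>M b\<in>B. lborel) (\<Pi>\<^sub>M y\<in>C. lborel) (\<lambda>c. \<lambda>y\<in>C. t y (c (k y))) = (\<Pi>\<^sub>M y\<in>C. lborel)"
proof (rule lborel_product.PiM_eqI[OF C])
  have B: "finite B" using bij_betw_finite[OF k] C by simp
  have kB: "k y \<in> B" if "y \<in> C" for y using bij_betwE[OF k] that by blast
  have meas: "(\<lambda>c. \<lambda>y\<in>C. t y (c (k y))) \<in> measurable (\<Pi>\<^sub>M b\<in>B. lborel) (\<Pi>\<^sub>M y\<in>C. lborel)"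
    using t(1) kB by (intro measurable_restrict) (auto intro!: measurable_compose[OF measurable_component_singleton])
  show "sets (distr (Pi\<^sub>M B (\<lambda>b. lborel)) (Pi\<^sub>M C (\<lambda>y. lborel)) (\<lambda>c. \<lambda>y\<in>C. t y (c (k y)))) = sets (Pi\<^sub>M C (\<lambda>_. lborel))"
    by simp
  fix A :: "'b \<Rightarrow> real set" assume A: "\<And>i. i \<in> C \<Longrightarrow> A i \<in> sets lborel"
  define A' where "A' b = t (the_inv_into C k b) -` A (the_inv_into C k b)" for b
  have ki: "the_inv_into C k (k y) = y" if "y \<in> C" for y
    using k that by (simp add: bij_betw_def the_inv_into_f_f)
  have eq: "(\<lambda>c. \<lambda>y\<in>C. t y (c (k y))) -` Pi\<^sub>E C A \<inter> space (\<Pi>\<^sub>M b\<in>B. lborel) = Pi\<^sub>E B A'"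
  proof -
    have "(\<forall>y\<in>C. t y (c (k y)) \<in> A y) \<longleftrightarrow> (\<forall>b\<in>B. c b \<in> A' b)" for c
      using k unfolding A'_def bij_betw_def by (auto simp: ki)
    then show ?thesis
      by (auto simp: space_PiM PiE_def Pi_def)
  qed
  have A': "A' (k y) \<in> sets lborel" "emeasure lborel (A' (k y)) = emeasure lborel (A y)" if "y \<in> C" for y
  proof -
    show 1: "A' (k y) \<in> sets lborel"
      using measurable_sets[OF t(1)[OF that], of "A y"] A[OF that] that by (simp add: A'_def ki)
    have "emeasure (distr lborel borel (t y)) (A y) = emeasure lborel (A' (k y))"
      using t(1)[OF that] A[OF that] that by (subst emeasure_distr) (auto simp: A'_def ki)
    then show "emeasure lborel (A' (k y)) = emeasure lborel (A y)"
      by (simp add: t(2)[OF that])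
  qed
  have "emeasure (distr (\<Pi>\<^sub>M b\<in>B. lborel) (\<Pi>\<^sub>M y\<in>C. lborel) (\<lambda>c. \<lambda>y\<in>C. t y (c (k y)))) (Pi\<^sub>E C A)
      = emeasure (\<Pi>\<^sub>M b\<in>B. lborel) (Pi\<^sub>E B A')"
    using A C by (subst emeasure_distr[OF meas]) (auto simp: eq intro!: sets_PiM_I_finite)
  also have "\<dots> = (\<Prod>b\<in>B. emeasure lborel (A' b))"
    using A'(1) k by (intro lborel_product.emeasure_PiM B) (auto simp: bij_betw_def)
  also have "\<dots> = (\<Prod>y\<in>C. emeasure lborel (A' (k y)))"
    by (rule prod.reindex_bij_betw[OF k, symmetric])
  also have "\<dots> = (\<Prod>y\<in>C. emeasure lborel (A y))"
    by (rule prod.cong) (auto simp: A')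
  finally show "emeasure (distr (\<Pi>\<^sub>M b\<in>B. lborel) (\<Pi>\<^sub>M y\<in>C. lborel) (\<lambda>c. \<lambda>y\<in>C. t y (c (k y)))) (Pi\<^sub>E C A)
      = (\<Prod>y\<in>C. emeasure lborel (A y))" .
qed

lemma sets_basis_lborel [simp, measurable_cong]: "sets (basis_lborel B) = sets borel"
  and space_basis_lborel [simp]: "space (basis_lborel B) = UNIV"
  by (simp_all add: basis_lborel_def)

lemma measurable_basis_sum [measurable]:
  fixes B :: "'a::euclidean_space set"
  shows "(\<lambda>c. \<Sum>b\<in>B. c b *\<^sub>R b) \<in> borel_measurable (\<Pi>\<^sub>M b\<in>B. (lborel :: real measure))"
proof (intro borel_measurable_sum borel_measurable_scaleR borel_measurable_const)
  fix b assume "b \<in> B"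
  then show "(\<lambda>c. c b) \<in> borel_measurable (\<Pi>\<^sub>M b\<in>B. (lborel :: real measure))"
    using measurable_component_singleton[of b B "\<lambda>_. lborel :: real measure"] by simp
qed

lemma lborel_eq_basis_lborel: "lborel = basis_lborel Basis"
proof -
  have "(lborel :: real measure) = interval_measure (\<lambda>x. x)"
    by (simp add: lborel_eq_real)
  then show ?thesis by (simp add: lborel_def basis_lborel_def)
qed

lemma AE_basis_lborel: "AE x in basis_lborel B. x \<in> span B"
  unfolding basis_lborel_def
  by (subst AE_distr_iff) (auto intro!: measurable_basis_sum AE_I2 span_sum span_scale intro: span_base)

text \<open>A vector and its image have the same coordinates with respect to B and its image, so no
  determinant appears.\<close>

lemma basis_lborel_image:
  assumes B: "finite B" and f: "inj_on f B" "linear f"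
  shows "basis_lborel (f ` B) = distr (basis_lborel B) borel f"
proof -
  let ?C = "f ` B" and ?k = "the_inv_into B f"
  have fm: "f \<in> borel_measurable borel"
    using f(2) by (intro borel_measurable_continuous_onI linear_continuous_on) (simp add: linear_linear)
  have k: "bij_betw ?k ?C B" using f(1) by (intro bij_betw_the_inv_into) (simp add: bij_betw_def)
  have "basis_lborel ?C = distr (distr (\<Pi>\<^sub>M b\<in>B. lborel) (\<Pi>\<^sub>M y\<in>?C. lborel) (\<lambda>c. \<lambda>y\<in>?C. c (?k y)))
      borel (\<lambda>c. \<Sum>b\<in>?C. c b *\<^sub>R b)"
    using B k by (subst distr_PiM_lborel[where t="\<lambda>_ x. x"]) (auto simp: basis_lborel_def distr_id2)
  also have "\<dots> = distr (\<Pi>\<^sub>M b\<in>B. lborel) borel (\<lambda>c. \<Sum>y\<in>?C. c (?k y) *\<^sub>R y)"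
    by (subst distr_distr) (auto simp: o_def intro!: distr_cong measurable_basis_sum measurable_restrict
        measurable_component_singleton bij_betwE[OF k, rule_format])
  also have "\<dots> = distr (\<Pi>\<^sub>M b\<in>B. lborel) borel (\<lambda>c. f (\<Sum>b\<in>B. c b *\<^sub>R b))"
    using f by (intro distr_cong refl)
      (simp add: sum.reindex the_inv_into_f_f linear_sum linear_scale)
  also have "\<dots> = distr (basis_lborel B) borel f"
    unfolding basis_lborel_def by (subst distr_distr) (auto simp: o_def fm)
  finally show ?thesis .
qed

lemma basis_lborel_translation:
  assumes B: "finite B" and v: "v \<in> span B"
  shows "distr (basis_lborel B) borel (\<lambda>x. v + x) = basis_lborel B"
proof -
  obtain a where a: "v = (\<Sum>b\<in>B. a b *\<^sub>R b)"
    using v span_finite[OF B] by auto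
  have "basis_lborel B = distr (distr (\<Pi>\<^sub>M b\<in>B. lborel) (\<Pi>\<^sub>M y\<in>B. lborel) (\<lambda>c. \<lambda>y\<in>B. a y + c (id y)))
      borel (\<lambda>c. \<Sum>b\<in>B. c b *\<^sub>R b)"
    using B by (subst distr_PiM_lborel[where t="\<lambda>y x. a y + x" and k=id]) (auto simp: basis_lborel_def lborel_distr_plus)
  also have "\<dots> = distr (\<Pi>\<^sub>M b\<in>B. lborel) borel (\<lambda>c. \<Sum>y\<in>B. (a y + c y) *\<^sub>R y)"
    by (subst distr_distr) (auto simp: o_def intro!: distr_cong measurable_basis_sum measurable_restrict)
  also have "\<dots> = distr (\<Pi>\<^sub>M b\<in>B. lborel) borel (\<lambda>c. v + (\<Sum>b\<in>B. c b *\<^sub>R b))"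
    by (simp add: a scaleR_add_left sum.distrib)
  also have "\<dots> = distr (basis_lborel B) borel (\<lambda>x. v + x)"
    unfolding basis_lborel_def by (subst distr_distr) (auto simp: o_def)
  finally show ?thesis by simp
qed

lemma integrable_inverse_one_plus_square: "integrable lborel (\<lambda>x::real. inverse (1 + x\<^sup>2))"
  using integrable_inverse_1_plus_square by (simp add: set_integrable_def)

text \<open>The product of the factors 1 + c_b^2 over B is at most (1 + |y|^2)^(card B), because
  |y|^2 is the sum of all c_b^2. So the function lies below a product of integrable functions of one
  variable.\<close>

lemma integrable_basis_lborel_decay:
  assumes B: "orthonormal B" and K: "card B \<le> K"
  shows "integrable (basis_lborel B) (\<lambda>y. inverse ((1 + (norm y)\<^sup>2) ^ K))"
proof -
  have 1: "integrable (\<Pi>\<^sub>M b\<in>B. lborel) (\<lambda>c. \<Prod>b\<in>B. inverse (1 + (c b :: real)\<^sup>2))"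
    by (rule lborel_product.product_integrable_prod[where f="\<lambda>_ x. inverse (1 + x\<^sup>2)", OF orthonormal_finite[OF B]])
      (rule integrable_inverse_one_plus_square)
  have "integrable (\<Pi>\<^sub>M b\<in>B. lborel) (\<lambda>c. inverse ((1 + (norm (\<Sum>b\<in>B. c b *\<^sub>R b))\<^sup>2) ^ K))"
  proof (rule Bochner_Integration.integrable_bound[OF 1])
    show "AE c in \<Pi>\<^sub>M b\<in>B. lborel. norm (inverse ((1 + (norm (\<Sum>b\<in>B. c b *\<^sub>R b))\<^sup>2) ^ K))
        \<le> norm (\<Prod>b\<in>B. inverse (1 + (c b)\<^sup>2))"
    proof (rule AE_I2)
      fix c :: "'a \<Rightarrow> real"
      let ?s = "1 + (\<Sum>b\<in>B. (c b)\<^sup>2)"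
      have s: "1 \<le> ?s" by (simp add: sum_nonneg)
      have "(\<Prod>b\<in>B. 1 + (c b)\<^sup>2) \<le> (\<Prod>b\<in>B. ?s)"
        using orthonormal_finite[OF B] by (intro prod_mono) (auto intro!: member_le_sum)
      also have "\<dots> \<le> ?s ^ K" using s K by (simp add: power_increasing)
      finally have "inverse (?s ^ K) \<le> inverse (\<Prod>b\<in>B. 1 + (c b)\<^sup>2)"
        by (intro le_imp_inverse_le prod_pos) (auto simp: add_pos_nonneg)
      then show "norm (inverse ((1 + (norm (\<Sum>b\<in>B. c b *\<^sub>R b))\<^sup>2) ^ K)) \<le> norm (\<Prod>b\<in>B. inverse (1 + (c b)\<^sup>2))"
        using s by (simp add: orthonormal_norm_sum[OF B] prod_inversef[unfolded o_def] abs_prod)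
    qed
  qed measurable
  then show ?thesis unfolding basis_lborel_def by (subst integrable_distr_eq) measurable
qed

text \<open>On a ball the integrable function of \<open>integrable_basis_lborel_decay\<close> is
  bounded below by a positive constant.\<close>

lemma basis_lborel_ball_finite:
  assumes B: "orthonormal B"
  shows "emeasure (basis_lborel B) (cball 0 r) < \<infinity>"
proof -
  have "integrable (basis_lborel B) (indicator (cball 0 r) :: 'a \<Rightarrow> real)"
  proof (rule Bochner_Integration.integrable_bound)
    show "integrable (basis_lborel B) (\<lambda>y. (1 + r\<^sup>2) ^ card B * inverse ((1 + (norm y)\<^sup>2) ^ card B))"
      by (intro integrable_mult_right integrable_basis_lborel_decay B order.refl)
    show "AE y in basis_lborel B. norm (indicator (cball 0 r) y :: real) \<le> norm ((1 + r\<^sup>2) ^ card B * inverse ((1 + (norm y)\<^sup>2) ^ card B))"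
    proof (rule AE_I2)
      fix y :: 'a
      have "(1 + (norm y)\<^sup>2) ^ card B \<le> (1 + r\<^sup>2) ^ card B" if "norm y \<le> r"
        using that by (intro power_mono add_left_mono) auto
      moreover have "0 < 1 + (norm y)\<^sup>2" by (simp add: add_pos_nonneg)
      ultimately show "norm (indicator (cball 0 r) y :: real) \<le> norm ((1 + r\<^sup>2) ^ card B * inverse ((1 + (norm y)\<^sup>2) ^ card B))"
        by (auto simp: indicator_def abs_mult field_simps)
    qed
  qed (simp add: borel_measurable_indicator)
  then show ?thesis by (subst (asm) integrable_indicator_iff) auto
qed

lemma sigma_finite_basis_lborel:
  assumes B: "orthonormal B"
  shows "sigma_finite_measure (basis_lborel B)"
proof
  have "x \<in> (\<Union>n::nat. cball 0 (real n))" for x :: 'a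
    using real_arch_simple[of "norm x"] by auto
  then show "\<exists>A. countable A \<and> A \<subseteq> sets (basis_lborel B) \<and> \<Union> A = space (basis_lborel B) \<and>
      (\<forall>a\<in>A. emeasure (basis_lborel B) a \<noteq> \<infinity>)"
    using basis_lborel_ball_finite[OF B]
    by (intro exI[of _ "range (\<lambda>n::nat. cball 0 (real n))"]) (auto simp: less_top)
qed

lemma basis_lborel_ball_pos:
  assumes B: "orthonormal B" and r: "r > 0" and v: "v \<in> span B"
  shows "emeasure (basis_lborel B) (ball v r) > 0"
proof -
  \<comment> \<open>Half the side of a cube around 0 that fits into the ball of radius r: the norm
    is at most the sum of the \<open>card B\<close> coordinates. The summand 1 makes the inequality
    strict and covers the empty basis.\<close>
  define e where "e = r / (1 + real (card B))"
  have e: "e > 0" using r by (simp add: e_def)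
  have ce: "real (card B) * e < r" using r by (simp add: e_def field_simps)
  have "0 < (\<Prod>b\<in>B. ennreal (2 * e))" using e by (simp add: ennreal_power)
  also have "\<dots> = emeasure (\<Pi>\<^sub>M b\<in>B. lborel) (\<Pi>\<^sub>E b\<in>B. {-e<..<e})"
    using e by (subst lborel_product.emeasure_PiM) (auto simp: orthonormal_finite[OF B])
  also have "\<dots> \<le> emeasure (\<Pi>\<^sub>M b\<in>B. lborel) ((\<lambda>c. \<Sum>b\<in>B. c b *\<^sub>R b) -` ball 0 r \<inter> space (\<Pi>\<^sub>M b\<in>B. lborel))"
  proof (rule emeasure_mono)
    show "(\<Pi>\<^sub>E b\<in>B. {-e<..<e}) \<subseteq> (\<lambda>c. \<Sum>b\<in>B. c b *\<^sub>R b) -` ball 0 r \<inter> space (\<Pi>\<^sub>M b\<in>B. lborel)"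
    proof
      fix c assume c: "c \<in> (\<Pi>\<^sub>E b\<in>B. {-e<..<e})"
      have "norm (\<Sum>b\<in>B. c b *\<^sub>R b) \<le> (\<Sum>b\<in>B. \<bar>c b\<bar>)"
        using B by (intro sum_norm_le) (auto simp: orthonormal_def)
      also have "\<dots> \<le> (\<Sum>b\<in>B. e)" using c by (intro sum_mono) (fastforce simp: PiE_iff)
      also have "\<dots> < r" using ce by simp
      finally show "c \<in> (\<lambda>c. \<Sum>b\<in>B. c b *\<^sub>R b) -` ball 0 r \<inter> space (\<Pi>\<^sub>M b\<in>B. lborel)"
        using c by (auto simp: space_PiM PiE_def)
    qed
  qed measurable
  also have "\<dots> = emeasure (basis_lborel B) (ball 0 r)"
    unfolding basis_lborel_def by (subst emeasure_distr) auto
  also have "\<dots> = emeasure (distr (basis_lborel B) borel (\<lambda>x. v + x)) (ball v r)"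
    by (subst emeasure_distr) (auto simp: vimage_def dist_norm intro!: arg_cong[where f="emeasure _"])
  also have "\<dots> = emeasure (basis_lborel B) (ball v r)"
    by (simp add: basis_lborel_translation orthonormal_finite[OF B] v)
  finally show ?thesis .
qed


text \<open>The uniqueness argument for Haar measures: with C the unit ball, the double integral of
  1_C(y) 1_A(y + x) is N(C) M(A) in one order and M(C) N(A) in the other. Both measures are carried
  by W, so almost every point is an admissible translation.\<close>

lemma translation_invariant_unique:
  fixes M N :: "'a::euclidean_space measure"
  assumes "sigma_finite_measure M" "sigma_finite_measure N"
    and sets: "sets M = sets borel" "sets N = sets borel"
    and AE: "AE x in M. x \<in> W" "AE x in N. x \<in> W"
    and tr: "\<And>v. v \<in> W \<Longrightarrow> distr M borel ((+) v) = M" "\<And>v. v \<in> W \<Longrightarrow> distr N borel ((+) v) = N"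
    and W: "subspace W"
    and ball: "emeasure M (ball 0 1) = emeasure N (ball 0 1)"
      "emeasure M (ball 0 1) \<noteq> 0" "emeasure M (ball 0 1) \<noteq> \<infinity>"
  shows "M = N"
proof (rule measure_eqI)
  interpret M: sigma_finite_measure M by fact
  interpret N: sigma_finite_measure N by fact
  interpret P: pair_sigma_finite N M ..
  note [measurable_cong] = sets
  show "sets M = sets N" by (simp add: sets)
  fix A assume "A \<in> sets M"
  then have [measurable]: "A \<in> sets borel" by (simp add: sets)
  let ?C = "ball 0 1 :: 'a set"
  have [measurable]: "?C \<in> sets borel" by simp
  have trM: "(\<integral>\<^sup>+x. f (v + x) \<partial>M) = (\<integral>\<^sup>+x. f x \<partial>M)" if "v \<in> W" "f \<in> borel_measurable borel" for v f
    by (subst (2) tr(1)[OF that(1), symmetric]) (use that(2) in \<open>simp add: nn_integral_distr\<close>)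
  have trN: "(\<integral>\<^sup>+x. f (v + x) \<partial>N) = (\<integral>\<^sup>+x. f x \<partial>N)" if "v \<in> W" "f \<in> borel_measurable borel" for v f
    by (subst (2) tr(2)[OF that(1), symmetric]) (use that(2) in \<open>simp add: nn_integral_distr\<close>)
  have "emeasure N ?C * emeasure M A = (\<integral>\<^sup>+y. indicator ?C y * (\<integral>\<^sup>+x. indicator A x \<partial>M) \<partial>N)"
    by (subst nn_integral_multc) (auto simp: sets intro!: borel_measurable_indicator)
  also have "\<dots> = (\<integral>\<^sup>+y. indicator ?C y * (\<integral>\<^sup>+x. indicator A (y + x) \<partial>M) \<partial>N)"
    using AE(2) by (intro nn_integral_cong_AE) (auto simp: trM[where f="indicator A"])
  also have "\<dots> = (\<integral>\<^sup>+y. (\<integral>\<^sup>+x. indicator ?C y * indicator A (y + x) \<partial>M) \<partial>N)"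
    by (simp add: nn_integral_cmult)
  also have "\<dots> = (\<integral>\<^sup>+x. (\<integral>\<^sup>+y. indicator ?C y * indicator A (y + x) \<partial>N) \<partial>M)"
    by (rule P.Fubini'[symmetric]) measurable
  also have "\<dots> = (\<integral>\<^sup>+x. (\<integral>\<^sup>+y. indicator ?C (y - x) * indicator A y \<partial>N) \<partial>M)"
    using AE(1)
  proof (intro nn_integral_cong_AE, eventually_elim)
    fix x assume "x \<in> W"
    then show "(\<integral>\<^sup>+y. indicator ?C y * indicator A (y + x) \<partial>N) = (\<integral>\<^sup>+y. indicator ?C (y - x) * indicator A y \<partial>N)"
      using trN[of x "\<lambda>y. indicator ?C (y - x) * indicator A y"] by (simp add: add.commute)
  qed
  also have "\<dots> = (\<integral>\<^sup>+y. (\<integral>\<^sup>+x. indicator ?C (y - x) * indicator A y \<partial>M) \<partial>N)"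
    by (rule P.Fubini') measurable
  \<comment> \<open>The ball is symmetric, so y - x may be replaced by -y + x, to which invariance
    of M applies.\<close>
  also have "\<dots> = (\<integral>\<^sup>+y. indicator A y * (\<integral>\<^sup>+x. indicator ?C (- y + x) \<partial>M) \<partial>N)"
    by (subst nn_integral_cmult[symmetric])
      (auto simp: indicator_def dist_norm norm_minus_commute mult.commute intro!: nn_integral_cong)
  also have "\<dots> = (\<integral>\<^sup>+y. indicator A y * emeasure M ?C \<partial>N)"
    using AE(2)
  proof (intro nn_integral_cong_AE, eventually_elim)
    fix y assume "y \<in> W"
    then have "(\<integral>\<^sup>+x. indicator ?C (- y + x) \<partial>M) = (\<integral>\<^sup>+x. indicator ?C x \<partial>M)"
      using W by (intro trM) (auto simp: subspace_neg intro!: borel_measurable_indicator)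
    then show "indicator A y * (\<integral>\<^sup>+x. indicator ?C (- y + x) \<partial>M) = indicator A y * emeasure M ?C"
      by (simp add: sets)
  qed
  also have "\<dots> = emeasure N A * emeasure M ?C"
    by (subst nn_integral_multc) (auto simp: sets intro!: borel_measurable_indicator)
  finally have "emeasure M ?C * emeasure M A = emeasure M ?C * emeasure N A"
    by (simp add: ball mult.commute)
  then show "emeasure M A = emeasure N A"
    using ball(2,3) by (simp add: ennreal_mult_cancel_left)
qed

text \<open>Both measures are invariant under translations in the common span, so by uniqueness only
  the mass of the unit ball has to be compared. The linear map that carries B to C is isometric on
  the span and maps one measure to the other.\<close>

lemma basis_lborel_cong:
  fixes B C :: "'a::euclidean_space set"
  assumes B: "orthonormal B" and C: "orthonormal C" and sp: "span B = span C"
  shows "basis_lborel B = basis_lborel C"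
proof (rule translation_invariant_unique)
  have fin: "finite B" "finite C" using orthonormal_finite B C by auto
  show "sigma_finite_measure (basis_lborel B)" "sigma_finite_measure (basis_lborel C)"
    using sigma_finite_basis_lborel B C by auto
  show "AE x in basis_lborel B. x \<in> span B" "AE x in basis_lborel C. x \<in> span B"
    using AE_basis_lborel[of B] AE_basis_lborel[of C] sp by auto
  show "distr (basis_lborel B) borel ((+) v) = basis_lborel B"
    "distr (basis_lborel C) borel ((+) v) = basis_lborel C" if "v \<in> span B" for v
    using basis_lborel_translation fin that sp by auto
  have "card B = card C" using orthonormal_card B C sp by metis
  then obtain k where k: "bij_betw k B C" using fin finite_same_card_bij by blast
  have ind: "independent B"
    by (rule orthonormal_independent[OF B])
  obtain F where F: "linear F" "\<And>b. b \<in> B \<Longrightarrow> F b = k b"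
    using linear_independent_extend[OF ind] by metis
  have FB: "F ` B = C" "inj_on F B"
    using k F(2) by (auto simp: bij_betw_def inj_on_def)
  have norm: "norm (F x) = norm x" if "x \<in> span B" for x
  proof -
    have x: "x = (\<Sum>b\<in>B. (x \<bullet> b) *\<^sub>R b)" by (rule orthonormal_expand[OF B that])
    have "F x = (\<Sum>b\<in>B. (x \<bullet> b) *\<^sub>R k b)"
      by (subst x) (simp add: linear_sum[OF F(1)] linear_scale[OF F(1)] F(2))
    also have "\<dots> = (\<Sum>c\<in>C. (x \<bullet> the_inv_into B k c) *\<^sub>R c)"
      using k by (subst sum.reindex_bij_betw[OF k, symmetric])
        (auto intro!: sum.cong simp: bij_betw_def the_inv_into_f_f)
    finally have "(norm (F x))\<^sup>2 = (\<Sum>c\<in>C. (x \<bullet> the_inv_into B k c)\<^sup>2)"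
      using orthonormal_norm_sum[OF C] by simp
    also have "\<dots> = (\<Sum>b\<in>B. (x \<bullet> b)\<^sup>2)"
      using k by (subst sum.reindex_bij_betw[OF k, symmetric])
        (auto intro!: sum.cong simp: bij_betw_def the_inv_into_f_f)
    also have "\<dots> = (norm x)\<^sup>2"
      by (subst (2) x) (simp add: orthonormal_norm_sum[OF B])
    finally show ?thesis by simp
  qed
  have Fm: "F \<in> borel_measurable borel"
    using F(1) by (intro borel_measurable_continuous_onI linear_continuous_on) (simp add: linear_linear)
  have "emeasure (basis_lborel C) (ball 0 1) = emeasure (distr (basis_lborel B) borel F) (ball 0 1)"
    using basis_lborel_image[OF fin(1) FB(2) F(1)] FB(1) by simp
  also have "\<dots> = emeasure (basis_lborel B) (F -` ball 0 1)"
    using Fm by (subst emeasure_distr) auto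
  also have "\<dots> = emeasure (basis_lborel B) (ball 0 1)"
    using AE_basis_lborel[of B] Fm measurable_sets[OF Fm, of "ball 0 1"]
    by (intro emeasure_eq_AE) (auto simp: norm)
  finally show "emeasure (basis_lborel B) (ball 0 1) = emeasure (basis_lborel C) (ball 0 1)" by simp
  show "emeasure (basis_lborel B) (ball 0 1) \<noteq> 0"
    using basis_lborel_ball_pos[OF B, of 1 0] by (simp add: span_zero)
  show "emeasure (basis_lborel B) (ball 0 1) \<noteq> \<infinity>"
    using emeasure_mono[OF ball_subset_cball[of 0 1], of "basis_lborel B"] basis_lborel_ball_finite[OF B, of 1]
    by (auto simp: less_top top_unique)
qed (simp_all)

lemma basis_lborel_Un:
  fixes B C :: "'a::euclidean_space set"
  assumes "orthonormal (B \<union> C)" "B \<inter> C = {}"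
  shows "basis_lborel (B \<union> C) = distr (basis_lborel B \<Otimes>\<^sub>M basis_lborel C) borel (\<lambda>(x, y). x + y)"
proof -
  have on: "orthonormal B" "orthonormal C"
    using assms(1) by (auto simp: orthonormal_def pairwise_def)
  note fin = orthonormal_finite[OF on(1)] orthonormal_finite[OF on(2)]
  let ?PB = "\<Pi>\<^sub>M b\<in>B. (lborel :: real measure)" and ?PC = "\<Pi>\<^sub>M b\<in>C. (lborel :: real measure)"
    and ?S = "\<lambda>B c. \<Sum>b\<in>B. c b *\<^sub>R (b :: 'a)"
  have "basis_lborel (B \<union> C) = distr (distr (?PB \<Otimes>\<^sub>M ?PC) (\<Pi>\<^sub>M b\<in>B \<union> C. lborel) (merge B C)) borel (?S (B \<union> C))"
    using lborel_product.distr_merge[OF assms(2) fin] by (simp add: basis_lborel_def)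
  also have "\<dots> = distr (?PB \<Otimes>\<^sub>M ?PC) borel (?S (B \<union> C) \<circ> merge B C)"
    by (rule distr_distr) measurable
  also have "?S (B \<union> C) \<circ> merge B C = (\<lambda>(x, y). ?S B x + ?S C y)"
    using fin assms(2) by (auto simp: fun_eq_iff sum.union_disjoint merge_def disjoint_iff
        intro!: arg_cong2[where f="(+)"] sum.cong)
  also have "distr (?PB \<Otimes>\<^sub>M ?PC) borel (\<lambda>(x, y). ?S B x + ?S C y)
      = distr (distr (?PB \<Otimes>\<^sub>M ?PC) (borel \<Otimes>\<^sub>M borel) (\<lambda>(x, y). (?S B x, ?S C y))) borel (\<lambda>(x, y). x + y)"
    by (subst distr_distr) (auto simp: o_def split_beta')
  also have "distr (?PB \<Otimes>\<^sub>M ?PC) (borel \<Otimes>\<^sub>M borel) (\<lambda>(x, y). (?S B x, ?S C y))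
      = basis_lborel B \<Otimes>\<^sub>M basis_lborel C"
    unfolding basis_lborel_def
    by (rule pair_measure_distr[symmetric])
      (use sigma_finite_basis_lborel[OF on(2)] in \<open>auto simp: basis_lborel_def\<close>)
  finally show ?thesis .
qed

lemma basis_lborel_gaussian:
  fixes B :: "'a::euclidean_space set"
  assumes B: "orthonormal B"
  shows "integrable (basis_lborel B) (\<lambda>x. exp (- (norm x)\<^sup>2 / 2))"
    and "(\<integral>x. exp (- (norm x)\<^sup>2 / 2) \<partial>basis_lborel B) = sqrt (2 * pi) ^ card B"
proof -
  \<comment> \<open>This is exp (- x^2 / 2), written through the normal density, whose integral is
    known.\<close>
  let ?g = "\<lambda>x::real. sqrt (2 * pi) * std_normal_density x"
  have eq: "exp (- (norm (\<Sum>b\<in>B. c b *\<^sub>R b))\<^sup>2 / 2) = (\<Prod>b\<in>B. ?g (c b))" for c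
  proof -
    have "- (\<Sum>b\<in>B. (c b)\<^sup>2) / 2 = (\<Sum>b\<in>B. - (c b)\<^sup>2 / 2)"
      by (simp add: sum_negf sum_divide_distrib)
    then show ?thesis
      by (simp add: orthonormal_norm_sum[OF B] std_normal_density_def exp_sum orthonormal_finite[OF B] del: sum_divide_distrib)
  qed
  have g: "integrable lborel ?g" "(\<integral>x. ?g x \<partial>lborel) = sqrt (2 * pi)"
    using integrable_normal_density[of 1 0] integral_normal_density[of 1 0] by auto
  have 1: "integrable (\<Pi>\<^sub>M b\<in>B. lborel) (\<lambda>c. exp (- (norm (\<Sum>b\<in>B. c b *\<^sub>R b))\<^sup>2 / 2))"
    unfolding eq by (rule lborel_product.product_integrable_prod[where f="\<lambda>_. ?g", OF orthonormal_finite[OF B]]) (rule g)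
  show "integrable (basis_lborel B) (\<lambda>x. exp (- (norm x)\<^sup>2 / 2))"
    unfolding basis_lborel_def using 1 by (subst integrable_distr_eq) measurable
  have "(\<integral>c. (\<Prod>b\<in>B. ?g (c b)) \<partial>(\<Pi>\<^sub>M b\<in>B. lborel)) = (\<Prod>b\<in>B. (\<integral>x. ?g x \<partial>lborel))"
    by (rule lborel_product.product_integral_prod[where f="\<lambda>_. ?g", OF orthonormal_finite[OF B]]) (rule g)
  moreover have "(\<integral>x. exp (- (norm x)\<^sup>2 / 2) \<partial>basis_lborel B)
      = (\<integral>c. exp (- (norm (\<Sum>b\<in>B. c b *\<^sub>R b))\<^sup>2 / 2) \<partial>(\<Pi>\<^sub>M b\<in>B. lborel))"
    unfolding basis_lborel_def by (rule integral_distr) measurable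
  ultimately show "(\<integral>x. exp (- (norm x)\<^sup>2 / 2) \<partial>basis_lborel B) = sqrt (2 * pi) ^ card B"
    unfolding eq g(2) by simp
qed


section \<open>Lebesgue measure of a subspace, free of the basis\<close>

lemma orthonormal_basis_of_iff: "orthonormal_basis_of W B \<longleftrightarrow> orthonormal B \<and> span B = W"
  by (auto simp: orthonormal_basis_of_def orthonormal_def)

lemma subspace_orthonormal_basis:
  fixes W :: "'a::euclidean_space set"
  assumes "subspace W"
  obtains B where "orthonormal B" "span B = W"
proof -
  obtain B where B: "B \<subseteq> W" "pairwise orthogonal B" "\<And>x. x \<in> B \<Longrightarrow> norm x = 1"
      "independent B" "card B = dim W" "span B = W"
    by (rule orthonormal_basis_subspace[OF assms]) blast
  show thesis using B by (intro that[of B]) (auto simp: orthonormal_def)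
qed

lemma subspace_lborel_eq:
  fixes B :: "(real^'n) set"
  assumes B: "orthonormal B" "span B = W"
  shows "subspace_lborel W = basis_lborel B"
proof -
  have "\<exists>B. orthonormal_basis_of W B"
    using assms by (auto simp: orthonormal_basis_of_iff)
  then have "orthonormal_basis_of W (SOME B. orthonormal_basis_of W B)"
    by (rule someI_ex)
  then show ?thesis
    using basis_lborel_cong[OF B(1), of "SOME B. orthonormal_basis_of W B"] B
    by (auto simp: orthonormal_basis_of_iff subspace_lborel_def basis_lborel_def Let_def)
qed

lemma sets_subspace_lborel [simp, measurable_cong]: "sets (subspace_lborel W) = sets borel"
  and space_subspace_lborel [simp]: "space (subspace_lborel W) = UNIV"
  by (simp_all add: subspace_lborel_def Let_def)

lemma subspace_lborel_basis:
  fixes W :: "(real^'n) set"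
  assumes "subspace W"
  obtains B where "orthonormal B" "span B = W" "card B = dim W" "subspace_lborel W = basis_lborel B"
proof -
  obtain B where B: "orthonormal B" "span B = W" by (rule subspace_orthonormal_basis[OF assms])
  show thesis
    by (rule that[OF B _ subspace_lborel_eq[OF B]]) (simp add: orthonormal_card[OF B(1)] B(2))
qed

lemma sigma_finite_subspace_lborel:
  assumes "subspace W"
  shows "sigma_finite_measure (subspace_lborel W)"
proof -
  obtain B where B: "orthonormal B" "span B = W" "card B = dim W" "subspace_lborel W = basis_lborel B"
    by (rule subspace_lborel_basis[OF assms])
  show ?thesis unfolding B(4) by (rule sigma_finite_basis_lborel[OF B(1)])
qed

lemma AE_subspace_lborel:
  assumes "subspace W"
  shows "AE x in subspace_lborel W. x \<in> W"
proof -
  obtain B where B: "orthonormal B" "span B = W" "card B = dim W" "subspace_lborel W = basis_lborel B"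
    by (rule subspace_lborel_basis[OF assms])
  show ?thesis using AE_basis_lborel[of B] by (simp only: B)
qed

lemma lborel_eq_subspace_lborel: "(lborel :: (real^'n) measure) = subspace_lborel UNIV"
proof -
  have "orthonormal (Basis :: (real^'n) set)"
    by (auto simp: orthonormal_def pairwise_def orthogonal_def inner_Basis)
  then show ?thesis
    using subspace_lborel_eq[of "Basis :: (real^'n) set" UNIV] lborel_eq_basis_lborel[where 'a="real^'n"] by simp
qed

lemma subspace_lborel_ball_pos:
  assumes "subspace W" "v \<in> W" "r > 0"
  shows "emeasure (subspace_lborel W) (ball v r) > 0"
proof -
  obtain B where B: "orthonormal B" "span B = W" "card B = dim W" "subspace_lborel W = basis_lborel B"
    by (rule subspace_lborel_basis[OF assms(1)])
  show ?thesis unfolding B(4) by (rule basis_lborel_ball_pos[OF B(1) assms(3)]) (simp only: B(2) assms(2))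
qed

lemma integrable_subspace_lborel_decay:
  assumes "subspace W" "dim W \<le> K"
  shows "integrable (subspace_lborel W) (\<lambda>y. inverse ((1 + (norm y)\<^sup>2) ^ K))"
proof -
  obtain B where B: "orthonormal B" "span B = W" "card B = dim W" "subspace_lborel W = basis_lborel B"
    by (rule subspace_lborel_basis[OF assms(1)])
  show ?thesis unfolding B(4) by (rule integrable_basis_lborel_decay[OF B(1)]) (simp only: B(3) assms(2))
qed

lemma subspace_lborel_gaussian:
  assumes "subspace W"
  shows "integrable (subspace_lborel W) (\<lambda>x. exp (- (norm x)\<^sup>2 / 2))"
    and "(\<integral>x. exp (- (norm x)\<^sup>2 / 2) \<partial>subspace_lborel W) = sqrt (2 * pi) ^ dim W"
proof -
  obtain B where B: "orthonormal B" "span B = W" "card B = dim W" "subspace_lborel W = basis_lborel B"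
    by (rule subspace_lborel_basis[OF assms])
  show "integrable (subspace_lborel W) (\<lambda>x. exp (- (norm x)\<^sup>2 / 2))"
    and "(\<integral>x. exp (- (norm x)\<^sup>2 / 2) \<partial>subspace_lborel W) = sqrt (2 * pi) ^ dim W"
    unfolding B(4) B(3)[symmetric] by (rule basis_lborel_gaussian[OF B(1)])+
qed

lemma borel_measurable_matrix_vector_mult [measurable]:
  fixes A :: "real^'n^'m"
  shows "(*v) A \<in> borel_measurable borel"
  by (intro borel_measurable_continuous_onI linear_continuous_on) (rule matrix_vector_mul_bounded_linear)

lemma subspace_lborel_image:
  fixes A :: "real^'n^'n"
  assumes A: "orthogonal_matrix A" and W: "subspace W"
  shows "subspace_lborel ((*v) A ` W) = distr (subspace_lborel W) borel ((*v) A)"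
proof -
  obtain B where B: "orthonormal B" "span B = W" by (rule subspace_orthonormal_basis[OF W])
  have inj: "inj_on ((*v) A) B"
    by (rule inj_on_inverseI[of _ "(*v) (transpose A)"]) (rule orthogonal_matrix_inverse[OF A])
  have "orthonormal ((*v) A ` B)"
    using B(1) by (auto simp: orthonormal_def pairwise_def orthogonal_def orthogonal_matrix_norm[OF A]
        orthogonal_matrix_inner(1)[OF A])
  moreover have "span ((*v) A ` B) = (*v) A ` W"
    by (simp add: span_linear_image B(2)[symmetric])
  ultimately have "subspace_lborel ((*v) A ` W) = basis_lborel ((*v) A ` B)"
    by (rule subspace_lborel_eq)
  also have "\<dots> = distr (basis_lborel B) borel ((*v) A)"
    by (rule basis_lborel_image[OF orthonormal_finite[OF B(1)] inj]) simp
  finally show ?thesis by (simp add: subspace_lborel_eq[OF B])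
qed

lemma lborel_orthogonal_image:
  fixes A :: "real^'n^'n"
  assumes A: "orthogonal_matrix A"
  shows "distr lborel borel ((*v) A) = lborel"
proof -
  have "range ((*v) A) = UNIV"
    using orthogonal_matrix_inverse(2)[OF A] by (metis surjI)
  then show ?thesis
    using subspace_lborel_image[OF A subspace_UNIV] by (simp add: lborel_eq_subspace_lborel)
qed

text \<open>Orthonormal bases of V and of its complement in U together form one of U. This is the
  Fubini decomposition behind the slice theorem and behind the change of domain in the Radon
  integral.\<close>

lemma subspace_lborel_sum:
  fixes V U :: "(real^'n) set"
  assumes V: "subspace V" and U: "subspace U" and VU: "V \<subseteq> U"
  shows "subspace_lborel U
    = distr (subspace_lborel V \<Otimes>\<^sub>M subspace_lborel (V\<^sup>\<bottom> \<inter> U)) borel (\<lambda>(x, y). x + y)"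
proof -
  have V': "subspace (V\<^sup>\<bottom> \<inter> U)" using U by (simp add: subspace_inter subspace_orthogonal_comp)
  obtain B where B: "orthonormal B" "span B = V" by (rule subspace_orthonormal_basis[OF V])
  obtain C where C: "orthonormal C" "span C = V\<^sup>\<bottom> \<inter> U" by (rule subspace_orthonormal_basis[OF V'])
  have in_: "b \<in> V" "c \<in> V\<^sup>\<bottom> \<inter> U" if "b \<in> B" "c \<in> C" for b c
    using that span_base[of b B] span_base[of c C] unfolding B(2) C(2) by blast+
  then have orth: "b \<bullet> c = 0" "c \<bullet> b = 0" if "b \<in> B" "c \<in> C" for b c
    using in_[OF that] by (auto simp: orthogonal_comp_def orthogonal_def inner_commute)
  have BC: "orthonormal (B \<union> C)"
    using B(1) C(1) orth by (auto simp: orthonormal_def pairwise_def orthogonal_def)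
  have dj: "B \<inter> C = {}"
    using orth B(1) by (force simp: orthonormal_def)
  have "span (B \<union> C) = U"
  proof
    show "span (B \<union> C) \<subseteq> U"
    proof (rule span_minimal[OF _ U])
      have "B \<subseteq> V" "C \<subseteq> V\<^sup>\<bottom> \<inter> U" using B(2) C(2) span_superset by blast+
      then show "B \<union> C \<subseteq> U" using VU by blast
    qed
    show "U \<subseteq> span (B \<union> C)"
    proof
      fix x assume "x \<in> U"
      then have "x = closest_point V x + closest_point (V\<^sup>\<bottom> \<inter> U) x"
        by (simp add: closest_point_relative_orthogonal_comp[OF V U VU] closest_point_self)
      moreover have "closest_point V x \<in> span B" "closest_point (V\<^sup>\<bottom> \<inter> U) x \<in> span C"
        by (simp_all only: B(2) C(2) closest_point_subspace_in[OF V] closest_point_subspace_in[OF V'])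
      then have "closest_point V x \<in> span (B \<union> C)" "closest_point (V\<^sup>\<bottom> \<inter> U) x \<in> span (B \<union> C)"
        using span_mono[of B "B \<union> C"] span_mono[of C "B \<union> C"] by blast+
      ultimately show "x \<in> span (B \<union> C)"
        using span_add by metis
    qed
  qed
  with basis_lborel_Un[OF BC dj] show ?thesis
    by (simp add: subspace_lborel_eq[OF B] subspace_lborel_eq[OF C] subspace_lborel_eq[OF BC])
qed

section \<open>Invariant measures on orthogonal groups\<close>

lemma continuous_on_matrix_mult [continuous_intros]:
  fixes f :: "'a::topological_space \<Rightarrow> real^'n^'m" and g :: "'a \<Rightarrow> real^'k^'n"
  assumes "continuous_on S f" "continuous_on S g"
  shows "continuous_on S (\<lambda>x. f x ** g x)"
  unfolding matrix_matrix_mult_def using assms by (intro continuous_intros)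

lemma continuous_on_matrix_vector_mult' [continuous_intros]:
  fixes f :: "'a::topological_space \<Rightarrow> real^'n^'m" and g :: "'a \<Rightarrow> real^'n"
  assumes "continuous_on S f" "continuous_on S g"
  shows "continuous_on S (\<lambda>x. f x *v g x)"
  unfolding matrix_vector_mult_def using assms by (intro continuous_intros)

lemma continuous_on_transpose [continuous_intros]:
  fixes f :: "'a::topological_space \<Rightarrow> real^'n^'m"
  assumes "continuous_on S f"
  shows "continuous_on S (\<lambda>x. transpose (f x))"
  unfolding transpose_def using assms by (intro continuous_intros)

lemma borel_measurable_matrix_mult [measurable (raw)]:
  fixes f :: "'a \<Rightarrow> real^'n^'m" and g :: "'a \<Rightarrow> real^'k^'n"
  assumes "f \<in> borel_measurable M" "g \<in> borel_measurable M"
  shows "(\<lambda>x. f x ** g x) \<in> borel_measurable M"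
  by (rule borel_measurable_continuous_Pair[OF assms]) (intro continuous_intros)

lemma borel_measurable_matrix_vector_mult' [measurable (raw)]:
  fixes f :: "'a \<Rightarrow> real^'n^'m" and g :: "'a \<Rightarrow> real^'n"
  assumes "f \<in> borel_measurable M" "g \<in> borel_measurable M"
  shows "(\<lambda>x. f x *v g x) \<in> borel_measurable M"
  by (rule borel_measurable_continuous_Pair[OF assms]) (intro continuous_intros)

lemma borel_measurable_transpose [measurable (raw)]:
  fixes f :: "'a \<Rightarrow> real^'n^'m"
  assumes "f \<in> borel_measurable M"
  shows "(\<lambda>x. transpose (f x)) \<in> borel_measurable M"
  by (rule measurable_compose[OF assms borel_measurable_continuous_onI]) (intro continuous_intros)

text \<open>Displays the reflection as a Borel function of \<open>u\<close>; the scalar factor 2 /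
  (u \<bullet> u) is Borel also across the singular point 0.\<close>

lemma householder_eq: "householder u = mat 1 - (2 / (u \<bullet> u)) *\<^sub>R (\<chi> i j. u $ i * u $ j)"
proof (rule iffD2[OF matrix_eq], rule allI)
  fix x
  have "(\<chi> i j. u $ i * u $ j) *v x = (u \<bullet> x) *\<^sub>R u"
    by (simp add: vec_eq_iff matrix_vector_mult_def inner_vec_def sum_distrib_left sum_distrib_right mult_ac)
  then show "householder u *v x = (mat 1 - (2 / (u \<bullet> u)) *\<^sub>R (\<chi> i j. u $ i * u $ j)) *v x"
    by (simp add: householder_mult matrix_vector_mult_diff_rdistrib scaleR_matrix_vector_assoc[symmetric])
qed

lemma borel_measurable_householder [measurable]: "householder \<in> borel_measurable borel"
proof -
  have [measurable]: "(\<lambda>u::real^'n. \<chi> i j. u $ i * u $ j) \<in> borel_measurable borel"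
    by (intro borel_measurable_continuous_onI continuous_intros)
  show ?thesis unfolding householder_eq[abs_def] by measurable
qed

section \<open>A rotation invariant probability on the ambient space\<close>

lemma lborel_lowdim_null:
  fixes V :: "'a::euclidean_space set"
  assumes "subspace V" "dim V < DIM('a)"
  shows "AE x in lborel. x \<notin> V"
proof -
  have "V \<in> sets lborel" using closed_subspace[OF assms(1)] by auto
  moreover have "emeasure lborel V = 0"
    using negligible_lowdim[OF assms(2)] \<open>V \<in> sets lborel\<close>
    by (simp add: negligible_iff_emeasure0)
  ultimately show ?thesis by (intro AE_not_in) (auto simp: null_sets_def)
qed

text \<open>A source of random directions: projected to a subspace and normalised, such a point is a
  uniformly distributed unit vector. What matters is invariance under isometries and that proper
  subspaces are null sets.\<close>

definition ball_measure :: "(real^'n) measure" where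
  "ball_measure = uniform_measure lborel (ball 0 1)"

lemma sets_ball_measure [simp, measurable_cong]: "sets ball_measure = sets borel"
  and space_ball_measure [simp]: "space ball_measure = UNIV"
  by (simp_all add: ball_measure_def)

lemma lborel_ball_pos_finite: "emeasure lborel (ball 0 1 :: (real^'n) set) \<noteq> 0" "emeasure lborel (ball 0 1 :: (real^'n) set) \<noteq> \<infinity>"
proof -
  show "emeasure lborel (ball 0 1 :: (real^'n) set) \<noteq> 0"
    using subspace_lborel_ball_pos[OF subspace_UNIV UNIV_I zero_less_one, of "0 :: real^'n"]
    unfolding lborel_eq_subspace_lborel by (rule less_imp_neq[symmetric])
  show "emeasure lborel (ball 0 1 :: (real^'n) set) \<noteq> \<infinity>"
    using emeasure_lborel_ball_finite[of "0::real^'n" 1] by (simp add: less_top)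
qed

lemma prob_space_ball_measure: "prob_space ball_measure"
  unfolding ball_measure_def by (rule prob_space_uniform_measure[OF lborel_ball_pos_finite])

lemma distr_ball_measure:
  fixes A :: "real^'n^'n"
  assumes A: "orthogonal_matrix A"
  shows "distr ball_measure borel ((*v) A) = ball_measure"
proof (rule measure_eqI)
  fix X :: "(real^'n) set" assume "X \<in> sets (distr ball_measure borel ((*v) A))"
  then have X [measurable]: "X \<in> sets borel" by simp
  have [measurable]: "ball 0 1 \<in> sets (borel :: (real^'n) measure)" by simp
  have "(*v) A -` X \<in> sets borel" using measurable_sets[OF borel_measurable_matrix_vector_mult X, of A] by simp
  then have "emeasure (distr ball_measure borel ((*v) A)) X
      = emeasure lborel (ball 0 1 \<inter> (*v) A -` X) / emeasure lborel (ball 0 1 :: (real^'n) set)"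
    by (simp add: emeasure_distr ball_measure_def)
  also have "ball 0 1 \<inter> (*v) A -` X = (*v) A -` (ball 0 1 \<inter> X)"
    using orthogonal_matrix_norm[OF A] by auto
  also have "emeasure lborel ((*v) A -` (ball 0 1 \<inter> X)) = emeasure (distr lborel borel ((*v) A)) (ball 0 1 \<inter> X)"
    by (subst emeasure_distr) auto
  finally show "emeasure (distr ball_measure borel ((*v) A)) X = emeasure ball_measure X"
    by (simp add: lborel_orthogonal_image[OF A] ball_measure_def)
qed simp

text \<open>Right invariance is the form in use: an average over g may be rewritten as an average
  over g ** A, and then be averaged over A in a smaller group. The measure lives on the group
  itself, so that statements about \<open>space \<nu>\<close> are statements about group
  elements.\<close>

definition haar :: "(real^'n) set \<Rightarrow> (real^'n^'n) measure \<Rightarrow> bool" where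
  "haar U \<nu> \<longleftrightarrow> prob_space \<nu> \<and> sets \<nu> = sets (restrict_space borel (orthogonal_group U)) \<and>
     (\<forall>B \<in> orthogonal_group U. distr \<nu> \<nu> (\<lambda>A. A ** B) = \<nu>)"

lemma haar_space: "haar U \<nu> \<Longrightarrow> space \<nu> = orthogonal_group U"
  using sets_eq_imp_space_eq[of \<nu> "restrict_space borel (orthogonal_group U)"]
  by (simp add: haar_def space_restrict_space)

lemma haar_measurable_ident:
  fixes U :: "(real^'n) set"
  assumes "haar U \<nu>"
  shows "(\<lambda>A. A) \<in> borel_measurable \<nu>"
proof -
  have sets: "sets \<nu> = sets (restrict_space borel (orthogonal_group U))"
    using assms by (simp add: haar_def)
  show ?thesis
    unfolding measurable_cong_sets[OF sets refl]
    by (rule measurable_restrict_space1) simp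
qed

text \<open>An element of the orthogonal group of \<open>U\<close> is the product of one that fixes the unit vector
  \<open>b \<in> U\<close> and of a reflection that maps a given unit vector of \<open>U\<close> to \<open>b\<close>.\<close>

lemma haar_exists:
  fixes U :: "(real^'n) set"
  assumes "subspace U"
  shows "\<exists>\<nu>. haar U \<nu>"
  using assms
proof (induction "dim U" arbitrary: U)
  case 0
  then have "U = {0}" using dim_eq_0[of U] subspace_0[of U] by auto
  then have O: "orthogonal_group U = {mat 1}"
    by (auto simp: orthogonal_group_def matrix_eq orthogonal_matrix_id)
  let ?\<nu> = "return (restrict_space borel (orthogonal_group U)) (mat 1 :: real^'n^'n)"
  have sp: "space (restrict_space borel (orthogonal_group U)) = orthogonal_group U"
    by (simp add: space_restrict_space)
  have "prob_space ?\<nu>" by (rule prob_space_return) (simp add: sp O)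
  moreover have "distr ?\<nu> ?\<nu> (\<lambda>A. A ** B) = ?\<nu>" if "B \<in> orthogonal_group U" for B
    using that by (simp add: O distr_id2)
  ultimately show ?case by (auto simp: haar_def)
next
  case (Suc d)
  then obtain b where b: "b \<in> U" "norm b = 1"
  proof -
    obtain B where B: "B \<subseteq> U" "\<And>x. x \<in> B \<Longrightarrow> norm x = 1" "card B = dim U"
      by (rule orthonormal_basis_subspace[OF Suc(3)]) blast
    then have "B \<noteq> {}" using Suc(2) by (metis card.empty nat.distinct(1))
    then show thesis using B that by blast
  qed
  define U' where "U' = (span {b})\<^sup>\<bottom> \<inter> U"
  have sU': "subspace U'" using Suc by (simp add: U'_def subspace_inter subspace_orthogonal_comp)
  have sb: "span {b} \<subseteq> U" using b Suc by (intro span_minimal) auto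
  have "b \<noteq> 0" using b by auto
  then have "dim U' = d"
    using dim_relative_orthogonal_comp[OF subspace_span Suc(3) sb] Suc(2)
    by (simp add: U'_def)
  then obtain \<nu>' where \<nu>': "haar U' \<nu>'" using Suc(1) sU' by metis
  have sets': "sets \<nu>' = sets (restrict_space borel (orthogonal_group U'))" using \<nu>' by (simp add: haar_def)
  have OU': "orthogonal_group U' \<subseteq> orthogonal_group U"
    by (rule orthogonal_group_mono) (auto simp: U'_def)
  \<comment> \<open>The stabiliser of b in the group of U is the group of U': a vector orthogonal to
    U' is a multiple of b plus a vector of \<open>U\<^sup>\<bottom>\<close>, and m fixes
    both.\<close>
  have U'perp: "m \<in> orthogonal_group U'" if m: "m \<in> orthogonal_group U" "m *v b = b" for m
  proof -
    have "m *v v = v" if v: "v \<in> U'\<^sup>\<bottom>" for v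
    proof -
      have "v - (v \<bullet> b) *\<^sub>R b \<in> U\<^sup>\<bottom>"
        unfolding orthogonal_comp_def orthogonal_def
      proof safe
        fix u assume u: "u \<in> U"
        have "u - (u \<bullet> b) *\<^sub>R b \<in> U'"
          using u b Suc(3) by (auto simp: U'_def orthogonal_comp_def orthogonal_def span_singleton
              subspace_diff subspace_scale inner_diff_right norm_eq_1 inner_commute)
        then have "(u - (u \<bullet> b) *\<^sub>R b) \<bullet> v = 0"
          using v by (auto simp: orthogonal_comp_def orthogonal_def)
        then show "u \<bullet> (v - (v \<bullet> b) *\<^sub>R b) = 0"
          by (simp add: algebra_simps inner_commute)
      qed
      then have "m *v (v - (v \<bullet> b) *\<^sub>R b) = v - (v \<bullet> b) *\<^sub>R b"
        by (rule orthogonal_groupD(2)[OF m(1)])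
      then show ?thesis using m(2)
        by (simp add: matrix_vector_mult_diff_distrib matrix_vector_mult_scaleR)
    qed
    then show ?thesis using orthogonal_groupD(1)[OF m(1)] by (simp add: orthogonal_group_def)
  qed
  define P where "P = matrix (closest_point U)"
  have P: "P *v x = closest_point U x" for x by (simp add: P_def matrix_closest_point_mult Suc)
  have PU: "P *v x \<in> U" for x by (simp add: P closest_point_subspace_in Suc)
  \<comment> \<open>A random unit vector of U. It is 0 on the null set where the projection of x
    vanishes, which still leaves \<open>s x\<close> in the group.\<close>
  define y where "y x = (P *v x) /\<^sub>R norm (P *v x)" for x
  define s where "s x = householder (b - y x)" for x
  have yU: "y x \<in> U" for x using PU Suc(3) by (simp add: y_def subspace_scale)
  have sO: "s x \<in> orthogonal_group U" for x
    unfolding s_def using b yU Suc(3) by (intro householder_in_orthogonal_group subspace_diff)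
  have [measurable]: "s \<in> borel_measurable borel" unfolding s_def y_def by measurable
  let ?\<tau> = "ball_measure :: (real^'n) measure"
  interpret \<nu>': prob_space \<nu>' using \<nu>' by (simp add: haar_def)
  interpret \<tau>: prob_space ?\<tau> by (rule prob_space_ball_measure)
  interpret pair_sigma_finite \<nu>' ?\<tau> ..
  interpret pair_prob_space \<nu>' ?\<tau> ..
  let ?R = "restrict_space borel (orthogonal_group U) :: (real^'n^'n) measure"
  define \<nu> where "\<nu> = distr (\<nu>' \<Otimes>\<^sub>M ?\<tau>) ?R (\<lambda>(h, x). h ** s x)"
  note [measurable] = haar_measurable_ident[OF \<nu>']
  have mult: "(\<lambda>(h, x). h ** s x) \<in> measurable (\<nu>' \<Otimes>\<^sub>M ?\<tau>) ?R"
    using orthogonal_group_mult[OF subsetD[OF OU'] sO]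
    by (intro measurable_restrict_space2) (auto simp: space_pair_measure haar_space[OF \<nu>'])
  have sets\<nu>: "sets \<nu> = sets ?R" by (simp add: \<nu>_def)
  have sp: "space \<nu> = orthogonal_group U" by (simp add: \<nu>_def space_restrict_space)
  have "distr \<nu> \<nu> (\<lambda>A. A ** B) = \<nu>" if B: "B \<in> orthogonal_group U" for B
  proof (rule measure_eqI)
    fix X assume "X \<in> sets (distr \<nu> \<nu> (\<lambda>A. A ** B))"
    then have X: "X \<in> sets ?R" by (simp add: sets\<nu>)
    have BT: "transpose B \<in> orthogonal_group U" by (rule orthogonal_group_transpose[OF B])
    have Bo: "orthogonal_matrix B" by (rule orthogonal_groupD[OF B])
    have mB: "(\<lambda>A. A ** B) \<in> measurable ?R ?R"
      using B orthogonal_group_mult by (intro measurable_restrict_space3) auto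
    have intX: "emeasure \<nu> {A \<in> orthogonal_group U. A ** C \<in> X}
        = (\<integral>\<^sup>+x. (\<integral>\<^sup>+h. indicator X (h ** s x ** C) \<partial>\<nu>') \<partial>?\<tau>)"
      and meas: "(\<lambda>x. \<integral>\<^sup>+h. indicator X (h ** s x ** C) \<partial>\<nu>') \<in> borel_measurable ?\<tau>"
      if C: "C \<in> orthogonal_group U" for C
    proof -
      have mC: "(\<lambda>A. A ** C) \<in> measurable ?R ?R"
        using C orthogonal_group_mult by (intro measurable_restrict_space3) auto
      have XC: "{A \<in> orthogonal_group U. A ** C \<in> X} \<in> sets ?R"
        using measurable_sets[OF mC X] by (simp add: vimage_def Int_def space_restrict_space conj_commute)
      have m1: "(\<lambda>(h, x). indicator X (h ** s x ** C) :: ennreal) \<in> borel_measurable (\<nu>' \<Otimes>\<^sub>M ?\<tau>)"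
        using measurable_compose[OF measurable_compose[OF mult mC] borel_measurable_indicator[OF X]]
        by (simp add: split_beta')
      have "emeasure \<nu> {A \<in> orthogonal_group U. A ** C \<in> X} = (\<integral>\<^sup>+A. indicator {A \<in> orthogonal_group U. A ** C \<in> X} A \<partial>\<nu>)"
        using XC by (simp add: sets\<nu>)
      also have "\<dots> = (\<integral>\<^sup>+A. indicator X (A ** C) \<partial>\<nu>)"
        by (intro nn_integral_cong) (auto simp: indicator_def sp)
      also have "\<dots> = (\<integral>\<^sup>+z. (case z of (h, x) \<Rightarrow> indicator X (h ** s x ** C)) \<partial>(\<nu>' \<Otimes>\<^sub>M ?\<tau>))"
        unfolding \<nu>_def using measurable_compose[OF mC borel_measurable_indicator[OF X]] mult
        by (subst nn_integral_distr) (auto simp: split_beta')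
      also have "\<dots> = (\<integral>\<^sup>+x. (\<integral>\<^sup>+h. indicator X (h ** s x ** C) \<partial>\<nu>') \<partial>?\<tau>)"
        using m1 by (subst nn_integral_snd[symmetric]) (auto simp: split_beta')
      finally show "emeasure \<nu> {A \<in> orthogonal_group U. A ** C \<in> X}
        = (\<integral>\<^sup>+x. (\<integral>\<^sup>+h. indicator X (h ** s x ** C) \<partial>\<nu>') \<partial>?\<tau>)" .
      show "(\<lambda>x. \<integral>\<^sup>+h. indicator X (h ** s x ** C) \<partial>\<nu>') \<in> borel_measurable ?\<tau>"
        using \<nu>'.borel_measurable_nn_integral[of "\<lambda>x h. indicator X (h ** s x ** C)" ?\<tau>]
          measurable_pair_swap[OF m1] by (simp add: split_beta')
    qed
    have PB: "P *v (transpose B *v x) = transpose B *v (P *v x)" for x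
      using closest_point_orthogonal_image[OF orthogonal_groupD(1)[OF BT] Suc(3), of "transpose B *v x"]
      by (simp add: P orthogonal_group_image[OF BT Suc(3)] orthogonal_matrix_inverse[OF Bo])
    have yB: "y (transpose B *v x) = transpose B *v y x" for x
      using orthogonal_matrix_norm[OF orthogonal_groupD(1)[OF BT]]
      by (simp add: y_def PB matrix_vector_mult_scaleR)
    have sy: "s x *v y x = b" if "P *v x \<noteq> 0" for x
      unfolding s_def using that b by (intro householder_swap) (simp add: y_def)
    have inner: "(\<integral>\<^sup>+h. indicator X (h ** s x ** B) \<partial>\<nu>') = (\<integral>\<^sup>+h. indicator X (h ** s (transpose B *v x)) \<partial>\<nu>')"
      if x: "P *v x \<noteq> 0" for x
    proof -
      let ?x' = "transpose B *v x"
      \<comment> \<open>The factor by which \<open>s x ** B\<close> differs from the reflection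
        \<open>s ?x'\<close> belonging to the rotated point. Both send \<open>y ?x'\<close> to b, so
        m fixes b and is absorbed by the invariance of \<nu>'.\<close>
      define m where "m = s x ** B ** transpose (s ?x')"
      have x': "P *v ?x' \<noteq> 0"
        using x orthogonal_matrix_norm[OF orthogonal_groupD(1)[OF BT], of "P *v x"]
        by (simp add: PB) (metis norm_eq_zero)
      have mU: "m \<in> orthogonal_group U"
        unfolding m_def by (intro orthogonal_group_mult orthogonal_group_transpose sO B)
      have "transpose (s ?x') *v b = y ?x'"
        using sy[OF x'] orthogonal_matrix_inverse(1)[OF orthogonal_groupD(1)[OF sO]] by metis
      then have "m *v b = s x *v (B *v y ?x')"
        by (simp add: m_def flip: matrix_vector_mul_assoc)
      also have "\<dots> = b" by (simp add: yB orthogonal_matrix_inverse[OF Bo] sy[OF x])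
      finally have mU': "m \<in> orthogonal_group U'" by (rule U'perp[OF mU])
      have ms: "m ** s ?x' = s x ** B"
        using orthogonal_groupD(1)[OF sO, of ?x']
        by (simp add: m_def orthogonal_matrix_def flip: matrix_mul_assoc)
      have m2: "(\<lambda>h. indicator X (h ** s ?x') :: ennreal) \<in> borel_measurable \<nu>'"
      proof -
        have "(\<lambda>h. h ** s ?x') \<in> measurable \<nu>' ?R"
          using orthogonal_group_mult[OF subsetD[OF OU'] sO]
          by (intro measurable_restrict_space2) (auto simp: haar_space[OF \<nu>'])
        then show ?thesis using X by measurable
      qed
      have m3: "(\<lambda>h. h ** m) \<in> measurable \<nu>' \<nu>'"
        unfolding measurable_cong_sets[OF sets' sets']
        using mU' orthogonal_group_mult by (intro measurable_restrict_space3) auto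
      have "(\<integral>\<^sup>+h. indicator X (h ** s ?x') \<partial>\<nu>') = (\<integral>\<^sup>+h. indicator X (h ** s ?x') \<partial>distr \<nu>' \<nu>' (\<lambda>h. h ** m))"
        using \<nu>' mU' by (simp add: haar_def)
      also have "\<dots> = (\<integral>\<^sup>+h. indicator X (h ** m ** s ?x') \<partial>\<nu>')"
        using m2 m3 by (subst nn_integral_distr) auto
      finally show ?thesis by (simp add: ms flip: matrix_mul_assoc)
    qed
    \<comment> \<open>The projection to U vanishes on \<open>U\<^sup>\<bottom>\<close> only, a
      proper subspace because dim U is a successor.\<close>
    have AE: "AE x in ?\<tau>. P *v x \<noteq> 0"
    proof -
      have "dim (U\<^sup>\<bottom>) + dim U = dim (UNIV :: (real^'n) set)"
        using dim_relative_orthogonal_comp[OF Suc(3) subspace_UNIV] by simp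
      then have "AE x in lborel. x \<notin> U\<^sup>\<bottom>"
        using Suc(2) by (intro lborel_lowdim_null subspace_orthogonal_comp) simp
      moreover have "x \<in> U\<^sup>\<bottom>" if "P *v x = 0" for x
        using that closest_point_orthogonal_comp[OF Suc(3), of x] closest_point_subspace_in[OF subspace_orthogonal_comp, of U x]
        by (simp add: P)
      ultimately have "AE x in lborel. P *v x \<noteq> 0" by auto
      then show ?thesis unfolding ball_measure_def by (intro AE_uniform_measureI) auto
    qed
    have "emeasure (distr \<nu> \<nu> (\<lambda>A. A ** B)) X = emeasure \<nu> ((\<lambda>A. A ** B) -` X \<inter> space \<nu>)"
    proof (rule emeasure_distr)
      show "(\<lambda>A. A ** B) \<in> \<nu> \<rightarrow>\<^sub>M \<nu>" unfolding measurable_cong_sets[OF sets\<nu> sets\<nu>] by (rule mB)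
      show "X \<in> sets \<nu>" unfolding sets\<nu> by (rule X)
    qed
    also have "(\<lambda>A. A ** B) -` X \<inter> space \<nu> = {A \<in> orthogonal_group U. A ** B \<in> X}"
      unfolding sp by blast
    also have "emeasure \<nu> {A \<in> orthogonal_group U. A ** B \<in> X} = (\<integral>\<^sup>+x. (\<integral>\<^sup>+h. indicator X (h ** s x ** B) \<partial>\<nu>') \<partial>?\<tau>)"
      by (rule intX[OF B])
    also have "\<dots> = (\<integral>\<^sup>+x. (\<integral>\<^sup>+h. indicator X (h ** s (transpose B *v x)) \<partial>\<nu>') \<partial>?\<tau>)"
      using AE inner by (intro nn_integral_cong_AE) auto
    \<comment> \<open>B now acts on x alone, where the rotation invariance of the ball measure
      removes it.\<close>
    also have "\<dots> = (\<integral>\<^sup>+x. (\<integral>\<^sup>+h. indicator X (h ** s x) \<partial>\<nu>') \<partial>distr ?\<tau> borel ((*v) (transpose B)))"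
    proof (rule nn_integral_distr[symmetric])
      show "(\<lambda>x. \<integral>\<^sup>+h. indicator X (h ** s x) \<partial>\<nu>') \<in> borel_measurable (distr ?\<tau> borel ((*v) (transpose B)))"
        using meas[OF mat_1_in_orthogonal_group] unfolding distr_ball_measure[OF orthogonal_groupD(1)[OF BT]]
        by simp
      show "(*v) (transpose B) \<in> ?\<tau> \<rightarrow>\<^sub>M borel"
        unfolding measurable_cong_sets[OF sets_ball_measure refl] by (rule borel_measurable_matrix_vector_mult)
    qed
    also have "\<dots> = emeasure \<nu> {A \<in> orthogonal_group U. A ** mat 1 \<in> X}"
      using intX[OF mat_1_in_orthogonal_group] by (simp add: distr_ball_measure[OF orthogonal_groupD(1)[OF BT]])
    also have "{A \<in> orthogonal_group U. A ** mat 1 \<in> X} = X"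
      using sets.sets_into_space[OF X] by (auto simp: space_restrict_space)
    finally show "emeasure (distr \<nu> \<nu> (\<lambda>A. A ** B)) X = emeasure \<nu> X" .
  qed (simp add: sets\<nu>)
  moreover have "prob_space \<nu>" unfolding \<nu>_def by (rule prob_space_distr[OF mult])
  ultimately have "haar U \<nu>" using sets\<nu> by (simp add: haar_def)
  then show ?case by blast
qed


lemma haar_mult_measurable:
  assumes "haar U \<nu>" "B \<in> orthogonal_group U"
  shows "(\<lambda>A. A ** B) \<in> measurable \<nu> \<nu>"
proof -
  have sets: "sets \<nu> = sets (restrict_space borel (orthogonal_group U))"
    using assms by (simp add: haar_def)
  show ?thesis
    unfolding measurable_cong_sets[OF sets sets]
    using assms(2) orthogonal_group_mult by (intro measurable_restrict_space3) auto
qed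

lemma haar_integral_mult:
  fixes F :: "real^'n^'n \<Rightarrow> 'b::{banach, second_countable_topology}"
  assumes \<nu>: "haar U \<nu>" and B: "B \<in> orthogonal_group U" and F: "F \<in> borel_measurable \<nu>"
  shows "(\<integral>A. F (A ** B) \<partial>\<nu>) = (\<integral>A. F A \<partial>\<nu>)"
  using integral_distr[OF haar_mult_measurable[OF \<nu> B] F] \<nu> B by (simp add: haar_def)

lemma norm_matrix_mult_orthogonal:
  fixes A B :: "real^'n^'n"
  assumes "orthogonal_matrix B"
  shows "norm (A ** B) = norm A"
proof -
  have "(A ** B) $ i = transpose B *v (A $ i)" for i
    by (simp add: vec_eq_iff matrix_matrix_mult_def matrix_vector_mult_def transpose_def mult.commute)
  then have "norm ((A ** B) $ i) = norm (A $ i)" for i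
    using orthogonal_matrix_norm[of "transpose B"] assms by simp
  then show ?thesis by (simp add: norm_vec_def)
qed

text \<open>Right translations are isometries for the Euclidean norm of matrices, so all balls of
  radius r centred in the group have equal measure. By compactness finitely many of them cover the
  group; if they were null sets, the total mass would be 0.\<close>

lemma haar_ball_pos:
  fixes \<nu> :: "(real^'n^'n) measure"
  assumes \<nu>: "haar U \<nu>" and r: "r > 0"
  shows "emeasure \<nu> (ball (mat 1) r \<inter> orthogonal_group U) > 0"
proof (rule ccontr)
  assume "\<not> ?thesis"
  then have 0: "emeasure \<nu> (ball (mat 1) r \<inter> orthogonal_group U) = 0" by simp
  interpret prob_space \<nu> using \<nu> by (simp add: haar_def)
  have S: "ball B r \<inter> orthogonal_group U \<in> sets \<nu>" for B
    using \<nu> by (auto simp: haar_def sets_restrict_space)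
  have "ball B r \<inter> orthogonal_group U \<in> null_sets \<nu>" if B: "B \<in> orthogonal_group U" for B
  proof -
    have BT: "transpose B \<in> orthogonal_group U" by (rule orthogonal_group_transpose[OF B])
    have "dist B A = dist (mat 1) (A ** transpose B)" for A
    proof -
      have "mat 1 - A ** transpose B = (B - A) ** transpose B"
        using orthogonal_groupD(1)[OF B]
        by (simp add: matrix_eq orthogonal_matrix_inverse matrix_vector_mult_diff_rdistrib
            flip: matrix_vector_mul_assoc)
      then show ?thesis
        using norm_matrix_mult_orthogonal[OF orthogonal_groupD(1)[OF BT]] by (simp add: dist_norm)
    qed
    then have "ball B r \<inter> orthogonal_group U
        = (\<lambda>A. A ** transpose B) -` (ball (mat 1) r \<inter> orthogonal_group U) \<inter> space \<nu>"
      using BT orthogonal_group_mult by (auto simp: haar_space[OF \<nu>])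
    also have "emeasure \<nu> \<dots> = emeasure (distr \<nu> \<nu> (\<lambda>A. A ** transpose B)) (ball (mat 1) r \<inter> orthogonal_group U)"
      by (rule emeasure_distr[symmetric]) (use haar_mult_measurable[OF \<nu> BT] S in auto)
    also have "\<dots> = 0" using \<nu> BT 0 by (simp add: haar_def)
    finally show ?thesis using S by (simp add: null_sets_def)
  qed
  moreover obtain K where K: "finite K" "K \<subseteq> orthogonal_group U" "orthogonal_group U \<subseteq> (\<Union>B\<in>K. ball B r)"
  proof -
    have "orthogonal_group U \<subseteq> (\<Union>B\<in>orthogonal_group U. ball B r)" using r by force
    then show thesis using that
      by (rule compactE_image[OF compact_orthogonal_group, rotated]) auto
  qed
  ultimately have "(\<Union>B\<in>K. ball B r \<inter> orthogonal_group U) \<in> null_sets \<nu>"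
    by (intro null_sets_UN') (auto simp: countable_finite)
  moreover have "(\<Union>B\<in>K. ball B r \<inter> orthogonal_group U) = space \<nu>"
    using K by (auto simp: haar_space[OF \<nu>])
  ultimately show False using emeasure_space_1 by (simp add: null_sets_def)
qed

section \<open>Functions on the affine Grassmannian\<close>

lemma norm_matrix_vector_mult_le:
  fixes A :: "real^'n^'m"
  shows "norm (A *v x) \<le> norm A * norm x"
proof -
  have "norm (A *v x) = L2_set (\<lambda>i. \<bar>A $ i \<bullet> x\<bar>) UNIV"
    by (simp add: norm_vec_def matrix_vector_mul_component)
  also have "\<dots> \<le> L2_set (\<lambda>i. norm x * norm (A $ i)) UNIV"
    by (rule L2_set_mono, subst mult.commute, rule Cauchy_Schwarz_ineq2) simp
  also have "\<dots> = norm A * norm x"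
    by (simp add: norm_vec_def mult.commute flip: L2_set_right_distrib)
  finally show ?thesis .
qed

lemma invertible_matrix_inv: "invertible A \<Longrightarrow> A ** matrix_inv A = mat 1"
  unfolding invertible_def matrix_inv_def by (rule conjunct1[OF someI_ex])

text \<open>For S within 1/2 of the identity, |x| \<le> 2 |S x|. This gives injectivity, and the
  estimate follows by applying it to (S^-1 - 1) x, whose image under S is - (S - 1) x.\<close>

lemma matrix_near_identity_inverse:
  fixes S :: "real^'n^'n"
  assumes S: "norm (S - mat 1) \<le> 1/2"
  shows "invertible S" "norm ((matrix_inv S - mat 1) *v x) \<le> 2 * norm (S - mat 1) * norm x"
proof -
  have lower: "norm x \<le> 2 * norm (S *v x)" for x
  proof -
    have "x = S *v x - (S - mat 1) *v x" by (simp add: matrix_vector_mult_diff_rdistrib)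
    then have "norm x \<le> norm (S *v x) + norm ((S - mat 1) *v x)"
      by (metis norm_triangle_ineq4)
    also have "norm ((S - mat 1) *v x) \<le> 1/2 * norm x"
      using norm_matrix_vector_mult_le[of "S - mat 1" x] mult_right_mono[OF S norm_ge_zero[of x]] by simp
    finally show ?thesis by simp
  qed
  have "inj ((*v) S)"
  proof (rule injI)
    fix x y assume "S *v x = S *v y"
    then have "S *v (x - y) = 0" by (simp add: matrix_vector_mult_diff_distrib)
    then show "x = y" using lower[of "x - y"] by simp
  qed
  then show inv: "invertible S"
    by (meson invertible_left_inverse matrix_left_invertible_injective)
  have SR: "S ** matrix_inv S = mat 1" using inv by (rule invertible_matrix_inv)
  have "S *v ((matrix_inv S - mat 1) *v x) = - ((S - mat 1) *v x)"
    by (simp add: matrix_vector_mult_diff_rdistrib matrix_vector_mult_diff_distrib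
        matrix_vector_mul_assoc SR)
  then have "norm ((matrix_inv S - mat 1) *v x) \<le> 2 * norm ((S - mat 1) *v x)"
    using lower[of "(matrix_inv S - mat 1) *v x"] by simp
  also have "\<dots> \<le> 2 * (norm (S - mat 1) * norm x)"
    using norm_matrix_vector_mult_le[of "S - mat 1" x] by simp
  finally show "norm ((matrix_inv S - mat 1) *v x) \<le> 2 * norm (S - mat 1) * norm x" by simp
qed

text \<open>Continuity of inversion at the identity, which is the value of the matrix S of the graph
  charts at the centre of the chart.\<close>

lemma tendsto_matrix_inv_identity:
  fixes S :: "'a \<Rightarrow> real^'n^'n"
  assumes S: "(S \<longlongrightarrow> mat 1) F"
  shows "\<forall>\<^sub>F x in F. invertible (S x)" "((\<lambda>x. matrix_inv (S x)) \<longlongrightarrow> mat 1) F"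
proof -
  have ev: "\<forall>\<^sub>F x in F. norm (S x - mat 1) \<le> 1/2"
    using tendstoD[OF S, of "1/2"] by (auto simp: dist_norm elim!: eventually_mono)
  then show "\<forall>\<^sub>F x in F. invertible (S x)"
    by eventually_elim (rule matrix_near_identity_inverse)
  have lim0: "((\<lambda>x. 2 * norm (S x - mat 1)) \<longlongrightarrow> 0) F"
    using S by (auto intro!: tendsto_eq_intros)
  show "((\<lambda>x. matrix_inv (S x)) \<longlongrightarrow> mat 1) F"
  proof (intro vec_tendstoI)
    fix i j
    have "((\<lambda>x. matrix_inv (S x) $ i $ j - mat 1 $ i $ j) \<longlongrightarrow> 0) F"
    proof (rule Lim_null_comparison[OF _ lim0])
      show "\<forall>\<^sub>F x in F. norm (matrix_inv (S x) $ i $ j - mat 1 $ i $ j) \<le> 2 * norm (S x - mat 1)"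
        using ev
      proof eventually_elim
        fix x assume "norm (S x - mat 1) \<le> 1/2"
        have "matrix_inv (S x) $ i $ j - mat 1 $ i $ j = ((matrix_inv (S x) - mat 1) *v axis j 1) $ i"
          by (simp add: matrix_vector_mul_component inner_axis)
        also have "norm \<dots> \<le> norm ((matrix_inv (S x) - mat 1) *v axis j 1)"
          by (rule component_le_norm_cart[unfolded real_norm_def[symmetric]])
        also have "\<dots> \<le> 2 * norm (S x - mat 1) * norm (axis j 1 :: real^'n)"
          by (rule matrix_near_identity_inverse(2)) fact
        finally show "norm (matrix_inv (S x) $ i $ j - mat 1 $ i $ j) \<le> 2 * norm (S x - mat 1)"
          by simp
      qed
    qed
    then show "((\<lambda>x. matrix_inv (S x) $ i $ j) \<longlongrightarrow> mat 1 $ i $ j) F"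
      by (rule LIM_zero_cancel)
  qed
qed

section \<open>Projection matrices as coordinates of planes\<close>

abbreviation pmat :: "(real^'n) set \<Rightarrow> real^'n^'n" where
  "pmat \<sigma> \<equiv> matrix (closest_point \<sigma>)"

lemma range_pmat:
  assumes "subspace \<sigma>"
  shows "range ((*v) (pmat \<sigma>)) = \<sigma>"
proof
  show "range ((*v) (pmat \<sigma>)) \<subseteq> \<sigma>"
    using closest_point_subspace_in[OF assms] by (auto simp: matrix_closest_point_mult[OF assms])
  show "\<sigma> \<subseteq> range ((*v) (pmat \<sigma>))"
  proof
    fix x assume "x \<in> \<sigma>"
    then have "x = pmat \<sigma> *v x" by (simp add: matrix_closest_point_mult[OF assms] closest_point_self)
    then show "x \<in> range ((*v) (pmat \<sigma>))" by (rule range_eqI)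
  qed
qed

text \<open>A plane \<open>\<sigma>'\<close> close to \<open>\<sigma>\<close> is the graph over \<open>\<sigma>\<close> of \<open>P' S\<^sup>-\<^sup>1 - 1\<close>, where \<open>S\<close> agrees on \<open>\<sigma>\<close> with
  the compression of the projection \<open>P'\<close> onto \<open>\<sigma>'\<close> to \<open>\<sigma>\<close>.\<close>

lemma plane_eq_graph_chart:
  fixes \<sigma> \<sigma>' :: "(real^'n) set"
  defines "S \<equiv> pmat \<sigma> ** pmat \<sigma>' ** pmat \<sigma> + (mat 1 - pmat \<sigma>)"
  assumes \<sigma>: "subspace \<sigma>" and \<sigma>': "subspace \<sigma>'" and dim: "dim \<sigma> = dim \<sigma>'" and inv: "invertible S"
  shows "graph_chart \<sigma> (pmat \<sigma>' ** matrix_inv S, y - (pmat \<sigma>' ** matrix_inv S) *v (pmat \<sigma> *v y)) = plane \<sigma>' y"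
proof -
  define P where "P = closest_point \<sigma>"
  define A where "A x = (pmat \<sigma>' ** matrix_inv S) *v x" for x
  note Pm = matrix_closest_point_mult[OF \<sigma>, folded P_def] matrix_closest_point_mult[OF \<sigma>']
  have linP: "linear P" unfolding P_def by (rule linear_closest_point[OF \<sigma>])
  have linA: "linear A" unfolding A_def by (rule matrix_vector_mul_linear)
  have Pin: "P x \<in> \<sigma>" for x unfolding P_def by (rule closest_point_subspace_in[OF \<sigma>])
  have Pid: "x \<in> \<sigma> \<Longrightarrow> P x = x" for x unfolding P_def by (rule closest_point_self)
  have Ain: "A x \<in> \<sigma>'" for x
    by (simp add: A_def Pm closest_point_subspace_in[OF \<sigma>'] flip: matrix_vector_mul_assoc)
  have S_eq: "S *v x = P (closest_point \<sigma>' (P x)) + (x - P x)" for x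
    by (simp add: S_def matrix_vector_mult_add_rdistrib matrix_vector_mult_diff_rdistrib Pm[unfolded P_def] P_def
        flip: matrix_vector_mul_assoc)
  \<comment> \<open>Applying P to S x = u shows that x = S^-1 u lies in \<sigma> itself; there S is
    the compression of the projection onto \<sigma>', so A followed by P is the identity of
    \<sigma>.\<close>
  have PA: "P (A u) = u" if u: "u \<in> \<sigma>" for u
  proof -
    let ?x = "matrix_inv S *v u"
    have Sx: "S *v ?x = u" using invertible_matrix_inv[OF inv] by (simp add: matrix_vector_mul_assoc)
    have "P (S *v ?x) = P (closest_point \<sigma>' (P ?x))"
      unfolding S_eq by (simp add: linear_add[OF linP] linear_diff[OF linP] Pid Pin)
    then have "?x = P ?x" using S_eq[of ?x] Sx Pid[OF u] by simp
    then show ?thesis using S_eq[of ?x] Sx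
      by (simp add: A_def Pm flip: matrix_vector_mul_assoc)
  qed
  have A\<sigma>: "A ` \<sigma> = \<sigma>'"
  proof (rule subspace_dim_equal)
    show "subspace (A ` \<sigma>)" by (rule linear_subspace_image[OF linA \<sigma>])
    have "inj_on A \<sigma>" using PA by (rule inj_on_inverseI)
    then have "dim (A ` \<sigma>) = dim \<sigma>"
      using \<sigma> by (intro dim_image_eq linA) (simp add: span_eq_iff[THEN iffD2])
    then show "dim \<sigma>' \<le> dim (A ` \<sigma>)" by (simp add: dim)
  qed (use \<sigma>' Ain in auto)
  \<comment> \<open>Explains the second chart coordinate: subtracting A (P y) makes the affine graph
    pass through y, namely over u = P y, and the remaining shift by P y is absorbed by
    \<sigma>.\<close>
  have eq: "u + ((A u + (y - A (P y))) - P (A u + (y - A (P y)))) = y + A (u - P y)" if "u \<in> \<sigma>" for u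
    using PA[OF that] PA[OF Pin]
    by (simp add: linear_add[OF linP] linear_diff[OF linP] linear_diff[OF linA])
  have "graph_chart \<sigma> (pmat \<sigma>' ** matrix_inv S, y - (pmat \<sigma>' ** matrix_inv S) *v (pmat \<sigma> *v y))
      = (\<lambda>u. u + ((A u + (y - A (P y))) - P (A u + (y - A (P y))))) ` \<sigma>"
    by (simp add: graph_chart_def Pm(1) flip: P_def A_def)
  also have "\<dots> = (\<lambda>u. y + A (u - P y)) ` \<sigma>" by (rule image_cong[OF refl eq])
  also have "\<dots> = (\<lambda>u. y + A u) ` (\<lambda>u. u - P y) ` \<sigma>" by (simp add: image_image)
  also have "(\<lambda>u. u - P y) ` \<sigma> = \<sigma>"
  proof
    show "(\<lambda>u. u - P y) ` \<sigma> \<subseteq> \<sigma>" using Pin \<sigma> by (auto intro: subspace_diff)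
    show "\<sigma> \<subseteq> (\<lambda>u. u - P y) ` \<sigma>"
    proof
      fix x assume "x \<in> \<sigma>"
      then have "x + P y \<in> \<sigma>" "x = x + P y - P y" using Pin \<sigma> by (auto intro: subspace_add)
      then show "x \<in> (\<lambda>u. u - P y) ` \<sigma>" by blast
    qed
  qed
  also have "(\<lambda>u. y + A u) ` \<sigma> = plane (A ` \<sigma>) y" by (simp add: plane_def image_image)
  finally show ?thesis by (simp add: A\<sigma>)
qed

text \<open>The Grassmannian as a compact set of matrices. Functions of planes thereby become
  functions on a subset of a Euclidean space, where measurability and continuity can be
  discussed.\<close>

definition pmats :: "nat \<Rightarrow> (real^'n^'n) set" where
  "pmats p = pmat ` linear_grassmannian p"

lemma pmat_idem:
  assumes "subspace \<sigma>"
  shows "pmat \<sigma> ** pmat \<sigma> = pmat \<sigma>"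
  using assms by (simp add: matrix_eq matrix_closest_point_mult closest_point_self closest_point_subspace_in
      flip: matrix_vector_mul_assoc)

text \<open>Near (Q, y) the function is the chart expression of f at the centre \<sigma>, composed
  with the coordinates from \<open>plane_eq_graph_chart\<close>. These depend continuously on the
  nearby plane because S tends to the identity.\<close>

lemma smooth_on_grassmannian_continuous:
  fixes f :: "(real^'n) set \<Rightarrow> complex"
  assumes f: "smooth_on_grassmannian p f"
  shows "continuous_on (pmats p \<times> UNIV) (\<lambda>(Q, y). f (plane (range ((*v) Q)) y))"
  unfolding continuous_on_def
proof safe
  fix Q :: "real^'n^'n" and y :: "real^'n"
  assume "Q \<in> pmats p"
  then obtain \<sigma> where \<sigma>: "subspace \<sigma>" "dim \<sigma> = p" and Q: "Q = pmat \<sigma>"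
    by (auto simp: pmats_def linear_grassmannian_def)
  let ?F = "at (Q, y) within pmats p \<times> UNIV"
  define S where "S z = Q ** fst z ** Q + (mat 1 - Q)" for z :: "(real^'n^'n) \<times> (real^'n)"
  define A where "A z = fst z ** matrix_inv (S z)" for z
  define c where "c = f \<circ> graph_chart \<sigma>"
  have "Ck 0 c" using f \<sigma> unfolding smooth_on_grassmannian_def c_def linear_grassmannian_def by blast
  then have c: "continuous_on UNIV c" by simp
  have id: "((\<lambda>z. z) \<longlongrightarrow> (Q, y)) ?F" by (rule tendsto_ident_at)
  have lims: "(fst \<longlongrightarrow> Q) ?F" "(snd \<longlongrightarrow> y) ?F"
    using tendsto_fst[OF id] tendsto_snd[OF id] by simp_all
  have mult: "((\<lambda>z. g z ** h z) \<longlongrightarrow> G ** H) F" if "(g \<longlongrightarrow> G) F" "(h \<longlongrightarrow> H) F"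
    for g h :: "(real^'n^'n) \<times> (real^'n) \<Rightarrow> real^'n^'n" and G H F
    unfolding matrix_matrix_mult_def using that by (intro tendsto_intros)
  have multv: "((\<lambda>z. g z *v h z) \<longlongrightarrow> G *v H) F" if "(g \<longlongrightarrow> G) F" "(h \<longlongrightarrow> H) F"
    for g :: "(real^'n^'n) \<times> (real^'n) \<Rightarrow> real^'n^'n" and h :: "(real^'n^'n) \<times> (real^'n) \<Rightarrow> real^'n" and G H F
    unfolding matrix_vector_mult_def using that by (intro tendsto_intros)
  have "(S \<longlongrightarrow> Q ** Q ** Q + (mat 1 - Q)) ?F"
    unfolding S_def by (intro tendsto_intros mult lims)
  then have S: "(S \<longlongrightarrow> mat 1) ?F" using pmat_idem[OF \<sigma>(1)] by (simp add: Q)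
  have A: "(A \<longlongrightarrow> Q) ?F"
    using mult[OF lims(1) tendsto_matrix_inv_identity(2)[OF S]] unfolding A_def by simp
  have "((\<lambda>z. (A z, snd z - A z *v (Q *v snd z))) \<longlongrightarrow> (Q, y - Q *v (Q *v y))) ?F"
    by (intro tendsto_intros multv A lims)
  then have "((\<lambda>z. c (A z, snd z - A z *v (Q *v snd z))) \<longlongrightarrow> c (Q, y - Q *v (Q *v y))) ?F"
    by (rule isCont_tendsto_compose[rotated]) (use c in \<open>simp add: continuous_on_eq_continuous_at\<close>)
  moreover have "\<forall>\<^sub>F z in ?F. z \<in> pmats p \<times> UNIV" by (simp add: eventually_at_filter)
  then have "\<forall>\<^sub>F z in ?F. c (A z, snd z - A z *v (Q *v snd z)) = (case z of (Q', y') \<Rightarrow> f (plane (range ((*v) Q')) y'))"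
    using tendsto_matrix_inv_identity(1)[OF S]
  proof eventually_elim
    fix z assume z: "invertible (S z)" "z \<in> pmats p \<times> UNIV"
    then obtain \<sigma>' where \<sigma>': "subspace \<sigma>'" "dim \<sigma>' = p" "fst z = pmat \<sigma>'"
      by (auto simp: pmats_def linear_grassmannian_def)
    show "c (A z, snd z - A z *v (Q *v snd z)) = (case z of (Q', y') \<Rightarrow> f (plane (range ((*v) Q')) y'))"
      using plane_eq_graph_chart[OF \<sigma>(1) \<sigma>'(1), of "snd z"] z(1) \<sigma>(2) \<sigma>'
      by (simp add: c_def A_def S_def Q split_beta' range_pmat)
  qed
  ultimately have "((\<lambda>z. case z of (Q', y') \<Rightarrow> f (plane (range ((*v) Q')) y')) \<longlongrightarrow> c (Q, y - Q *v (Q *v y))) ?F"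
    by (rule Lim_transform_eventually)
  moreover have inv1: "invertible (mat 1 :: real^'n^'n)"
    using invertible_def matrix_mul_lid by blast
  then have "matrix_inv (mat 1) = (mat 1 :: real^'n^'n)"
    using invertible_matrix_inv[OF inv1] by simp
  then have "c (Q, y - Q *v (Q *v y)) = f (plane (range ((*v) Q)) y)"
    using plane_eq_graph_chart[OF \<sigma>(1) \<sigma>(1) refl, of y] pmat_idem[OF \<sigma>(1)]
    by (simp add: c_def Q range_pmat[OF \<sigma>(1)] inv1)
  ultimately show "((\<lambda>(Q, y). f (plane (range ((*v) Q)) y)) \<longlongrightarrow> f (plane (range ((*v) Q)) y)) ?F"
    by simp
qed


text \<open>By transitivity it is a single orbit of the compact orthogonal group, acting by
  conjugation.\<close>

lemma pmats_compact: "compact (pmats p :: (real^'n^'n) set)"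
proof (cases "linear_grassmannian p = ({} :: (real^'n) set set)")
  case False
  then obtain \<sigma> :: "(real^'n) set" where \<sigma>: "subspace \<sigma>" "dim \<sigma> = p"
    by (auto simp: linear_grassmannian_def)
  have "pmats p = (\<lambda>A. A ** pmat \<sigma> ** transpose A) ` orthogonal_group UNIV"
  proof (intro equalityI subsetI)
    fix Q :: "real^'n^'n" assume "Q \<in> pmats p"
    then obtain \<tau> where \<tau>: "subspace \<tau>" "dim \<tau> = p" "Q = pmat \<tau>"
      by (auto simp: pmats_def linear_grassmannian_def)
    obtain A where A: "A \<in> orthogonal_group UNIV" "(*v) A ` \<sigma> = \<tau>"
      by (rule orthogonal_group_transitive[OF subspace_UNIV \<sigma>(1) subset_UNIV \<tau>(1) subset_UNIV])
        (simp_all add: \<sigma> \<tau>)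
    have "Q = A ** pmat \<sigma> ** transpose A"
      using matrix_closest_point_orthogonal_image[OF orthogonal_groupD(1)[OF A(1)] \<sigma>(1)] A(2) \<tau>(3) by simp
    then show "Q \<in> (\<lambda>A. A ** pmat \<sigma> ** transpose A) ` orthogonal_group UNIV" using A(1) by blast
  next
    fix Q assume "Q \<in> (\<lambda>A. A ** pmat \<sigma> ** transpose A) ` orthogonal_group UNIV"
    then obtain A where A: "A \<in> orthogonal_group UNIV" "Q = A ** pmat \<sigma> ** transpose A" by blast
    then have "Q = pmat ((*v) A ` \<sigma>)"
      using matrix_closest_point_orthogonal_image[OF orthogonal_groupD(1)[OF A(1)] \<sigma>(1)] by simp
    moreover have "(*v) A ` \<sigma> \<in> linear_grassmannian p"
      using dim_orthogonal_matrix_image[OF orthogonal_groupD(1)[OF A(1)]] \<sigma>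
      by (simp add: linear_grassmannian_def linear_subspace_image)
    ultimately show "Q \<in> pmats p" by (simp add: pmats_def)
  qed
  then show ?thesis
    by (simp add: compact_continuous_image[OF _ compact_orthogonal_group] continuous_intros)
qed (simp add: pmats_def)

text \<open>f as a function of the projection matrix and of any point of the plane, extended by 0 to
  a Borel function on all matrices. The compact set \<open>pmats p\<close> is Borel, so the
  extension costs nothing.\<close>

definition plane_fun :: "nat \<Rightarrow> ((real^'n) set \<Rightarrow> complex) \<Rightarrow> (real^'n^'n) \<times> (real^'n) \<Rightarrow> complex" where
  "plane_fun p f z = (if fst z \<in> pmats p then f (plane (range ((*v) (fst z))) (snd z)) else 0)"

lemma plane_fun_pmat:
  "\<sigma> \<in> linear_grassmannian p \<Longrightarrow> plane_fun p f (pmat \<sigma>, y) = f (plane \<sigma> y)"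
  by (simp add: plane_fun_def pmats_def linear_grassmannian_def range_pmat)

lemma borel_measurable_plane_fun:
  assumes "smooth_on_grassmannian p f"
  shows "plane_fun p f \<in> borel_measurable borel"
proof -
  have cl: "closed (pmats p \<times> UNIV :: ((real^'n^'n) \<times> (real^'n)) set)"
    by (intro closed_Times compact_imp_closed[OF pmats_compact] closed_UNIV)
  have "(\<lambda>z. if z \<in> pmats p \<times> UNIV then f (plane (range ((*v) (fst z))) (snd z)) else 0) \<in> borel_measurable borel"
    using smooth_on_grassmannian_continuous[OF assms]
    by (intro borel_measurable_continuous_on_if borel_closed[OF cl]) (auto simp: split_beta')
  moreover have "(\<lambda>z. if z \<in> pmats p \<times> UNIV then f (plane (range ((*v) (fst z))) (snd z)) else 0) = plane_fun p f"
    by (auto simp: plane_fun_def fun_eq_iff)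
  ultimately show ?thesis by simp
qed

section \<open>Direction, foot and decay\<close>

lemma direction_plane:
  assumes "subspace \<sigma>"
  shows "direction (plane \<sigma> x) = \<sigma>"
proof
  show "direction (plane \<sigma> x) \<subseteq> \<sigma>"
    using assms by (auto simp: direction_def plane_def subspace_diff)
  show "\<sigma> \<subseteq> direction (plane \<sigma> x)"
  proof
    fix u assume "u \<in> \<sigma>"
    then have "x + u \<in> plane \<sigma> x" "x + 0 \<in> plane \<sigma> x" "u = (x + u) - (x + 0)"
      using subspace_0[OF assms] by (auto simp: plane_def)
    then show "u \<in> direction (plane \<sigma> x)" unfolding direction_def by blast
  qed
qed

lemma foot_plane:
  fixes \<sigma> :: "(real^'n) set"
  assumes \<sigma>: "subspace \<sigma>"
  shows "foot (plane \<sigma> x) = x - closest_point \<sigma> x"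
  unfolding foot_def direction_plane[OF \<sigma>]
proof (rule the_equality)
  have perp: "x - closest_point \<sigma> x \<in> \<sigma>\<^sup>\<bottom>"
    using closest_point_subspace_orth[OF \<sigma>] by (auto simp: orthogonal_comp_def orthogonal_def inner_commute)
  have "y = x - closest_point \<sigma> x" if y: "y \<in> \<sigma>\<^sup>\<bottom>" "y \<in> plane \<sigma> x" for y
  proof -
    obtain u where u: "u \<in> \<sigma>" "y = x + u" using y(2) by (auto simp: plane_def)
    have "closest_point \<sigma> x = - u"
      using u y(1) \<sigma>
      by (intro closest_point_subspace_eqI) (auto simp: subspace_neg orthogonal_comp_def orthogonal_def inner_commute)
    then show ?thesis using u by simp
  qed
  moreover have "x + (- closest_point \<sigma> x) \<in> plane \<sigma> x"
    unfolding plane_def using closest_point_subspace_in[OF \<sigma>] \<sigma> by (intro imageI) (simp add: subspace_neg)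
  then have "x - closest_point \<sigma> x \<in> plane \<sigma> x" by simp
  ultimately show eq: "{x - closest_point \<sigma> x} = \<sigma>\<^sup>\<bottom> \<inter> plane \<sigma> x"
    using perp by blast
  show "y = x - closest_point \<sigma> x" if "{y} = \<sigma>\<^sup>\<bottom> \<inter> plane \<sigma> x" for y
    using that unfolding eq[symmetric] by blast
qed

lemma plane_in_affine_grassmannian:
  assumes "\<sigma> \<in> linear_grassmannian p"
  shows "plane \<sigma> x \<in> affine_grassmannian p"
proof -
  have \<sigma>: "subspace \<sigma>" "dim \<sigma> = p" using assms by (auto simp: linear_grassmannian_def)
  have "affine (plane \<sigma> x)"
    using affine_translation[of \<sigma> x] \<sigma>(1) by (simp add: plane_def subspace_imp_affine)
  moreover have "aff_dim (plane \<sigma> x) = int p"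
    using aff_dim_translation_eq[of x \<sigma>] aff_dim_subspace[OF \<sigma>(1)] \<sigma>(2) by (simp add: plane_def)
  ultimately show ?thesis by (simp add: affine_grassmannian_def)
qed

lemma affine_grassmannian_cases:
  fixes l :: "(real^'n) set"
  assumes "l \<in> affine_grassmannian p"
  obtains \<sigma> x where "\<sigma> \<in> linear_grassmannian p" "x \<in> \<sigma>\<^sup>\<bottom>" "l = plane \<sigma> x"
proof -
  have l: "affine l" "aff_dim l = int p" using assms by (auto simp: affine_grassmannian_def)
  then have "l \<noteq> {}" by (auto simp: aff_dim_empty)
  then obtain a where a: "a \<in> l" by blast
  define \<sigma> where "\<sigma> = (\<lambda>u. - a + u) ` l"
  have s: "subspace \<sigma>" unfolding \<sigma>_def using a l(1) by (rule affine_diffs_subspace[rotated])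
  have "aff_dim \<sigma> = int p" unfolding \<sigma>_def using aff_dim_translation_eq[of "- a" l] l(2) by (rule trans)
  then have d: "dim \<sigma> = p" using aff_dim_subspace[OF s] by simp
  have la: "l = plane \<sigma> a" by (simp add: \<sigma>_def plane_def image_image)
  have shift: "plane \<sigma> (a - closest_point \<sigma> a) = plane \<sigma> a"
  proof -
    have c: "closest_point \<sigma> a \<in> \<sigma>" by (rule closest_point_subspace_in[OF s])
    have "(\<lambda>u. - closest_point \<sigma> a + u) ` \<sigma> = \<sigma>"
    proof
      show "(\<lambda>u. - closest_point \<sigma> a + u) ` \<sigma> \<subseteq> \<sigma>" using c s by (auto intro: subspace_diff)
      show "\<sigma> \<subseteq> (\<lambda>u. - closest_point \<sigma> a + u) ` \<sigma>"
      proof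
        fix u assume "u \<in> \<sigma>"
        then have "closest_point \<sigma> a + u \<in> \<sigma>" "u = - closest_point \<sigma> a + (closest_point \<sigma> a + u)"
          using c s by (auto intro: subspace_add)
        then show "u \<in> (\<lambda>u. - closest_point \<sigma> a + u) ` \<sigma>" by blast
      qed
    qed
    then have "(\<lambda>u. a + u) ` (\<lambda>u. - closest_point \<sigma> a + u) ` \<sigma> = (\<lambda>u. a + u) ` \<sigma>" by simp
    then show ?thesis by (simp add: plane_def image_image algebra_simps)
  qed
  show thesis
  proof (rule that)
    show "\<sigma> \<in> linear_grassmannian p" using s d by (simp add: linear_grassmannian_def)
    show "a - closest_point \<sigma> a \<in> \<sigma>\<^sup>\<bottom>"
      using closest_point_subspace_orth[OF s] by (auto simp: orthogonal_comp_def orthogonal_def inner_commute)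
    show "l = plane \<sigma> (a - closest_point \<sigma> a)" by (simp add: shift la)
  qed
qed

text \<open>The inequality (1 + t)^K \<le> 2^K (1 + t^K) reduces the claim to the two seminorms with
  N = 0 and N = 2 K.\<close>

lemma schwartz_decay:
  fixes f :: "(real^'n) set \<Rightarrow> complex"
  assumes "f \<in> schwartz_space p"
  obtains C where "C \<ge> 0" "\<And>l. l \<in> affine_grassmannian p \<Longrightarrow> norm (f l) \<le> C * inverse ((1 + (norm (foot l))\<^sup>2) ^ K)"
proof -
  have bdd: "bdd_above ((\<lambda>l. norm (foot l) ^ N * norm (f l)) ` affine_grassmannian p)" for N
  proof -
    show ?thesis
      \<comment> \<open>The empty list of Lie algebra elements: the seminorm of f itself.\<close>
      using assms[unfolded schwartz_space_def mem_Collect_eq, THEN conjunct2, THEN spec, THEN bspec, of "[]" N]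
      by simp
  qed
  obtain a where a: "\<And>l. l \<in> affine_grassmannian p \<Longrightarrow> norm (f l) \<le> a"
    using bdd[of 0] by (auto simp: bdd_above_def)
  obtain b where b: "\<And>l. l \<in> affine_grassmannian p \<Longrightarrow> norm (foot l) ^ (2 * K) * norm (f l) \<le> b"
    using bdd[of "2 * K"] by (auto simp: bdd_above_def)
  have main: "norm (f l) * (1 + (norm (foot l))\<^sup>2) ^ K \<le> 2 ^ K * (\<bar>a\<bar> + \<bar>b\<bar>)" if l: "l \<in> affine_grassmannian p" for l
  proof -
    let ?t = "(norm (foot l))\<^sup>2"
    have "(1 + ?t) ^ K \<le> (2 * max 1 ?t) ^ K" by (intro power_mono) auto
    also have "\<dots> = 2 ^ K * max 1 ?t ^ K" by (simp add: power_mult_distrib)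
    also have "max 1 ?t ^ K \<le> 1 + ?t ^ K" by (simp add: max_def)
    finally have "(1 + ?t) ^ K \<le> 2 ^ K * (1 + norm (foot l) ^ (2 * K))" by (simp add: power_mult)
    then have "norm (f l) * (1 + ?t) ^ K \<le> norm (f l) * (2 ^ K * (1 + norm (foot l) ^ (2 * K)))"
      by (rule mult_left_mono) simp
    also have "\<dots> = 2 ^ K * (norm (f l) + norm (foot l) ^ (2 * K) * norm (f l))" by (simp add: algebra_simps)
    also have "\<dots> \<le> 2 ^ K * (\<bar>a\<bar> + \<bar>b\<bar>)" using a[OF l] b[OF l] by (intro mult_left_mono) auto
    finally show ?thesis .
  qed
  show thesis
  proof (rule that[of "2 ^ K * (\<bar>a\<bar> + \<bar>b\<bar>)"])
    show "norm (f l) \<le> 2 ^ K * (\<bar>a\<bar> + \<bar>b\<bar>) * inverse ((1 + (norm (foot l))\<^sup>2) ^ K)"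
      if "l \<in> affine_grassmannian p" for l
    proof -
      have "0 < (1 + (norm (foot l))\<^sup>2) ^ K" by (simp add: add_pos_nonneg)
      then show ?thesis using main[OF that] by (simp add: field_simps)
    qed
  qed simp
qed

section \<open>The Radon transform as an average over an orthogonal group\<close>

lemma (in pair_sigma_finite)
  fixes u :: "_ \<Rightarrow> 'c::{real_normed_field, banach, second_countable_topology}" and w :: "_ \<Rightarrow> 'c"
  assumes u: "integrable M1 u" and w: "integrable M2 w"
  shows integrable_pair_mult: "integrable (M1 \<Otimes>\<^sub>M M2) (\<lambda>(x, y). u x * w y)"
    and integral_pair_mult: "(\<integral>z. (case z of (x, y) \<Rightarrow> u x * w y) \<partial>(M1 \<Otimes>\<^sub>M M2)) = integral\<^sup>L M1 u * integral\<^sup>L M2 w"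
proof -
  note [measurable] = borel_measurable_integrable[OF u] borel_measurable_integrable[OF w]
  show *: "integrable (M1 \<Otimes>\<^sub>M M2) (\<lambda>(x, y). u x * w y)"
  proof (rule Fubini_integrable)
    show "(\<lambda>(x, y). u x * w y) \<in> borel_measurable (M1 \<Otimes>\<^sub>M M2)" by measurable
    show "integrable M1 (\<lambda>x. LINT y|M2. norm (case (x, y) of (x, y) \<Rightarrow> u x * w y))"
      using u by (simp add: norm_mult)
    show "AE x in M1. integrable M2 (\<lambda>y. case (x, y) of (x, y) \<Rightarrow> u x * w y)"
      using w by simp
  qed
  have "(\<integral>x. (\<integral>y. u x * w y \<partial>M2) \<partial>M1) = (\<integral>z. (case z of (x, y) \<Rightarrow> u x * w y) \<partial>(M1 \<Otimes>\<^sub>M M2))"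
    by (rule integral_fst[OF *])
  then show "(\<integral>z. (case z of (x, y) \<Rightarrow> u x * w y) \<partial>(M1 \<Otimes>\<^sub>M M2)) = integral\<^sup>L M1 u * integral\<^sup>L M2 w"
    by simp
qed

section \<open>The invariant measure on the p-planes inside a given subspace\<close>

lemma space_sub_grassmannian_algebra:
  "space (sub_grassmannian_algebra p \<eta>) = {\<sigma> \<in> linear_grassmannian p. \<sigma> \<subseteq> \<eta>}"
  by (simp add: sub_grassmannian_algebra_def)

lemma measurable_pmat [measurable]: "pmat \<in> borel_measurable (sub_grassmannian_algebra p \<eta>)"
  unfolding sub_grassmannian_algebra_def by (rule measurable_vimage_algebra1) simp

lemma measurable_sub_grassmannianI:
  assumes "\<And>x. x \<in> space M \<Longrightarrow> g x \<in> linear_grassmannian p \<and> g x \<subseteq> \<eta>"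
    and "(\<lambda>x. pmat (g x)) \<in> borel_measurable M"
  shows "g \<in> measurable M (sub_grassmannian_algebra p \<eta>)"
  unfolding sub_grassmannian_algebra_def
  by (rule measurable_vimage_algebra2) (use assms in auto)

lemma linear_grassmannian_image:
  fixes A :: "real^'n^'n"
  assumes "orthogonal_matrix A" "\<sigma> \<in> linear_grassmannian p"
  shows "(*v) A ` \<sigma> \<in> linear_grassmannian p"
  using assms dim_orthogonal_matrix_image[OF assms(1)]
  by (simp add: linear_grassmannian_def linear_subspace_image)

lemma linear_grassmannian_transitive:
  fixes \<eta> :: "(real^'n) set"
  assumes "subspace \<eta>" "\<sigma> \<in> linear_grassmannian p" "\<sigma> \<subseteq> \<eta>" "\<tau> \<in> linear_grassmannian p" "\<tau> \<subseteq> \<eta>"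
  obtains u where "u \<in> orthogonal_group \<eta>" "(*v) u ` \<sigma> = \<tau>"
proof -
  have "subspace \<sigma>" "subspace \<tau>" "dim \<sigma> = dim \<tau>"
    using assms(2,4) by (auto simp: linear_grassmannian_def)
  then show thesis
    using orthogonal_group_transitive[OF assms(1) _ assms(3) _ assms(5)] that by blast
qed

text \<open>The image of Haar measure under A \<mapsto> A^T \<sigma>. The transpose turns right
  invariance into invariance under isometries acting on planes from the left. Existence ensures that
  the measure selected in \<open>sub_grassmannian_measure\<close> has the required
  properties.\<close>

lemma invariant_prob_exists:
  fixes \<eta> :: "(real^'n) set"
  assumes \<eta>: "subspace \<eta>" and p: "p \<le> dim \<eta>"
  shows "\<exists>\<mu>. is_invariant_prob p \<eta> \<mu>"
proof -
  obtain \<sigma> where "subspace \<sigma>" "\<sigma> \<subseteq> span \<eta>" "dim \<sigma> = p"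
    by (rule choose_subspace_of_subspace[OF p])
  then have \<sigma>: "\<sigma> \<in> linear_grassmannian p" "\<sigma> \<subseteq> \<eta>" "subspace \<sigma>"
    using \<eta> by (auto simp: linear_grassmannian_def span_eq_iff[THEN iffD2])
  obtain \<nu> where \<nu>: "haar \<eta> \<nu>" using haar_exists[OF \<eta>] by blast
  interpret prob_space \<nu> using \<nu> by (simp add: haar_def)
  note [measurable] = haar_measurable_ident[OF \<nu>]
  let ?G = "sub_grassmannian_algebra p \<eta>" and ?g = "\<lambda>A. (*v) (transpose A) ` \<sigma>"
  have T: "transpose A \<in> orthogonal_group \<eta>" if "A \<in> orthogonal_group \<eta>" for A
    by (rule orthogonal_group_transpose[OF that])
  have gm: "?g \<in> measurable \<nu> ?G"
  proof (rule measurable_sub_grassmannianI)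
    show "?g A \<in> linear_grassmannian p \<and> ?g A \<subseteq> \<eta>" if "A \<in> space \<nu>" for A
      using that \<sigma> linear_grassmannian_image[OF orthogonal_groupD(1)[OF T]]
        orthogonal_group_image_subset[OF T \<eta>] by (auto simp: haar_space[OF \<nu>])
    have "(\<lambda>A. transpose A ** pmat \<sigma> ** A) \<in> borel_measurable \<nu>" by measurable
    then show "(\<lambda>A. pmat (?g A)) \<in> borel_measurable \<nu>"
      by (rule measurable_cong[THEN iffD2, rotated])
        (simp add: haar_space[OF \<nu>] matrix_closest_point_orthogonal_image[OF orthogonal_groupD(1)[OF T]] \<sigma>)
  qed
  define \<mu> where "\<mu> = distr \<nu> ?G ?g"
  have sets: "sets \<mu> = sets ?G" by (simp add: \<mu>_def)
  have "distr \<mu> \<mu> (\<lambda>\<sigma>. k ` \<sigma>) = \<mu>" if k: "orthogonal_transformation k" "k ` \<eta> = \<eta>" for k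
  proof -
    \<comment> \<open>k preserves \<eta> but may move vectors of the complement, so it need not
      belong to the group of \<eta>. B agrees with k on \<eta>, hence on all planes in question, and
      is the identity on the complement.\<close>
    define B where "B = matrix k ** pmat \<eta> + (mat 1 - pmat \<eta>)"
    have K: "matrix k *v x = k x" for x
      using k(1) by (simp add: matrix_works orthogonal_transformation_linear)
    have ko: "orthogonal_matrix (matrix k)" using k(1) orthogonal_transformation_matrix by blast
    have Bx: "B *v x = k (closest_point \<eta> x) + (x - closest_point \<eta> x)" for x
      by (simp add: B_def matrix_vector_mult_add_rdistrib matrix_vector_mult_diff_rdistrib K
          matrix_closest_point_mult[OF \<eta>] flip: matrix_vector_mul_assoc)
    have "norm (B *v x) = norm x" for x
    proof -
      let ?y = "closest_point \<eta> x"
      have "k ?y \<in> \<eta>" using k(2) closest_point_subspace_in[OF \<eta>] by blast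
      then have "(norm (B *v x))\<^sup>2 = (norm (k ?y))\<^sup>2 + (norm (x - ?y))\<^sup>2"
        unfolding Bx power2_norm_eq_inner
        using closest_point_subspace_orth[OF \<eta>, of "k ?y" x] by (simp add: algebra_simps inner_commute)
      also have "norm (k ?y) = norm ?y" by (rule orthogonal_transformation_norm[OF k(1)])
      finally have "(norm (B *v x))\<^sup>2 = (norm x)\<^sup>2"
        using closest_point_subspace_pythagoras[OF \<eta>, of x] by simp
      then show ?thesis by simp
    qed
    then have "orthogonal_matrix B" by (rule orthogonal_matrixI_norm)
    moreover have "B *v x = x" if "x \<in> \<eta>\<^sup>\<bottom>" for x
    proof -
      have "closest_point \<eta> x = 0"
        using that \<eta> by (intro closest_point_subspace_eqI) (auto simp: subspace_0 orthogonal_comp_def orthogonal_def inner_commute)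
      then show ?thesis using linear_0[OF orthogonal_transformation_linear[OF k(1)]] by (simp add: Bx)
    qed
    ultimately have B: "B \<in> orthogonal_group \<eta>" by (simp add: orthogonal_group_def)
    have kB: "k ` \<tau> = (*v) B ` \<tau>" if "\<tau> \<subseteq> \<eta>" for \<tau>
      using that by (intro image_cong refl) (auto simp: Bx closest_point_self)
    have km: "(\<lambda>\<tau>. k ` \<tau>) \<in> measurable ?G ?G"
    proof (rule measurable_sub_grassmannianI)
      have k': "k = (*v) (matrix k)" using K by auto
      show "k ` \<tau> \<in> linear_grassmannian p \<and> k ` \<tau> \<subseteq> \<eta>" if "\<tau> \<in> space ?G" for \<tau>
        using that linear_grassmannian_image[OF ko, of \<tau> p] k(2)
        by (auto simp: space_sub_grassmannian_algebra K)
      have "(\<lambda>\<tau>. matrix k ** pmat \<tau> ** transpose (matrix k)) \<in> borel_measurable ?G" by measurable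
      then show "(\<lambda>\<tau>. pmat (k ` \<tau>)) \<in> borel_measurable ?G"
        by (rule measurable_cong[THEN iffD2, rotated])
          (use matrix_closest_point_orthogonal_image[OF ko] in
            \<open>simp add: space_sub_grassmannian_algebra linear_grassmannian_def K\<close>)
    qed
    have "distr \<mu> \<mu> (\<lambda>\<sigma>. k ` \<sigma>) = distr \<mu> ?G (\<lambda>\<sigma>. k ` \<sigma>)"
      by (rule distr_cong) (simp_all add: sets)
    also have "\<dots> = distr \<nu> ?G (\<lambda>A. k ` ?g A)"
      unfolding \<mu>_def by (subst distr_distr[OF km gm]) (simp add: o_def)
    also have "\<dots> = distr \<nu> ?G (\<lambda>A. ?g (A ** transpose B))"
    proof (rule distr_cong)
      fix A assume "A \<in> space \<nu>"
      then have "?g A \<subseteq> \<eta>"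
        using \<sigma> orthogonal_group_image_subset[OF T \<eta>] by (auto simp: haar_space[OF \<nu>])
      then have "k ` ?g A = (*v) B ` ?g A" by (rule kB)
      then show "k ` ?g A = ?g (A ** transpose B)"
        by (simp only: image_image matrix_vector_mul_assoc matrix_transpose_mul transpose_transpose)
    qed simp_all
    also have "\<dots> = distr (distr \<nu> \<nu> (\<lambda>A. A ** transpose B)) ?G ?g"
      by (subst distr_distr[OF gm haar_mult_measurable[OF \<nu> T[OF B]]]) (simp add: o_def)
    also have "\<dots> = \<mu>" using \<nu> T[OF B] by (simp add: haar_def \<mu>_def)
    finally show ?thesis .
  qed
  moreover have "prob_space \<mu>" unfolding \<mu>_def by (rule prob_space_distr[OF gm])
  ultimately show ?thesis using sets unfolding is_invariant_prob_def by blast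
qed

text \<open>Uniqueness of the invariant measure, in integrated form. In the double integral of
  \<Phi> over the rotated planes, the integral over A does not depend on \<tau> by transitivity and
  right invariance, and the integral over \<tau> does not depend on A by invariance of \<mu>. The
  bound on \<Phi> justifies Fubini.\<close>

lemma invariant_prob_integral:
  fixes \<Phi> :: "(real^'n) set \<Rightarrow> complex"
  assumes g: "orthogonal_matrix g" and \<eta>: "subspace \<eta>" and \<sigma>: "\<sigma> \<in> linear_grassmannian p" "\<sigma> \<subseteq> \<eta>"
    and \<mu>: "is_invariant_prob p ((*v) g ` \<eta>) \<mu>" and \<nu>: "haar \<eta> \<nu>"
    and \<Phi>: "\<Phi> \<in> borel_measurable (sub_grassmannian_algebra p ((*v) g ` \<eta>))"
    and bound: "\<And>\<tau>. \<tau> \<in> linear_grassmannian p \<Longrightarrow> \<tau> \<subseteq> (*v) g ` \<eta> \<Longrightarrow> norm (\<Phi> \<tau>) \<le> C"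
  shows "(\<integral>\<tau>. \<Phi> \<tau> \<partial>\<mu>) = (\<integral>A. \<Phi> ((*v) (g ** A) ` \<sigma>) \<partial>\<nu>)"
proof -
  let ?G = "sub_grassmannian_algebra p ((*v) g ` \<eta>)"
  interpret \<nu>: prob_space \<nu> using \<nu> by (simp add: haar_def)
  interpret \<mu>: prob_space \<mu> using \<mu> by (simp add: is_invariant_prob_def)
  interpret P: pair_prob_space \<mu> \<nu> ..
  have sets: "sets \<mu> = sets ?G" using \<mu> by (simp add: is_invariant_prob_def)
  have space: "space \<mu> = {\<tau> \<in> linear_grassmannian p. \<tau> \<subseteq> (*v) g ` \<eta>}"
    using sets_eq_imp_space_eq[OF sets] by (simp add: space_sub_grassmannian_algebra)
  note [measurable] = haar_measurable_ident[OF \<nu>]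
  have [measurable]: "pmat \<in> borel_measurable \<mu>"
    unfolding measurable_cong_sets[OF sets refl] by (rule measurable_pmat)
  \<comment> \<open>Conjugation by g carries the group of \<eta> to isometries that preserve the
    rotated subspace.\<close>
  let ?k = "\<lambda>A. g ** A ** transpose g"
  have gT: "orthogonal_matrix (transpose g)" using g by simp
  have ko: "orthogonal_matrix (?k A)" if "A \<in> orthogonal_group \<eta>" for A
    using orthogonal_groupD(1)[OF that] g by (intro orthogonal_matrix_mul) simp_all
  have gTg: "(*v) (transpose g) ` (*v) g ` X = X" for X
    by (simp add: image_image orthogonal_matrix_inverse[OF g])
  have k\<eta>: "(*v) (?k A) ` (*v) g ` \<eta> = (*v) g ` \<eta>" if "A \<in> orthogonal_group \<eta>" for A
  proof -
    have "(*v) (?k A) ` (*v) g ` \<eta> = (*v) g ` (*v) A ` (*v) (transpose g) ` (*v) g ` \<eta>"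
      by (simp add: image_image flip: matrix_vector_mul_assoc)
    then show ?thesis unfolding gTg using orthogonal_group_image[OF that \<eta>] by simp
  qed
  have kin: "(*v) (?k A) ` \<tau> \<in> linear_grassmannian p \<and> (*v) (?k A) ` \<tau> \<subseteq> (*v) g ` \<eta>"
    if "A \<in> orthogonal_group \<eta>" "\<tau> \<in> space \<mu>" for A \<tau>
    using that linear_grassmannian_image[OF ko[OF that(1)], of \<tau> p] image_mono[of \<tau> "(*v) g ` \<eta>" "(*v) (?k A)"]
      k\<eta>[OF that(1)] by (simp add: space)
  have pk: "pmat ((*v) (?k A) ` \<tau>) = ?k A ** pmat \<tau> ** transpose (?k A)"
    if "A \<in> orthogonal_group \<eta>" "\<tau> \<in> space \<mu>" for A \<tau>
    using that by (intro matrix_closest_point_orthogonal_image ko) (auto simp: space linear_grassmannian_def)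
  have joint: "(\<lambda>(\<tau>, A). (*v) (?k A) ` \<tau>) \<in> measurable (\<mu> \<Otimes>\<^sub>M \<nu>) ?G"
  proof (rule measurable_sub_grassmannianI)
    show "(case z of (\<tau>, A) \<Rightarrow> (*v) (?k A) ` \<tau>) \<in> linear_grassmannian p \<and> (case z of (\<tau>, A) \<Rightarrow> (*v) (?k A) ` \<tau>) \<subseteq> (*v) g ` \<eta>"
      if z: "z \<in> space (\<mu> \<Otimes>\<^sub>M \<nu>)" for z
    proof (cases z)
      case (Pair \<tau> A)
      then show ?thesis using z kin[of A \<tau>] by (simp add: space_pair_measure haar_space[OF \<nu>])
    qed
    have "(\<lambda>z. ?k (snd z) ** pmat (fst z) ** transpose (?k (snd z))) \<in> borel_measurable (\<mu> \<Otimes>\<^sub>M \<nu>)"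
      by measurable
    then show "(\<lambda>z. pmat (case z of (\<tau>, A) \<Rightarrow> (*v) (?k A) ` \<tau>)) \<in> borel_measurable (\<mu> \<Otimes>\<^sub>M \<nu>)"
      by (rule measurable_cong[THEN iffD2, rotated])
        (auto simp: space_pair_measure haar_space[OF \<nu>] pk)
  qed
  have Fm: "(\<lambda>(\<tau>, A). \<Phi> ((*v) (?k A) ` \<tau>)) \<in> borel_measurable (\<mu> \<Otimes>\<^sub>M \<nu>)"
    using measurable_compose[OF joint \<Phi>] by (simp add: split_beta')
  have Fint: "integrable (\<mu> \<Otimes>\<^sub>M \<nu>) (\<lambda>(\<tau>, A). \<Phi> ((*v) (?k A) ` \<tau>))"
  proof (rule P.integrable_const_bound[OF AE_I2 Fm])
    fix z assume z: "z \<in> space (\<mu> \<Otimes>\<^sub>M \<nu>)"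
    show "norm (case z of (\<tau>, A) \<Rightarrow> \<Phi> ((*v) (?k A) ` \<tau>)) \<le> C"
    proof (cases z)
      case (Pair \<tau> A)
      then show ?thesis using z kin[of A \<tau>] bound[of "(*v) (?k A) ` \<tau>"]
        by (simp add: space_pair_measure haar_space[OF \<nu>])
    qed
  qed
  define c where "c = (\<integral>A. \<Phi> ((*v) (g ** A) ` \<sigma>) \<partial>\<nu>)"
  have \<sigma>g: "(*v) g ` \<sigma> \<in> space \<mu>" using \<sigma> linear_grassmannian_image[OF g \<sigma>(1)] by (auto simp: space)
  have base: "(\<lambda>A. \<Phi> ((*v) (g ** A) ` \<sigma>)) \<in> borel_measurable \<nu>"
  proof -
    have "(\<lambda>A. (*v) (?k A) ` (*v) g ` \<sigma>) \<in> measurable \<nu> ?G"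
      using measurable_compose[OF measurable_Pair1'[OF \<sigma>g] joint] by simp
    from measurable_compose[OF this \<Phi>] show ?thesis
      using g by (simp add: image_image matrix_vector_mul_assoc orthogonal_matrix_def flip: matrix_mul_assoc)
  qed
  have inner: "(\<integral>A. \<Phi> ((*v) (?k A) ` \<tau>) \<partial>\<nu>) = c" if \<tau>: "\<tau> \<in> space \<mu>" for \<tau>
  proof -
    have "(*v) (transpose g) ` \<tau> \<subseteq> \<eta>"
      using \<tau> image_mono[of \<tau> "(*v) g ` \<eta>" "(*v) (transpose g)"] gTg by (simp add: space)
    moreover have "(*v) (transpose g) ` \<tau> \<in> linear_grassmannian p"
      using \<tau> by (intro linear_grassmannian_image gT) (simp add: space)
    ultimately obtain u where u: "u \<in> orthogonal_group \<eta>" "(*v) u ` \<sigma> = (*v) (transpose g) ` \<tau>"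
      using \<sigma> linear_grassmannian_transitive[OF \<eta>] by metis
    have "(*v) (?k A) ` \<tau> = (*v) (g ** (A ** u)) ` \<sigma>" for A
    proof -
      have "(*v) (?k A) ` \<tau> = (*v) (g ** A) ` (*v) (transpose g) ` \<tau>"
        by (simp add: image_image matrix_vector_mul_assoc)
      also have "\<dots> = (*v) (g ** A) ` (*v) u ` \<sigma>" by (simp add: u(2))
      finally show ?thesis by (simp add: image_image matrix_vector_mul_assoc matrix_mul_assoc)
    qed
    then have "(\<integral>A. \<Phi> ((*v) (?k A) ` \<tau>) \<partial>\<nu>) = (\<integral>A. \<Phi> ((*v) (g ** (A ** u)) ` \<sigma>) \<partial>\<nu>)" by simp
    also have "\<dots> = c" unfolding c_def by (rule haar_integral_mult[OF \<nu> u(1) base])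
    finally show ?thesis .
  qed
  have outer: "(\<integral>\<tau>. \<Phi> ((*v) (?k A) ` \<tau>) \<partial>\<mu>) = (\<integral>\<tau>. \<Phi> \<tau> \<partial>\<mu>)" if A: "A \<in> space \<nu>" for A
  proof -
    have A': "A \<in> orthogonal_group \<eta>" using A by (simp add: haar_space[OF \<nu>])
    have inv: "distr \<mu> \<mu> (\<lambda>\<tau>. (*v) (?k A) ` \<tau>) = \<mu>"
      using \<mu> k\<eta>[OF A'] orthogonal_transformation_matrix[of "(*v) (?k A)"] ko[OF A']
      unfolding is_invariant_prob_def by simp
    have m: "(\<lambda>\<tau>. (*v) (?k A) ` \<tau>) \<in> measurable \<mu> \<mu>"
      using measurable_compose[OF measurable_Pair2'[OF A] joint]
      unfolding measurable_cong_sets[OF refl sets] by simp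
    have "\<Phi> \<in> borel_measurable \<mu>" unfolding measurable_cong_sets[OF sets refl] by (rule \<Phi>)
    from integral_distr[OF m this] show ?thesis unfolding inv by simp
  qed
  have "(\<integral>\<tau>. \<Phi> \<tau> \<partial>\<mu>) = (\<integral>A. (\<integral>\<tau>. \<Phi> ((*v) (?k A) ` \<tau>) \<partial>\<mu>) \<partial>\<nu>)"
    by (simp add: outer \<nu>.prob_space cong: Bochner_Integration.integral_cong)
  also have "\<dots> = (\<integral>\<tau>. (\<integral>A. \<Phi> ((*v) (?k A) ` \<tau>) \<partial>\<nu>) \<partial>\<mu>)"
    by (rule P.Fubini_integral[OF Fint])
  also have "\<dots> = c"
    by (simp add: inner \<mu>.prob_space cong: Bochner_Integration.integral_cong)
  finally show ?thesis by (simp add: c_def)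
qed


text \<open>
  Replaces the domain \<open>\<sigma>\<^sup>\<bottom> \<inter> \<eta>\<close> by \<open>\<eta>\<close>, which does not depend on \<open>\<sigma>\<close>: this is how the inner integral of
  the Radon transform is seen to be measurable in \<open>\<sigma>\<close>.
\<close>

lemma subspace_lborel_weight:
  fixes \<phi> :: "real^'n \<Rightarrow> complex"
  assumes \<sigma>: "subspace \<sigma>" and \<eta>: "subspace \<eta>" and \<sigma>\<eta>: "\<sigma> \<subseteq> \<eta>"
    and [measurable]: "\<phi> \<in> borel_measurable borel" and \<phi>: "integrable (subspace_lborel (\<sigma>\<^sup>\<bottom> \<inter> \<eta>)) \<phi>"
  shows "(\<integral>x. complex_of_real (exp (- (norm (pmat \<sigma> *v x))\<^sup>2 / 2)) * \<phi> (x - pmat \<sigma> *v x) \<partial>subspace_lborel \<eta>)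
    = complex_of_real (sqrt (2 * pi) ^ dim \<sigma>) * (\<integral>x. \<phi> x \<partial>subspace_lborel (\<sigma>\<^sup>\<bottom> \<inter> \<eta>))"
proof -
  let ?S1 = "subspace_lborel \<sigma>" and ?S2 = "subspace_lborel (\<sigma>\<^sup>\<bottom> \<inter> \<eta>)"
  have s2: "subspace (\<sigma>\<^sup>\<bottom> \<inter> \<eta>)" using \<eta> by (simp add: subspace_inter subspace_orthogonal_comp)
  interpret S1: sigma_finite_measure ?S1 by (rule sigma_finite_subspace_lborel[OF \<sigma>])
  interpret S2: sigma_finite_measure ?S2 by (rule sigma_finite_subspace_lborel[OF s2])
  interpret pair_sigma_finite ?S1 ?S2 ..
  \<comment> \<open>The weight is a function of the \<sigma>-component with a known nonzero
    integral, so it factors out and leaves the integral over the complement.\<close>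
  let ?w = "\<lambda>x. complex_of_real (exp (- (norm x)\<^sup>2 / 2))"
  let ?F = "\<lambda>x. ?w (pmat \<sigma> *v x) * \<phi> (x - pmat \<sigma> *v x)"
  have [measurable]: "?F \<in> borel_measurable borel" by measurable
  have w: "integrable ?S1 ?w"
    by (rule integrable_of_real[OF subspace_lborel_gaussian(1)[OF \<sigma>]])
  have F_eq: "(\<integral>x. ?F x \<partial>subspace_lborel \<eta>) = (\<integral>z. ?F (case z of (x, y) \<Rightarrow> x + y) \<partial>(?S1 \<Otimes>\<^sub>M ?S2))"
    unfolding subspace_lborel_sum[OF \<sigma> \<eta> \<sigma>\<eta>] by (rule integral_distr) measurable
  have mF: "(\<lambda>z. ?F (case z of (x, y) \<Rightarrow> x + y)) \<in> borel_measurable (?S1 \<Otimes>\<^sub>M ?S2)" by measurable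
  have mG: "(\<lambda>z. case z of (x, y) \<Rightarrow> ?w x * \<phi> y) \<in> borel_measurable (?S1 \<Otimes>\<^sub>M ?S2)" by measurable
  note F_eq
  also have "(\<integral>z. ?F (case z of (x, y) \<Rightarrow> x + y) \<partial>(?S1 \<Otimes>\<^sub>M ?S2))
      = (\<integral>z. (case z of (x, y) \<Rightarrow> ?w x * \<phi> y) \<partial>(?S1 \<Otimes>\<^sub>M ?S2))"
  proof (rule integral_cong_AE)
    let ?D = "\<lambda>z. ?F (case z of (x, y) \<Rightarrow> x + y) - (case z of (x, y) \<Rightarrow> ?w x * \<phi> y)"
    have D: "?D \<in> borel_measurable (?S1 \<Otimes>\<^sub>M ?S2)" by (intro borel_measurable_diff mF mG)
    have "AE x in ?S1. AE y in ?S2. ?F (x + y) = ?w x * \<phi> y"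
      using AE_subspace_lborel[OF \<sigma>]
    proof eventually_elim
      fix x assume x: "x \<in> \<sigma>"
      show "AE y in ?S2. ?F (x + y) = ?w x * \<phi> y"
        using AE_subspace_lborel[OF s2]
      proof eventually_elim
        fix y assume y: "y \<in> \<sigma>\<^sup>\<bottom> \<inter> \<eta>"
        have "closest_point \<sigma> (x + y) = x"
          using x y by (intro closest_point_subspace_eqI[OF \<sigma>])
            (auto simp: orthogonal_comp_def orthogonal_def inner_commute)
        then show "?F (x + y) = ?w x * \<phi> y" by (simp add: matrix_closest_point_mult[OF \<sigma>])
      qed
    qed
    then have "AE x in ?S1. AE y in ?S2. (x, y) \<in> ?D -` {0} \<inter> space (?S1 \<Otimes>\<^sub>M ?S2)"
    proof eventually_elim
      case (elim x)
      then show ?case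
        by eventually_elim (simp only: vimage_eq Int_iff space_pair_measure space_subspace_lborel
            mem_Times_iff UNIV_I prod.case diff_self singleton_iff simp_thms)
    qed
    then have "AE z in ?S1 \<Otimes>\<^sub>M ?S2. z \<in> ?D -` {0} \<inter> space (?S1 \<Otimes>\<^sub>M ?S2)"
      by (intro AE_pair_measure) (use measurable_sets[OF D, of "{0}"] in \<open>simp only: Int_absorb1 Collect_mem_eq Collect_conj_eq Int_lower2 sets.top Int_commute sets.Int closed_singleton borel_closed\<close>)
    then show "AE z in ?S1 \<Otimes>\<^sub>M ?S2. ?F (case z of (x, y) \<Rightarrow> x + y) = (case z of (x, y) \<Rightarrow> ?w x * \<phi> y)"
      by eventually_elim (simp only: vimage_eq Int_iff singleton_iff right_minus_eq)
  qed (fact mF mG)+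
  also have "\<dots> = integral\<^sup>L ?S1 ?w * integral\<^sup>L ?S2 \<phi>"
    by (rule integral_pair_mult[OF w \<phi>])
  also have "integral\<^sup>L ?S1 ?w = complex_of_real (sqrt (2 * pi) ^ dim \<sigma>)"
    using integral_of_real[OF subspace_lborel_gaussian(1)[OF \<sigma>], where ?'a = complex]
    unfolding subspace_lborel_gaussian(2)[OF \<sigma>] .
  finally show ?thesis .
qed

text \<open>The exponent n is at least the dimension of every subspace, so the same bound is
  integrable over all domains that occur.\<close>

lemma schwartz_plane_bound:
  fixes f :: "(real^'n) set \<Rightarrow> complex"
  assumes "f \<in> schwartz_space p"
  obtains C where "C \<ge> 0"
    "\<And>\<sigma> y. \<sigma> \<in> linear_grassmannian p \<Longrightarrow> y \<in> \<sigma>\<^sup>\<bottom> \<Longrightarrow>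
      norm (f (plane \<sigma> y)) \<le> C * inverse ((1 + (norm y)\<^sup>2) ^ CARD('n))"
proof -
  obtain C where C: "C \<ge> 0"
      "\<And>l. l \<in> affine_grassmannian p \<Longrightarrow> norm (f l) \<le> C * inverse ((1 + (norm (foot l))\<^sup>2) ^ CARD('n))"
    by (rule schwartz_decay[OF assms]) blast
  show thesis
  proof (rule that[OF C(1)])
    fix \<sigma> :: "(real^'n) set" and y :: "real^'n"
    assume \<sigma>: "\<sigma> \<in> linear_grassmannian p" and y: "y \<in> \<sigma>\<^sup>\<bottom>"
    then have s: "subspace \<sigma>" by (simp add: linear_grassmannian_def)
    have "closest_point \<sigma> y = 0"
      using y s by (intro closest_point_subspace_eqI)
        (auto simp: subspace_0 orthogonal_comp_def orthogonal_def inner_commute)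
    then show "norm (f (plane \<sigma> y)) \<le> C * inverse ((1 + (norm y)\<^sup>2) ^ CARD('n))"
      using C(2)[OF plane_in_affine_grassmannian[OF \<sigma>, of y]] by (simp add: foot_plane[OF s])
  qed
qed

lemma plane_image:
  fixes A :: "real^'n^'n"
  shows "(*v) A ` plane \<sigma> x = plane ((*v) A ` \<sigma>) (A *v x)"
  by (simp add: plane_def image_image matrix_vector_right_distrib)

lemma dim_le_CARD: "dim (V :: (real^'n) set) \<le> CARD('n)"
  using dim_subset_UNIV[of V] by simp

lemma orthogonal_comp_sum_bound:
  fixes v x :: "'a::real_inner"
  assumes "v \<in> \<eta>\<^sup>\<bottom>" "x \<in> \<eta>"
  shows "inverse ((1 + (norm (v + x))\<^sup>2) ^ K) \<le> inverse ((1 + (norm x)\<^sup>2) ^ K)"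
proof -
  have "v \<bullet> x = 0" using assms by (auto simp: orthogonal_comp_def orthogonal_def inner_commute)
  then have "(norm (v + x))\<^sup>2 = (norm v)\<^sup>2 + (norm x)\<^sup>2"
    unfolding power2_norm_eq_inner by (simp add: algebra_simps inner_commute)
  then have "(1 + (norm x)\<^sup>2) ^ K \<le> (1 + (norm (v + x))\<^sup>2) ^ K" by (intro power_mono) auto
  then show ?thesis by (intro le_imp_inverse_le) (auto simp: add_pos_nonneg)
qed

text \<open>Every p-plane inside g \<eta> is g A \<sigma> for some A in the group of \<eta>.
  Rotating it back to \<sigma> makes the domain of the inner integral the same for all planes, and A
  leaves w in place because w is orthogonal to \<eta>.\<close>

lemma radon_eq_haar:
  fixes f :: "(real^'n) set \<Rightarrow> complex" and g :: "real^'n^'n"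
  assumes f: "f \<in> schwartz_space p" and g: "orthogonal_matrix g" and \<eta>: "subspace \<eta>"
    and \<sigma>: "\<sigma> \<in> linear_grassmannian p" "\<sigma> \<subseteq> \<eta>" and \<nu>: "haar \<eta> \<nu>" and w: "w \<in> \<eta>\<^sup>\<bottom>"
  shows "radon p f ((*v) g ` plane \<eta> w)
    = (\<integral>A. (\<integral>x. f ((*v) (g ** A) ` plane \<sigma> (w + x)) \<partial>subspace_lborel (\<sigma>\<^sup>\<bottom> \<inter> \<eta>)) \<partial>\<nu>)"
proof -
  let ?\<eta> = "(*v) g ` \<eta>" and ?v = "g *v w"
  have s\<eta>: "subspace ?\<eta>" using \<eta> by (simp add: linear_subspace_image)
  have s\<sigma>: "subspace \<sigma>" and d\<sigma>: "dim \<sigma> = p" using \<sigma> by (auto simp: linear_grassmannian_def)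
  have v: "?v \<in> ?\<eta>\<^sup>\<bottom>" using w orthogonal_matrix_image_orthogonal_comp[OF g, of \<eta>] by blast
  have dir: "direction (plane ?\<eta> ?v) = ?\<eta>" by (rule direction_plane[OF s\<eta>])
  have "closest_point ?\<eta> ?v = 0"
    using v s\<eta> by (intro closest_point_subspace_eqI)
      (auto simp: subspace_0 orthogonal_comp_def orthogonal_def inner_commute)
  then have ft: "foot (plane ?\<eta> ?v) = ?v" by (simp add: foot_plane[OF s\<eta>])
  have sm: "smooth_on_grassmannian p f" using f by (simp add: schwartz_space_def)
  obtain C where C: "C \<ge> 0" "\<And>\<sigma> y. \<sigma> \<in> linear_grassmannian p \<Longrightarrow> y \<in> \<sigma>\<^sup>\<bottom> \<Longrightarrow>
      norm (f (plane \<sigma> y)) \<le> C * inverse ((1 + (norm y)\<^sup>2) ^ CARD('n))"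
    by (rule schwartz_plane_bound[OF f]) blast
  let ?h = "\<lambda>x::real^'n. C * inverse ((1 + (norm x)\<^sup>2) ^ CARD('n))"
  define \<Phi> where "\<Phi> \<tau> = (\<integral>x. f (plane \<tau> (?v + x)) \<partial>subspace_lborel (\<tau>\<^sup>\<bottom> \<inter> ?\<eta>))" for \<tau>
  have rel: "subspace (\<tau>\<^sup>\<bottom> \<inter> U)" if "subspace U" for \<tau> U :: "(real^'n) set"
    using that by (simp add: subspace_inter subspace_orthogonal_comp)
  have hint: "integrable (subspace_lborel (\<tau>\<^sup>\<bottom> \<inter> ?\<eta>)) ?h" for \<tau>
    by (intro integrable_mult_right integrable_subspace_lborel_decay rel s\<eta> dim_le_CARD)
  have hb: "norm (f (plane \<tau> (?v + x))) \<le> ?h x"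
    if "\<tau> \<in> linear_grassmannian p" "\<tau> \<subseteq> ?\<eta>" "x \<in> \<tau>\<^sup>\<bottom> \<inter> ?\<eta>" for \<tau> x
  proof -
    have "?v \<in> \<tau>\<^sup>\<bottom>" using v that(2) by (auto simp: orthogonal_comp_def)
    then have "?v + x \<in> \<tau>\<^sup>\<bottom>" using that(3) by (auto intro: subspace_add[OF subspace_orthogonal_comp])
    then have "norm (f (plane \<tau> (?v + x))) \<le> C * inverse ((1 + (norm (?v + x))\<^sup>2) ^ CARD('n))"
      by (rule C(2)[OF that(1)])
    also have "\<dots> \<le> ?h x" using that(3) v C(1) by (intro mult_left_mono orthogonal_comp_sum_bound) auto
    finally show ?thesis .
  qed
  have fm: "(\<lambda>x. f (plane \<tau> (?v + x))) \<in> borel_measurable borel" if "\<tau> \<in> linear_grassmannian p" for \<tau>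
  proof -
    have "(\<lambda>x. plane_fun p f (pmat \<tau>, ?v + x)) \<in> borel_measurable borel"
      by (rule measurable_compose[OF _ borel_measurable_plane_fun[OF sm]]) (simp add: borel_prod[symmetric])
    then show ?thesis by (simp add: plane_fun_pmat[OF that])
  qed
  have fint: "integrable (subspace_lborel (\<tau>\<^sup>\<bottom> \<inter> ?\<eta>)) (\<lambda>x. f (plane \<tau> (?v + x)))"
    if "\<tau> \<in> linear_grassmannian p" "\<tau> \<subseteq> ?\<eta>" for \<tau>
  proof (rule Bochner_Integration.integrable_bound[OF hint])
    show "(\<lambda>x. f (plane \<tau> (?v + x))) \<in> borel_measurable (subspace_lborel (\<tau>\<^sup>\<bottom> \<inter> ?\<eta>))"
      using fm[OF that(1)] by (simp add: measurable_cong_sets[OF sets_subspace_lborel refl])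
    show "AE x in subspace_lborel (\<tau>\<^sup>\<bottom> \<inter> ?\<eta>). norm (f (plane \<tau> (?v + x))) \<le> norm (?h x)"
      using AE_subspace_lborel[OF rel[OF s\<eta>, of \<tau>]]
    proof eventually_elim
      fix x assume "x \<in> \<tau>\<^sup>\<bottom> \<inter> ?\<eta>"
      from order.trans[OF hb[OF that this] abs_ge_self] show "norm (f (plane \<tau> (?v + x))) \<le> norm (?h x)" by simp
    qed
  qed
  have \<Phi>m: "\<Phi> \<in> borel_measurable (sub_grassmannian_algebra p ?\<eta>)"
  proof -
    let ?G = "sub_grassmannian_algebra p ?\<eta>"
    interpret S: sigma_finite_measure "subspace_lborel ?\<eta>" by (rule sigma_finite_subspace_lborel[OF s\<eta>])
    let ?c = "complex_of_real (sqrt (2 * pi) ^ p)"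
    let ?I = "\<lambda>\<tau>. (\<integral>x. complex_of_real (exp (- (norm (pmat \<tau> *v x))\<^sup>2 / 2)) *
        plane_fun p f (pmat \<tau>, ?v + (x - pmat \<tau> *v x)) \<partial>subspace_lborel ?\<eta>)"
    have "(\<lambda>z. plane_fun p f (pmat (fst z), ?v + (snd z - pmat (fst z) *v snd z)))
        \<in> borel_measurable (?G \<Otimes>\<^sub>M subspace_lborel ?\<eta>)"
      by (rule measurable_compose[OF _ borel_measurable_plane_fun[OF sm]]) (simp add: borel_prod[symmetric])
    then have "?I \<in> borel_measurable ?G"
      by (intro S.borel_measurable_lebesgue_integral) (simp add: split_beta')
    then have "(\<lambda>\<tau>. inverse ?c * ?I \<tau>) \<in> borel_measurable ?G" by measurable
    moreover have "\<Phi> \<tau> = inverse ?c * ?I \<tau>" if "\<tau> \<in> space ?G" for \<tau>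
    proof -
      have \<tau>: "\<tau> \<in> linear_grassmannian p" "\<tau> \<subseteq> ?\<eta>" "subspace \<tau>" "dim \<tau> = p"
        using that by (auto simp: space_sub_grassmannian_algebra linear_grassmannian_def)
      have "?I \<tau> = ?c * \<Phi> \<tau>"
        using subspace_lborel_weight[OF \<tau>(3) s\<eta> \<tau>(2) fm[OF \<tau>(1)] fint[OF \<tau>(1,2)]]
        by (simp add: plane_fun_pmat[OF \<tau>(1)] \<tau>(4) \<Phi>_def)
      then show ?thesis by simp
    qed
    ultimately show ?thesis by (subst measurable_cong) auto
  qed
  have img: "((*v) (g ** A) ` \<sigma>)\<^sup>\<bottom> \<inter> ?\<eta> = (*v) (g ** A) ` (\<sigma>\<^sup>\<bottom> \<inter> \<eta>)"
    and oA: "orthogonal_matrix (g ** A)" if A: "A \<in> orthogonal_group \<eta>" for A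
  proof -
    show oA: "orthogonal_matrix (g ** A)" using g orthogonal_groupD(1)[OF A] by (rule orthogonal_matrix_mul)
    have "?\<eta> = (*v) (g ** A) ` \<eta>"
      using orthogonal_group_image[OF A \<eta>] by (metis (no_types, lifting) image_cong image_image matrix_vector_mul_assoc)
    moreover have "inj ((*v) (g ** A))"
      by (rule inj_on_inverseI[of _ "(*v) (transpose (g ** A))"]) (rule orthogonal_matrix_inverse[OF oA])
    ultimately show "((*v) (g ** A) ` \<sigma>)\<^sup>\<bottom> \<inter> ?\<eta> = (*v) (g ** A) ` (\<sigma>\<^sup>\<bottom> \<inter> \<eta>)"
      by (simp add: image_Int orthogonal_matrix_image_orthogonal_comp[OF oA])
  qed
  have trans: "(\<integral>x. F x \<partial>subspace_lborel (((*v) (g ** A) ` \<sigma>)\<^sup>\<bottom> \<inter> ?\<eta>))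
      = (\<integral>x. F ((g ** A) *v x) \<partial>subspace_lborel (\<sigma>\<^sup>\<bottom> \<inter> \<eta>))"
    if A: "A \<in> orthogonal_group \<eta>" and F: "F \<in> borel_measurable borel" for A and F :: "real^'n \<Rightarrow> 'c::{banach, second_countable_topology}"
    unfolding img[OF A] subspace_lborel_image[OF oA[OF A] rel[OF \<eta>]]
    by (rule integral_distr) (use F in measurable)
  let ?C = "\<integral>x. ?h x \<partial>subspace_lborel (\<sigma>\<^sup>\<bottom> \<inter> \<eta>)"
  \<comment> \<open>The dominating function depends on the norm alone and the domains are rotations
    of each other, so the resulting constant is the same for all \<tau>.\<close>
  have bound: "norm (\<Phi> \<tau>) \<le> ?C" if \<tau>: "\<tau> \<in> linear_grassmannian p" "\<tau> \<subseteq> ?\<eta>" for \<tau>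
  proof -
    have "norm (\<Phi> \<tau>) \<le> (\<integral>x. norm (f (plane \<tau> (?v + x))) \<partial>subspace_lborel (\<tau>\<^sup>\<bottom> \<inter> ?\<eta>))"
      unfolding \<Phi>_def by (rule integral_norm_bound)
    also have "\<dots> \<le> (\<integral>x. ?h x \<partial>subspace_lborel (\<tau>\<^sup>\<bottom> \<inter> ?\<eta>))"
    proof (rule integral_mono_AE[OF integrable_norm[OF fint[OF \<tau>]] hint])
      show "AE x in subspace_lborel (\<tau>\<^sup>\<bottom> \<inter> ?\<eta>). norm (f (plane \<tau> (?v + x))) \<le> ?h x"
        using AE_subspace_lborel[OF rel[OF s\<eta>, of \<tau>]] by eventually_elim (rule hb[OF \<tau>])
    qed
    finally have le: "norm (\<Phi> \<tau>) \<le> (\<integral>x. ?h x \<partial>subspace_lborel (\<tau>\<^sup>\<bottom> \<inter> ?\<eta>))" .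
    have "(*v) (transpose g) ` \<tau> \<subseteq> \<eta>"
      using \<tau>(2) by (auto simp: orthogonal_matrix_inverse[OF g])
    then obtain u where u: "u \<in> orthogonal_group \<eta>" "(*v) u ` \<sigma> = (*v) (transpose g) ` \<tau>"
      using \<sigma> linear_grassmannian_transitive[OF \<eta>]
        linear_grassmannian_image[OF orthogonal_matrix_transpose[THEN iffD2, OF g] \<tau>(1)] by metis
    have "(*v) (g ** u) ` \<sigma> = (*v) g ` (*v) u ` \<sigma>" by (simp add: image_image matrix_vector_mul_assoc)
    also have "\<dots> = \<tau>" unfolding u(2) by (simp add: image_image orthogonal_matrix_inverse[OF g])
    finally have u\<tau>: "(*v) (g ** u) ` \<sigma> = \<tau>" .
    have "?h \<in> borel_measurable borel" by measurable
    then have eqC: "(\<integral>x. ?h x \<partial>subspace_lborel (\<tau>\<^sup>\<bottom> \<inter> ?\<eta>)) = ?C"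
      using trans[OF u(1), of ?h] unfolding u\<tau> orthogonal_matrix_norm[OF oA[OF u(1)]] by blast
    show ?thesis using le unfolding eqC .
  qed
  have "p \<le> dim ?\<eta>"
    using dim_subset[OF \<sigma>(2)] d\<sigma> by (simp add: dim_orthogonal_matrix_image[OF g])
  then have "is_invariant_prob p ?\<eta> (sub_grassmannian_measure p ?\<eta>)"
    unfolding sub_grassmannian_measure_def
    by (rule someI_ex[OF invariant_prob_exists[OF s\<eta>]])
  then have "(\<integral>\<tau>. \<Phi> \<tau> \<partial>sub_grassmannian_measure p ?\<eta>) = (\<integral>A. \<Phi> ((*v) (g ** A) ` \<sigma>) \<partial>\<nu>)"
    by (rule invariant_prob_integral[OF g \<eta> \<sigma> _ \<nu> \<Phi>m bound])
  also have "\<dots> = (\<integral>A. (\<integral>x. f ((*v) (g ** A) ` plane \<sigma> (w + x)) \<partial>subspace_lborel (\<sigma>\<^sup>\<bottom> \<inter> \<eta>)) \<partial>\<nu>)"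
  proof (rule Bochner_Integration.integral_cong[OF refl])
    fix A assume "A \<in> space \<nu>"
    then have A: "A \<in> orthogonal_group \<eta>" by (simp add: haar_space[OF \<nu>])
    have "(g ** A) *v w = ?v"
      using orthogonal_groupD(2)[OF A w] by (simp flip: matrix_vector_mul_assoc)
    then have "f ((*v) (g ** A) ` plane \<sigma> (w + x)) = f (plane ((*v) (g ** A) ` \<sigma>) (?v + (g ** A) *v x))" for x
      by (simp add: plane_image matrix_vector_right_distrib)
    moreover have "\<Phi> ((*v) (g ** A) ` \<sigma>) = (\<integral>x. f (plane ((*v) (g ** A) ` \<sigma>) (?v + (g ** A) *v x)) \<partial>subspace_lborel (\<sigma>\<^sup>\<bottom> \<inter> \<eta>))"
      unfolding \<Phi>_def by (rule trans[OF A fm[OF linear_grassmannian_image[OF oA[OF A] \<sigma>(1)]]])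
    ultimately show "\<Phi> ((*v) (g ** A) ` \<sigma>) = (\<integral>x. f ((*v) (g ** A) ` plane \<sigma> (w + x)) \<partial>subspace_lborel (\<sigma>\<^sup>\<bottom> \<inter> \<eta>))"
      by simp
  qed
  finally show ?thesis
    unfolding radon_def Let_def plane_image dir ft \<Phi>_def .
qed

section \<open>Gaussian averages and concentration\<close>

text \<open>A product over the coordinates of characteristic functions of the standard normal
  distribution. The general type is needed because it is applied to the space of matrices.\<close>

lemma lborel_gaussian_charfun:
  fixes a :: "'a::euclidean_space"
  shows "integrable lborel (\<lambda>x::'a. exp (- (norm x)\<^sup>2 / 2))"
    and "(\<integral>x. complex_of_real (exp (- (norm x)\<^sup>2 / 2)) * iexp (x \<bullet> a) \<partial>lborel)
      = complex_of_real (sqrt (2 * pi) ^ DIM('a) * exp (- (norm a)\<^sup>2 / 2))"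
proof -
  have B: "orthonormal (Basis :: 'a set)"
    by (auto simp: orthonormal_def pairwise_def orthogonal_def inner_Basis)
  show "integrable lborel (\<lambda>x::'a. exp (- (norm x)\<^sup>2 / 2))"
    unfolding lborel_eq_basis_lborel by (rule basis_lborel_gaussian(1)[OF B])
  let ?g = "\<lambda>(b::'a) x::real. complex_of_real (sqrt (2 * pi) * std_normal_density x) * iexp (x * (a \<bullet> b))"
  have gint: "integrable lborel (?g b)" for b
  proof (rule Bochner_Integration.integrable_bound)
    show "integrable lborel (\<lambda>x. sqrt (2 * pi) * std_normal_density x)"
      using integrable_normal_density[of 1 0] by simp
    show "AE x in lborel. norm (?g b x) \<le> norm (sqrt (2 * pi) * std_normal_density x)"
      by (simp add: norm_mult)
  qed measurable
  have g: "(\<integral>x. ?g b x \<partial>lborel) = complex_of_real (sqrt (2 * pi) * exp (- (a \<bullet> b)\<^sup>2 / 2))" for b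
  proof -
    have "(\<integral>x. complex_of_real (std_normal_density x) * iexp (x * (a \<bullet> b)) \<partial>lborel) = char std_normal_distribution (a \<bullet> b)"
      unfolding char_def by (subst integral_density) (auto simp: scaleR_conv_of_real mult.commute)
    then have "(\<integral>x. complex_of_real (sqrt (2 * pi)) * (complex_of_real (std_normal_density x) * iexp (x * (a \<bullet> b))) \<partial>lborel)
      = complex_of_real (sqrt (2 * pi)) * complex_of_real (exp (- (a \<bullet> b)\<^sup>2 / 2))"
      by (simp add: char_std_normal_distribution)
    then show ?thesis by (simp only: of_real_mult mult.assoc)
  qed
  have prod: "complex_of_real (exp (- (norm (\<Sum>b\<in>Basis. c b *\<^sub>R b))\<^sup>2 / 2)) * iexp ((\<Sum>b\<in>Basis. c b *\<^sub>R b) \<bullet> a)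
      = (\<Prod>b\<in>Basis. ?g b (c b))" for c :: "'a \<Rightarrow> real"
  proof -
    have "- (norm (\<Sum>b\<in>Basis. c b *\<^sub>R b))\<^sup>2 / 2 = (\<Sum>b\<in>Basis. - (c b)\<^sup>2 / 2)"
      unfolding orthonormal_norm_sum[OF B] by (simp add: sum_negf sum_divide_distrib)
    then have 1: "exp (- (norm (\<Sum>b\<in>Basis. c b *\<^sub>R b))\<^sup>2 / 2) = (\<Prod>b\<in>Basis. sqrt (2 * pi) * std_normal_density (c b))"
      by (simp add: exp_sum std_normal_density_def)
    have "(\<Sum>b\<in>Basis. c b *\<^sub>R b) \<bullet> a = (\<Sum>b\<in>Basis. c b * (a \<bullet> b))"
      unfolding inner_sum_left inner_scaleR_left by (simp only: inner_commute)
    then have "\<i> * complex_of_real ((\<Sum>b\<in>Basis. c b *\<^sub>R b) \<bullet> a) = (\<Sum>b\<in>Basis. \<i> * complex_of_real (c b * (a \<bullet> b)))"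
      by (simp only: of_real_sum sum_distrib_left)
    then have 2: "iexp ((\<Sum>b\<in>Basis. c b *\<^sub>R b) \<bullet> a) = (\<Prod>b\<in>Basis. iexp (c b * (a \<bullet> b)))"
      by (simp add: exp_sum)
    show ?thesis unfolding 1 2 of_real_prod prod.distrib[symmetric] ..
  qed
  have "(\<integral>x. complex_of_real (exp (- (norm x)\<^sup>2 / 2)) * iexp (x \<bullet> a) \<partial>lborel)
      = (\<integral>c. (\<Prod>b\<in>Basis. ?g b (c b)) \<partial>(\<Pi>\<^sub>M b\<in>(Basis :: 'a set). lborel))"
    unfolding lborel_eq_basis_lborel[where 'a = 'a] basis_lborel_def prod[symmetric] by (rule integral_distr) measurable
  also have "\<dots> = (\<Prod>b\<in>Basis. \<integral>x. ?g b x \<partial>lborel)"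
    by (rule lborel_product.product_integral_prod[where f="?g", OF finite_Basis]) (rule gint)
  also have "\<dots> = complex_of_real (\<Prod>b\<in>Basis. sqrt (2 * pi) * exp (- (a \<bullet> b)\<^sup>2 / 2))"
    unfolding g by simp
  also have "(\<Prod>b\<in>Basis. sqrt (2 * pi) * exp (- (a \<bullet> b)\<^sup>2 / 2)) = sqrt (2 * pi) ^ DIM('a) * exp (- (norm a)\<^sup>2 / 2)"
  proof -
    have "(norm a)\<^sup>2 = (\<Sum>b\<in>Basis. (a \<bullet> b)\<^sup>2)"
      unfolding norm_eq_sqrt_inner euclidean_inner[of a a] by (simp add: sum_nonneg power2_eq_square)
    then have "- (norm a)\<^sup>2 / 2 = (\<Sum>b\<in>Basis. - (a \<bullet> b)\<^sup>2 / 2)" by (simp add: sum_negf sum_divide_distrib)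
    then have "exp (- (norm a)\<^sup>2 / 2) = (\<Prod>b\<in>Basis. exp (- (a \<bullet> b)\<^sup>2 / 2))" by (simp only: exp_sum finite_Basis)
    then show ?thesis by (simp only: prod.distrib prod_constant)
  qed
  finally show "(\<integral>x. complex_of_real (exp (- (norm x)\<^sup>2 / 2)) * iexp (x \<bullet> a) \<partial>lborel)
      = complex_of_real (sqrt (2 * pi) ^ DIM('a) * exp (- (norm a)\<^sup>2 / 2))" .
qed

text \<open>Multiply the vanishing integral by exp (r \<delta>). Where \<rho> < \<delta>/2 the
  integrand is at least b exp (r \<delta>/2); where \<rho> \<ge> \<delta> the exponential factor is
  at most 1; in between the integrand is positive. So b exp (r \<delta>/2) m is bounded by the
  integral of |u| for every r, which forces the mass m to vanish.\<close>

lemma laplace_concentration: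
  fixes u \<rho> :: "'a \<Rightarrow> real"
  assumes u: "integrable M u" and [measurable]: "\<rho> \<in> borel_measurable M"
    and \<rho>: "\<And>x. \<rho> x \<ge> 0" and pos: "\<delta> > 0" "b > 0"
    and lower: "AE x in M. \<rho> x < \<delta> \<longrightarrow> b \<le> u x"
    and zero: "\<And>r. r > 0 \<Longrightarrow> (\<integral>x. u x * exp (- r * \<rho> x) \<partial>M) = 0"
  shows "emeasure M {x \<in> space M. \<rho> x < \<delta> / 2} = 0"
proof (rule ccontr)
  note [measurable] = borel_measurable_integrable[OF u]
  let ?S = "{x \<in> space M. \<rho> x < \<delta> / 2}"
  assume ne: "emeasure M ?S \<noteq> 0"
  have S [measurable]: "?S \<in> sets M" by measurable
  have iS: "integrable M (indicator ?S :: 'a \<Rightarrow> real)"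
  proof (rule Bochner_Integration.integrable_bound)
    show "integrable M (\<lambda>x. inverse b * u x)" using u by simp
    show "AE x in M. norm (indicator ?S x :: real) \<le> norm (inverse b * u x)"
      using lower
    proof eventually_elim
      case (elim x)
      show ?case
      proof (cases "x \<in> ?S")
        case True
        then have "b \<le> u x" using elim pos(1) by auto
        then show ?thesis using True pos(2) by (simp add: field_simps)
      qed simp
    qed
  qed measurable
  define m where "m = measure M ?S"
  have fin: "emeasure M ?S < \<infinity>" using iS S by (simp add: integrable_indicator_iff)
  have m: "m > 0"
    using ne fin by (simp add: m_def measure_def enn2real_positive_iff zero_less_iff_neq_zero less_top)
  have bound: "b * exp (r * \<delta> / 2) * m \<le> (\<integral>x. \<bar>u x\<bar> \<partial>M)" if r: "r > 0" for r
  proof -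
    have int1: "integrable M (\<lambda>x. u x * exp (- r * \<rho> x))"
    proof (rule Bochner_Integration.integrable_bound[OF u])
      show "AE x in M. norm (u x * exp (- r * \<rho> x)) \<le> norm (u x)"
        using r \<rho> by (intro AE_I2) (auto simp: abs_mult intro!: mult_right_le_one_le)
    qed measurable
    have "(\<integral>x. b * exp (r * \<delta> / 2) * indicator ?S x - \<bar>u x\<bar> \<partial>M)
        \<le> (\<integral>x. exp (r * \<delta>) * (u x * exp (- r * \<rho> x)) \<partial>M)"
    proof (rule integral_mono_AE)
      show "integrable M (\<lambda>x. b * exp (r * \<delta> / 2) * indicator ?S x - \<bar>u x\<bar>)"
        using iS u by (intro Bochner_Integration.integrable_diff integrable_mult_right integrable_abs) auto
      show "integrable M (\<lambda>x. exp (r * \<delta>) * (u x * exp (- r * \<rho> x)))" using int1 by simp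
      show "AE x in M. b * exp (r * \<delta> / 2) * indicator ?S x - \<bar>u x\<bar> \<le> exp (r * \<delta>) * (u x * exp (- r * \<rho> x))"
        using lower
      proof eventually_elim
        case (elim x)
        have eq: "exp (r * \<delta>) * (u x * exp (- r * \<rho> x)) = u x * exp (r * (\<delta> - \<rho> x))"
          by (simp add: right_diff_distrib exp_diff exp_minus field_simps)
        show ?case
        proof (cases "\<rho> x < \<delta>")
          case True
          then have ub: "b \<le> u x" using elim by simp
          have "b * exp (r * \<delta> / 2) * indicator ?S x \<le> u x * exp (r * (\<delta> - \<rho> x))"
          proof (cases "x \<in> ?S")
            case True
            then have "r * (\<delta> / 2) \<le> r * (\<delta> - \<rho> x)" using r by (intro mult_left_mono) auto
            then have "exp (r * \<delta> / 2) \<le> exp (r * (\<delta> - \<rho> x))" by simp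
            then show ?thesis using True ub pos(2) by (simp add: mult_mono)
          qed (use ub pos(2) in simp)
          then show ?thesis unfolding eq by simp
        next
          case False
          then have "exp (r * (\<delta> - \<rho> x)) \<le> 1" using r by (simp add: mult_nonneg_nonpos)
          then have "\<bar>u x\<bar> * exp (r * (\<delta> - \<rho> x)) \<le> \<bar>u x\<bar>" by (simp add: mult_left_le)
          then have "- \<bar>u x\<bar> \<le> u x * exp (r * (\<delta> - \<rho> x))"
            using abs_ge_minus_self[of "u x * exp (r * (\<delta> - \<rho> x))"] by (simp add: abs_mult)
          then show ?thesis using False pos(1) unfolding eq by (simp add: indicator_def)
        qed
      qed
    qed
    also have "\<dots> = 0" using zero[OF r] by simp
    also have "(\<integral>x. b * exp (r * \<delta> / 2) * indicator ?S x - \<bar>u x\<bar> \<partial>M) = b * exp (r * \<delta> / 2) * m - (\<integral>x. \<bar>u x\<bar> \<partial>M)"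
      using iS u S by (subst Bochner_Integration.integral_diff) (auto simp: m_def)
    finally show ?thesis by simp
  qed
  define I where "I = (\<integral>x. \<bar>u x\<bar> \<partial>M)"
  have I: "I \<ge> 0" unfolding I_def by (rule integral_nonneg_AE) simp
  \<comment> \<open>Chosen so that b (r \<delta> / 2) m = I + 1; the exponential is larger than its
    argument, so the bound I is exceeded.\<close>
  define r where "r = 2 * (I + 1) / (\<delta> * b * m)"
  have r: "r > 0" using I pos m by (simp add: r_def)
  have "I + 1 = b * (r * \<delta> / 2) * m" using pos m by (simp add: r_def)
  also have "\<dots> \<le> b * exp (r * \<delta> / 2) * m"
  proof -
    have "r * \<delta> / 2 \<le> exp (r * \<delta> / 2)" using exp_ge_add_one_self[of "r * \<delta> / 2"] by linarith
    then show ?thesis using pos m by (intro mult_right_mono mult_left_mono) simp_all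
  qed
  also have "\<dots> \<le> I" unfolding I_def by (rule bound[OF r])
  finally show False by simp
qed

text \<open>One vector at a time: if z_i already lies in the span of the earlier choices, it is
  moved slightly along a vector of V outside this span, which exists as long as fewer than dim V
  vectors have been chosen. Injectivity together with independence of the image expresses
  independence of the family.\<close>

lemma independent_perturbation:
  fixes V :: "'a::euclidean_space set"
  assumes "finite J" "subspace V" "card J \<le> dim V" "\<epsilon> > 0" "\<And>j. j \<in> J \<Longrightarrow> z j \<in> V"
  shows "\<exists>z'. (\<forall>j\<in>J. z' j \<in> V \<and> norm (z' j - z j) < \<epsilon>) \<and> inj_on z' J \<and> independent (z' ` J)"
  using assms(1,3,5)
proof (induction J rule: finite_induct)
  case (insert i J)
  then obtain z' where z': "\<And>j. j \<in> J \<Longrightarrow> z' j \<in> V \<and> norm (z' j - z j) < \<epsilon>" "inj_on z' J" "independent (z' ` J)"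
    by (auto simp: insert.hyps)
  have "dim (span (z' ` J)) = card J"
    using z' by (simp add: dim_eq_card_independent card_image)
  then have "\<not> V \<subseteq> span (z' ` J)"
    using dim_subset[of V "span (z' ` J)"] insert by auto
  then obtain u where u: "u \<in> V" "u \<notin> span (z' ` J)" by blast
  obtain w where w: "w \<in> V" "norm (w - z i) < \<epsilon>" "w \<notin> span (z' ` J)"
  proof (cases "z i \<in> span (z' ` J)")
    case True
    \<comment> \<open>Small enough for t u to have norm below \<epsilon>.\<close>
    define t where "t = \<epsilon> / (2 * (norm u + 1))"
    have n: "norm u + 1 > 0" by (simp add: add_nonneg_pos)
    then have t: "t > 0" using assms(4) by (simp add: t_def)
    have "t * norm u < t * (2 * (norm u + 1))" using t by (intro mult_strict_left_mono) (auto simp: add_nonneg_pos)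
    also have "\<dots> = \<epsilon>" using n by (simp add: t_def)
    finally have tu: "t * norm u < \<epsilon>" .
    have "z i + t *\<^sub>R u \<notin> span (z' ` J)"
    proof
      assume "z i + t *\<^sub>R u \<in> span (z' ` J)"
      then have "t *\<^sub>R u \<in> span (z' ` J)" using True span_diff by fastforce
      then have "inverse t *\<^sub>R t *\<^sub>R u \<in> span (z' ` J)" by (rule span_scale)
      then show False using t u(2) by simp
    qed
    then show thesis
      using t tu u(1) insert.prems(2)[of i] assms(2)
      by (intro that[of "z i + t *\<^sub>R u"]) (auto intro: subspace_add subspace_scale)
  next
    case False
    then show thesis using insert.prems(2)[of i] assms(4) by (intro that[of "z i"]) auto
  qed
  define z'' where "z'' = z'(i := w)"
  have eq: "z'' ` J = z' ` J" "inj_on z'' J = inj_on z' J"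
  proof -
    have "z'' j = z' j" if "j \<in> J" for j using that insert.hyps(2) by (auto simp: z''_def)
    then show "z'' ` J = z' ` J" "inj_on z'' J = inj_on z' J" by (auto cong: image_cong inj_on_cong)
  qed
  have "w \<notin> z' ` J" using w(3) span_superset[of "z' ` J"] by blast
  moreover have zi: "z'' i = w" by (simp add: z''_def)
  ultimately have "inj_on z'' (insert i J)"
    using eq z'(2) insert.hyps(2) by (simp add: inj_on_insert)
  moreover have "independent (z'' ` insert i J)"
    unfolding image_insert zi eq(1) using w(3) z'(3) by (simp add: independent_insert)
  moreover have "\<forall>j\<in>insert i J. z'' j \<in> V \<and> norm (z'' j - z j) < \<epsilon>"
    using w z'(1) by (auto simp: z''_def)
  ultimately show ?case by blast
qed (simp add: independent_empty)

section \<open>Vanishing of the Radon transform inside a hyperplane\<close>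

text \<open>A bound by a function of y alone suffices because the first factor has total mass 1. The
  first factor will be a Haar measure, since rotations do not affect the decay of f.\<close>

lemma integrable_pair_bounded:
  fixes F :: "'a \<Rightarrow> 'b \<Rightarrow> 'c::{banach, second_countable_topology}"
  assumes "prob_space M" "sigma_finite_measure N"
    and F: "(\<lambda>(x, y). F x y) \<in> borel_measurable (M \<Otimes>\<^sub>M N)" and h: "integrable N h"
    and bound: "\<And>x. x \<in> space M \<Longrightarrow> AE y in N. norm (F x y) \<le> h y"
  shows "integrable (M \<Otimes>\<^sub>M N) (\<lambda>(x, y). F x y)"
proof -
  interpret M: prob_space M by fact
  interpret N: sigma_finite_measure N by fact
  interpret pair_sigma_finite M N ..
  have Fx: "integrable N (F x)" if x: "x \<in> space M" for x
  proof (rule Bochner_Integration.integrable_bound[OF h])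
    show "F x \<in> borel_measurable N"
      using measurable_compose[OF measurable_Pair1'[OF x] F] by simp
    show "AE y in N. norm (F x y) \<le> norm (h y)"
      using bound[OF x] by eventually_elim (simp add: order.trans[OF _ abs_ge_self])
  qed
  have nF: "(\<lambda>(x, y). norm (F x y)) \<in> borel_measurable (M \<Otimes>\<^sub>M N)"
    using measurable_compose[OF F borel_measurable_norm] by (simp add: split_beta')
  show ?thesis
  proof (rule Fubini_integrable[OF F])
    show "AE x in M. integrable N (\<lambda>y. case (x, y) of (x, y) \<Rightarrow> F x y)"
      using Fx by (intro AE_I2) simp
    have "integrable M (\<lambda>x. \<integral>y. norm (F x y) \<partial>N)"
    proof (rule M.integrable_const_bound)
      show "(\<lambda>x. \<integral>y. norm (F x y) \<partial>N) \<in> borel_measurable M"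
        by (rule N.borel_measurable_lebesgue_integral[OF nF])
      show "AE x in M. norm (\<integral>y. norm (F x y) \<partial>N) \<le> (\<integral>y. h y \<partial>N)"
      proof (rule AE_I2)
        fix x assume x: "x \<in> space M"
        have "(\<integral>y. norm (F x y) \<partial>N) \<le> (\<integral>y. h y \<partial>N)"
          by (rule integral_mono_AE[OF integrable_norm[OF Fx[OF x]] h bound[OF x]])
        moreover have "0 \<le> (\<integral>y. norm (F x y) \<partial>N)" by (rule Bochner_Integration.integral_nonneg) simp
        ultimately show "norm (\<integral>y. norm (F x y) \<partial>N) \<le> (\<integral>y. h y \<partial>N)" by simp
      qed
    qed
    then show "integrable M (\<lambda>x. \<integral>y. norm (case (x, y) of (x, y) \<Rightarrow> F x y) \<partial>N)" by simp
  qed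
qed

text \<open>The setting is the plane v0 + W with foot v0. For v in W orthogonal to \<eta>, the
  vector v0 + v is the foot of the q-plane in \<open>vanish\<close>, and all q-planes contained in
  v0 + W arise in this way.\<close>

locale radon_vanishing =
  fixes p q :: nat and f :: "(real^'n) set \<Rightarrow> complex" and W \<sigma> :: "(real^'n) set" and v0 :: "real^'n"
  assumes f: "f \<in> schwartz_space p" and W: "subspace W"
    and \<sigma>: "\<sigma> \<in> linear_grassmannian p" and \<sigma>W: "\<sigma> \<subseteq> W"
    and v0: "v0 \<in> W\<^sup>\<bottom>"
    and vanish: "\<And>\<eta> v. \<eta> \<in> linear_grassmannian q \<Longrightarrow> \<eta> \<subseteq> W \<Longrightarrow> v \<in> \<eta>\<^sup>\<bottom> \<inter> W \<Longrightarrow> radon p f (plane \<eta> (v0 + v)) = 0"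
begin

definition V :: "(real^'n) set" where "V = \<sigma>\<^sup>\<bottom> \<inter> W"

text \<open>For orthogonal g this is f at the image under g of the plane through v0 + y with
  direction \<sigma>, see \<open>T_eq\<close>. The detour through \<open>plane_fun\<close> makes it
  Borel on all matrices.\<close>

definition T :: "real^'n^'n \<Rightarrow> real^'n \<Rightarrow> complex" where
  "T g y = plane_fun p f (g ** pmat \<sigma> ** transpose g, g *v (v0 + y))"

lemma s\<sigma>: "subspace \<sigma>" and d\<sigma>: "dim \<sigma> = p"
  using \<sigma> by (auto simp: linear_grassmannian_def)

lemma sV: "subspace V"
  unfolding V_def using W by (simp add: subspace_inter subspace_orthogonal_comp)

lemma dV: "dim V + p = dim W"
  using dim_relative_orthogonal_comp[OF s\<sigma> W \<sigma>W] by (simp add: V_def d\<sigma>)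

lemma VW: "V \<subseteq> W" by (auto simp: V_def)

lemma v0_fixed: "g \<in> orthogonal_group W \<Longrightarrow> g *v v0 = v0"
  using orthogonal_groupD(2) v0 by blast

lemma T_measurable [measurable (raw)]:
  assumes "g \<in> borel_measurable M" "y \<in> borel_measurable M"
  shows "(\<lambda>x. T (g x) (y x)) \<in> borel_measurable M"
proof -
  note [measurable] = assms
  have "smooth_on_grassmannian p f" using f by (simp add: schwartz_space_def)
  moreover have "(\<lambda>x. (g x ** pmat \<sigma> ** transpose (g x), g x *v (v0 + y x))) \<in> borel_measurable M"
    by (intro borel_measurable_Pair) measurable
  ultimately show ?thesis unfolding T_def
    by (intro measurable_compose[OF _ borel_measurable_plane_fun])
qed

lemma T_eq: "orthogonal_matrix g \<Longrightarrow> T g y = f ((*v) g ` plane \<sigma> (v0 + y))"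
  by (simp add: T_def plane_image plane_fun_pmat linear_grassmannian_image \<sigma>
      flip: matrix_closest_point_orthogonal_image[OF _ s\<sigma>])

lemma T_bound:
  obtains h :: "real^'n \<Rightarrow> real" where "h \<in> borel_measurable borel" "integrable (subspace_lborel V) h"
    "\<And>g y. g \<in> orthogonal_group W \<Longrightarrow> y \<in> V \<Longrightarrow> norm (T g y) \<le> h y"
proof -
  obtain C where C: "C \<ge> 0" "\<And>\<sigma> y. \<sigma> \<in> linear_grassmannian p \<Longrightarrow> y \<in> \<sigma>\<^sup>\<bottom> \<Longrightarrow>
      norm (f (plane \<sigma> y)) \<le> C * inverse ((1 + (norm y)\<^sup>2) ^ CARD('n))"
    by (rule schwartz_plane_bound[OF f]) blast
  let ?h = "\<lambda>y::real^'n. C * inverse ((1 + (norm y)\<^sup>2) ^ CARD('n))"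
  have b: "norm (T g y) \<le> ?h y" if g: "g \<in> orthogonal_group W" and y: "y \<in> V" for g y
  proof -
    have go: "orthogonal_matrix g" by (rule orthogonal_groupD[OF g])
    have "v0 + y \<in> \<sigma>\<^sup>\<bottom>"
      using v0 y \<sigma>W by (auto simp: V_def intro!: subspace_add[OF subspace_orthogonal_comp])
        (auto simp: orthogonal_comp_def)
    then have "g *v (v0 + y) \<in> ((*v) g ` \<sigma>)\<^sup>\<bottom>"
      using orthogonal_matrix_image_orthogonal_comp[OF go, of \<sigma>] by blast
    then have "norm (T g y) \<le> C * inverse ((1 + (norm (g *v (v0 + y)))\<^sup>2) ^ CARD('n))"
      unfolding T_eq[OF go] plane_image by (rule C(2)[OF linear_grassmannian_image[OF go \<sigma>]])
    also have "\<dots> = C * inverse ((1 + (norm (v0 + y))\<^sup>2) ^ CARD('n))"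
      by (simp add: orthogonal_matrix_norm[OF go])
    also have "\<dots> \<le> ?h y"
      by (intro mult_left_mono orthogonal_comp_sum_bound[OF v0 subsetD[OF VW y]] C(1))
    finally show ?thesis .
  qed
  show thesis
  proof (rule that[of ?h])
    show "?h \<in> borel_measurable borel" by measurable
    show "integrable (subspace_lborel V) ?h"
      by (intro integrable_mult_right integrable_subspace_lborel_decay sV dim_le_CARD)
  qed (rule b)
qed

lemma T_phase_integrable:
  assumes "g \<in> orthogonal_group W" and [measurable]: "\<theta> \<in> borel_measurable borel"
  shows "integrable (subspace_lborel V) (\<lambda>y. T g y * iexp (\<theta> y))"
proof -
  obtain h where h: "integrable (subspace_lborel V) h"
    "\<And>g y. g \<in> orthogonal_group W \<Longrightarrow> y \<in> V \<Longrightarrow> norm (T g y) \<le> h y"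
    by (rule T_bound) blast
  show ?thesis
  proof (rule Bochner_Integration.integrable_bound[OF h(1)])
    show "(\<lambda>y. T g y * iexp (\<theta> y)) \<in> borel_measurable (subspace_lborel V)" by measurable
    show "AE y in subspace_lborel V. norm (T g y * iexp (\<theta> y)) \<le> norm (h y)"
      using AE_subspace_lborel[OF sV]
    proof eventually_elim
      case (elim y)
      show ?case using h(2)[OF assms(1) elim] by (simp add: norm_mult)
    qed
  qed
qed

text \<open>The projection-slice theorem, averaged over the group of \<eta>. V splits into the span
  Z of the z_j and the domain V1 of the inner Radon integral. The frequency z_j0 lies in Z, so the
  phase is constant along V1, and for each v in Z the averaged integral over V1 is the Radon
  transform at a q-plane inside v0 + W.\<close>

lemma fourier_average_zero:
  fixes z :: "'n \<Rightarrow> real^'n" and J :: "'n set"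
  defines "\<eta> \<equiv> (span (z ` J))\<^sup>\<bottom> \<inter> W"
  assumes z: "\<And>j. j \<in> J \<Longrightarrow> z j \<in> V" "inj_on z J" "independent (z ` J)" and J: "card J + q = dim W" "j0 \<in> J"
    and g: "g \<in> orthogonal_group W" and \<nu>: "haar \<eta> \<nu>"
  shows "(\<integral>A. (\<integral>y. T (g ** A) y * iexp (- (z j0 \<bullet> y)) \<partial>subspace_lborel V) \<partial>\<nu>) = 0"
proof -
  define Z where "Z = span (z ` J)"
  have sZ: "subspace Z" by (simp add: Z_def)
  have ZV: "Z \<subseteq> V" unfolding Z_def using z(1) by (intro span_minimal sV) auto
  have "dim Z = card J" using z(2,3) by (simp add: Z_def dim_eq_card_independent card_image)
  then have d\<eta>: "dim \<eta> = q"
    using dim_relative_orthogonal_comp[OF sZ W order.trans[OF ZV VW]] J(1) by (simp add: \<eta>_def flip: Z_def)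
  have s\<eta>: "subspace \<eta>" unfolding \<eta>_def using W by (simp add: subspace_inter subspace_orthogonal_comp)
  have \<eta>W: "\<eta> \<subseteq> W" by (auto simp: \<eta>_def)
  have \<eta>q: "\<eta> \<in> linear_grassmannian q" using s\<eta> d\<eta> by (simp add: linear_grassmannian_def)
  have Z\<eta>: "Z \<subseteq> \<eta>\<^sup>\<bottom>" by (auto simp: \<eta>_def Z_def orthogonal_comp_def orthogonal_def inner_commute)
  have \<sigma>\<eta>: "\<sigma> \<subseteq> \<eta>"
    using ZV \<sigma>W by (fastforce simp: \<eta>_def V_def orthogonal_comp_def orthogonal_def inner_commute simp flip: Z_def)
  define V1 where "V1 = Z\<^sup>\<bottom> \<inter> V"
  \<comment> \<open>One space in two roles: the part of V orthogonal to the frequencies, and the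
    domain of the inner integral of the Radon transform.\<close>
  have V1: "V1 = \<sigma>\<^sup>\<bottom> \<inter> \<eta>" by (auto simp: V1_def V_def \<eta>_def Z_def)
  have sV1: "subspace V1" unfolding V1_def using sV by (simp add: subspace_inter subspace_orthogonal_comp)
  have go: "orthogonal_matrix g" by (rule orthogonal_groupD[OF g])
  have O\<eta>: "orthogonal_group \<eta> \<subseteq> orthogonal_group W" by (rule orthogonal_group_mono[OF \<eta>W])
  have gA: "g ** A \<in> orthogonal_group W" if "A \<in> orthogonal_group \<eta>" for A
    using orthogonal_group_mult[OF g] that O\<eta> by blast
  interpret \<nu>: prob_space \<nu> using \<nu> by (simp add: haar_def)
  let ?SZ = "subspace_lborel Z" and ?S1 = "subspace_lborel V1"
  interpret SZ: sigma_finite_measure ?SZ by (rule sigma_finite_subspace_lborel[OF sZ])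
  interpret S1: sigma_finite_measure ?S1 by (rule sigma_finite_subspace_lborel[OF sV1])
  interpret ZV1: pair_sigma_finite ?SZ ?S1 ..
  interpret \<nu>Z: pair_sigma_finite \<nu> ?SZ ..
  note [measurable] = haar_measurable_ident[OF \<nu>]
  let ?e = "\<lambda>y. iexp (- (z j0 \<bullet> y))"
  have zZ: "z j0 \<in> Z" using J(2) by (auto simp: Z_def intro: span_base)
  \<comment> \<open>The q-plane is the image under g of \<eta> translated by v0 + v; it stays in v0
    + W because g fixes v0 and preserves W.\<close>
  have radon0: "(\<integral>A. (\<integral>x. T (g ** A) (v + x) \<partial>?S1) \<partial>\<nu>) = 0" if v: "v \<in> Z" for v
  proof -
    have vW: "v \<in> \<eta>\<^sup>\<bottom> \<inter> W" using v Z\<eta> ZV VW by blast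
    have "(*v) g ` \<eta> \<subseteq> W" using orthogonal_group_image[OF g W] \<eta>W by blast
    moreover have "g *v v \<in> ((*v) g ` \<eta>)\<^sup>\<bottom> \<inter> W"
      using vW orthogonal_matrix_image_orthogonal_comp[OF go, of \<eta>] orthogonal_group_image_subset[OF g W] by blast
    ultimately have "radon p f (plane ((*v) g ` \<eta>) (v0 + g *v v)) = 0"
      by (intro vanish linear_grassmannian_image[OF go \<eta>q])
    then have "radon p f ((*v) g ` plane \<eta> (v0 + v)) = 0"
      by (simp add: plane_image matrix_vector_right_distrib v0_fixed[OF g])
    moreover have "v0 + v \<in> \<eta>\<^sup>\<bottom>"
      using vW v0 orthogonal_comp_anti_mono[OF \<eta>W] by (intro subspace_add[OF subspace_orthogonal_comp]) auto
    ultimately have "(\<integral>A. (\<integral>x. f ((*v) (g ** A) ` plane \<sigma> (v0 + v + x)) \<partial>?S1) \<partial>\<nu>) = 0"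
      using radon_eq_haar[OF f go s\<eta> \<sigma> \<sigma>\<eta> \<nu>, of "v0 + v"] by (simp add: V1)
    moreover have "(\<integral>A. (\<integral>x. T (g ** A) (v + x) \<partial>?S1) \<partial>\<nu>)
        = (\<integral>A. (\<integral>x. f ((*v) (g ** A) ` plane \<sigma> (v0 + v + x)) \<partial>?S1) \<partial>\<nu>)"
    proof (rule Bochner_Integration.integral_cong[OF refl])
      fix A assume "A \<in> space \<nu>"
      then have "orthogonal_matrix (g ** A)" using gA orthogonal_groupD(1) by (auto simp: haar_space[OF \<nu>])
      then show "(\<integral>x. T (g ** A) (v + x) \<partial>?S1) = (\<integral>x. f ((*v) (g ** A) ` plane \<sigma> (v0 + v + x)) \<partial>?S1)"
        by (simp add: T_eq add.assoc)
    qed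
    ultimately show ?thesis by simp
  qed
  have SV: "subspace_lborel V = distr (?SZ \<Otimes>\<^sub>M ?S1) borel (\<lambda>(v, x). v + x)"
    unfolding V1_def by (rule subspace_lborel_sum[OF sZ sV ZV])
  have plus: "(\<lambda>(v, x). v + x) \<in> measurable (?SZ \<Otimes>\<^sub>M ?S1) borel" by measurable
  obtain h where h: "h \<in> borel_measurable borel" "integrable (subspace_lborel V) h"
    "\<And>g y. g \<in> orthogonal_group W \<Longrightarrow> y \<in> V \<Longrightarrow> norm (T g y) \<le> h y"
    by (rule T_bound) blast
  have h2: "integrable (?SZ \<Otimes>\<^sub>M ?S1) (\<lambda>(v, x). h (v + x))"
    using h(2) unfolding SV integrable_distr_eq[OF plus h(1)] by (simp add: split_beta')
  let ?G = "\<lambda>A v. (\<integral>x. T (g ** A) (v + x) \<partial>?S1) * ?e v"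
  let ?H = "\<lambda>v. \<integral>x. h (v + x) \<partial>?S1"
  \<comment> \<open>\<open>?H\<close> dominates \<open>?G A\<close> uniformly in A, as required for
    exchanging the group average and the integral over Z.\<close>
  have H: "integrable ?SZ ?H" by (rule ZV1.integrable_fst[OF h2])
  have Gm: "(\<lambda>(A, v). ?G A v) \<in> borel_measurable (\<nu> \<Otimes>\<^sub>M ?SZ)" by measurable
  have Gb: "AE v in ?SZ. norm (?G A v) \<le> ?H v" if "A \<in> space \<nu>" for A
    using AE_subspace_lborel[OF sZ] ZV1.AE_integrable_fst[OF h2]
  proof eventually_elim
    case (elim v)
    have A: "g ** A \<in> orthogonal_group W" using that gA by (simp add: haar_space[OF \<nu>])
    have b: "AE x in ?S1. norm (T (g ** A) (v + x)) \<le> h (v + x)"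
      using AE_subspace_lborel[OF sV1]
    proof eventually_elim
      case (elim x)
      have "v + x \<in> V" using elim \<open>v \<in> Z\<close> ZV sV by (auto simp: V1_def intro: subspace_add)
      then show ?case by (rule h(3)[OF A])
    qed
    have "integrable ?S1 (\<lambda>x. T (g ** A) (v + x))"
    proof (rule Bochner_Integration.integrable_bound[OF elim(2)])
      show "AE x in ?S1. norm (T (g ** A) (v + x)) \<le> norm (h (v + x))"
        using b by eventually_elim simp
    qed measurable
    then have "(\<integral>x. norm (T (g ** A) (v + x)) \<partial>?S1) \<le> ?H v"
      by (intro integral_mono_AE integrable_norm elim(2) b)
    then have "norm (\<integral>x. T (g ** A) (v + x) \<partial>?S1) \<le> ?H v"
      by (rule order.trans[OF integral_norm_bound])
    then show ?case by (simp add: norm_mult)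
  qed
  have Gint: "integrable (\<nu> \<Otimes>\<^sub>M ?SZ) (\<lambda>(A, v). ?G A v)"
    by (rule integrable_pair_bounded[OF _ _ Gm H Gb]) unfold_locales
  have inner: "(\<integral>y. T (g ** A) y * ?e y \<partial>subspace_lborel V) = (\<integral>v. ?G A v \<partial>?SZ)" if "A \<in> space \<nu>" for A
  proof -
    have A: "g ** A \<in> orthogonal_group W" using that gA by (simp add: haar_space[OF \<nu>])
    have em: "(\<lambda>y. T (g ** A) y * ?e y) \<in> borel_measurable borel" by measurable
    have i1: "integrable (subspace_lborel V) (\<lambda>y. T (g ** A) y * ?e y)"
      by (rule T_phase_integrable[OF A]) measurable
    then have i2: "integrable (?SZ \<Otimes>\<^sub>M ?S1) (\<lambda>(v, x). T (g ** A) (v + x) * ?e (v + x))"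
      unfolding SV integrable_distr_eq[OF plus em] by (simp only: split_beta')
    have "(\<integral>y. T (g ** A) y * ?e y \<partial>subspace_lborel V)
        = (\<integral>w. (case w of (v, x) \<Rightarrow> T (g ** A) (v + x) * ?e (v + x)) \<partial>(?SZ \<Otimes>\<^sub>M ?S1))"
      unfolding SV integral_distr[OF plus em] by (simp only: split_beta')
    also have "\<dots> = (\<integral>v. (\<integral>x. T (g ** A) (v + x) * ?e (v + x) \<partial>?S1) \<partial>?SZ)"
      by (rule ZV1.integral_fst[OF i2, symmetric])
    also have "\<dots> = (\<integral>v. ?G A v \<partial>?SZ)"
    proof (rule Bochner_Integration.integral_cong[OF refl])
      fix v
      have "(\<integral>x. T (g ** A) (v + x) * ?e (v + x) \<partial>?S1) = (\<integral>x. T (g ** A) (v + x) * ?e v \<partial>?S1)"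
      proof (rule integral_cong_AE)
        show "AE x in ?S1. T (g ** A) (v + x) * ?e (v + x) = T (g ** A) (v + x) * ?e v"
          using AE_subspace_lborel[OF sV1]
        proof eventually_elim
          case (elim x)
          have "z j0 \<bullet> x = 0" using elim zZ by (auto simp: V1_def orthogonal_comp_def orthogonal_def)
          then show ?case by (simp add: inner_add_right)
        qed
      qed measurable
      also have "\<dots> = ?G A v" by (rule Bochner_Integration.integral_mult_left_zero)
      finally show "(\<integral>x. T (g ** A) (v + x) * ?e (v + x) \<partial>?S1) = ?G A v" .
    qed
    finally show ?thesis .
  qed
  have "(\<integral>A. (\<integral>y. T (g ** A) y * ?e y \<partial>subspace_lborel V) \<partial>\<nu>) = (\<integral>A. (\<integral>v. ?G A v \<partial>?SZ) \<partial>\<nu>)"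
    by (rule Bochner_Integration.integral_cong[OF refl inner])
  also have "\<dots> = (\<integral>v. (\<integral>A. ?G A v \<partial>\<nu>) \<partial>?SZ)"
    by (rule \<nu>Z.Fubini_integral[OF Gint, symmetric])
  also have "\<dots> = (\<integral>v. 0 \<partial>?SZ)"
  proof (rule integral_cong_AE)
    show "AE v in ?SZ. (\<integral>A. ?G A v \<partial>\<nu>) = 0"
      using AE_subspace_lborel[OF sZ] by eventually_elim (simp add: radon0)
    show "(\<lambda>v. \<integral>A. ?G A v \<partial>\<nu>) \<in> borel_measurable ?SZ"
      using \<nu>Z.integrable_snd[OF Gint] by (rule borel_measurable_integrable)
  qed simp
  finally show ?thesis by simp
qed

text \<open>By right invariance g may be replaced by g ** A with A in the group of \<eta>. Such A
  fixes every z_j, so the phase does not notice it, and the average over A of the remaining factor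
  is zero by \<open>fourier_average_zero\<close>.\<close>

lemma phase_average_zero:
  fixes z x :: "'n \<Rightarrow> real^'n" and J :: "'n set"
  assumes z: "\<And>j. j \<in> J \<Longrightarrow> z j \<in> V" "inj_on z J" "independent (z ` J)" and J: "card J + q = dim W" "j0 \<in> J"
    and \<nu>: "haar W \<nu>"
  shows "(\<integral>g. iexp (\<Sum>j\<in>J. (g *v z j) \<bullet> x j) * (\<integral>y. T g y * iexp (- (z j0 \<bullet> y)) \<partial>subspace_lborel V) \<partial>\<nu>) = 0"
proof -
  define \<eta> where "\<eta> = (span (z ` J))\<^sup>\<bottom> \<inter> W"
  have s\<eta>: "subspace \<eta>" unfolding \<eta>_def using W by (simp add: subspace_inter subspace_orthogonal_comp)
  have O\<eta>: "orthogonal_group \<eta> \<subseteq> orthogonal_group W" by (rule orthogonal_group_mono) (simp add: \<eta>_def)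
  obtain \<kappa> where \<kappa>: "haar \<eta> \<kappa>" using haar_exists[OF s\<eta>] by blast
  interpret \<nu>: prob_space \<nu> using \<nu> by (simp add: haar_def)
  interpret \<kappa>: prob_space \<kappa> using \<kappa> by (simp add: haar_def)
  interpret P: pair_sigma_finite \<nu> \<kappa> ..
  interpret S: sigma_finite_measure "subspace_lborel V" by (rule sigma_finite_subspace_lborel[OF sV])
  note [measurable] = haar_measurable_ident[OF \<nu>] haar_measurable_ident[OF \<kappa>]
  define E where "E g = iexp (\<Sum>j\<in>J. (g *v z j) \<bullet> x j)" for g
  define M where "M g = E g * (\<integral>y. T g y * iexp (- (z j0 \<bullet> y)) \<partial>subspace_lborel V)" for g
  have Em [measurable]: "E \<in> borel_measurable borel" unfolding E_def by measurable
  have Mm [measurable]: "M \<in> borel_measurable borel" unfolding M_def by measurable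
  have EA: "E (g ** A) = E g" if A: "A \<in> orthogonal_group \<eta>" for g A
  proof -
    have "A *v z j = z j" if "j \<in> J" for j
    proof (rule orthogonal_groupD(2)[OF A])
      have "z j \<in> span (z ` J)" using that by (simp add: span_base)
      then show "z j \<in> \<eta>\<^sup>\<bottom>" by (auto simp: \<eta>_def orthogonal_comp_def orthogonal_def inner_commute)
    qed
    then show ?thesis by (simp add: E_def flip: matrix_vector_mul_assoc)
  qed
  obtain h where h: "integrable (subspace_lborel V) h"
    "\<And>g y. g \<in> orthogonal_group W \<Longrightarrow> y \<in> V \<Longrightarrow> norm (T g y) \<le> h y"
    by (rule T_bound) blast
  have Mb: "norm (M g) \<le> (\<integral>y. h y \<partial>subspace_lborel V)" if g: "g \<in> orthogonal_group W" for g
  proof -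
    have i: "integrable (subspace_lborel V) (\<lambda>y. T g y * iexp (- (z j0 \<bullet> y)))"
      by (rule T_phase_integrable[OF g]) measurable
    have "norm (M g) = norm (\<integral>y. T g y * iexp (- (z j0 \<bullet> y)) \<partial>subspace_lborel V)"
      by (simp add: M_def E_def norm_mult)
    also have "\<dots> \<le> (\<integral>y. norm (T g y * iexp (- (z j0 \<bullet> y))) \<partial>subspace_lborel V)" by (rule integral_norm_bound)
    also have "\<dots> \<le> (\<integral>y. h y \<partial>subspace_lborel V)"
    proof (rule integral_mono_AE[OF integrable_norm[OF i] h(1)])
      show "AE y in subspace_lborel V. norm (T g y * iexp (- (z j0 \<bullet> y))) \<le> h y"
        using AE_subspace_lborel[OF sV]
      proof eventually_elim
        case (elim y)
        show ?case using h(2)[OF g elim] by (simp add: norm_mult)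
      qed
    qed
    finally show ?thesis .
  qed
  have gA: "g ** A \<in> orthogonal_group W" if "g \<in> space \<nu>" "A \<in> space \<kappa>" for g A
    using that O\<eta> orthogonal_group_mult by (auto simp: haar_space[OF \<nu>] haar_space[OF \<kappa>])
  have int: "integrable (\<nu> \<Otimes>\<^sub>M \<kappa>) (\<lambda>(g, A). M (g ** A))"
  proof (rule integrable_pair_bounded)
    show "(\<lambda>(g, A). M (g ** A)) \<in> borel_measurable (\<nu> \<Otimes>\<^sub>M \<kappa>)" by measurable
    show "integrable \<kappa> (\<lambda>_. \<integral>y. h y \<partial>subspace_lborel V)" by simp
    show "AE A in \<kappa>. norm (M (g ** A)) \<le> (\<integral>y. h y \<partial>subspace_lborel V)" if "g \<in> space \<nu>" for g
      using that by (intro AE_I2 Mb gA)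
  qed unfold_locales
  have M\<nu>: "M \<in> borel_measurable \<nu>" by measurable
  have "(\<integral>g. M g \<partial>\<nu>) = (\<integral>A. (\<integral>g. M (g ** A) \<partial>\<nu>) \<partial>\<kappa>)"
  proof -
    have "(\<integral>A. (\<integral>g. M (g ** A) \<partial>\<nu>) \<partial>\<kappa>) = (\<integral>A. (\<integral>g. M g \<partial>\<nu>) \<partial>\<kappa>)"
    proof (rule Bochner_Integration.integral_cong[OF refl])
      fix A assume "A \<in> space \<kappa>"
      then have "A \<in> orthogonal_group W" using O\<eta> by (auto simp: haar_space[OF \<kappa>])
      then show "(\<integral>g. M (g ** A) \<partial>\<nu>) = (\<integral>g. M g \<partial>\<nu>)" by (rule haar_integral_mult[OF \<nu> _ M\<nu>])
    qed
    then show ?thesis by (simp add: \<kappa>.prob_space)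
  qed
  also have "\<dots> = (\<integral>g. (\<integral>A. M (g ** A) \<partial>\<kappa>) \<partial>\<nu>)" by (rule P.Fubini_integral[OF int])
  also have "\<dots> = (\<integral>g. 0 \<partial>\<nu>)"
  proof (rule Bochner_Integration.integral_cong[OF refl])
    fix g assume "g \<in> space \<nu>"
    then have g: "g \<in> orthogonal_group W" by (simp add: haar_space[OF \<nu>])
    have "(\<integral>A. M (g ** A) \<partial>\<kappa>) = (\<integral>A. E g * (\<integral>y. T (g ** A) y * iexp (- (z j0 \<bullet> y)) \<partial>subspace_lborel V) \<partial>\<kappa>)"
      by (rule Bochner_Integration.integral_cong[OF refl]) (simp add: M_def EA haar_space[OF \<kappa>])
    also have "\<dots> = E g * 0"
      using fourier_average_zero[OF z J g \<kappa>[unfolded \<eta>_def]] by simp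
    finally show "(\<integral>A. M (g ** A) \<partial>\<kappa>) = 0" by simp
  qed
  finally show ?thesis by (simp add: M_def E_def)
qed

text \<open>
  For a Gaussian matrix with rows \<open>G\<^sub>j\<close>, the phase of \<open>phase_average_zero\<close> at the vectors
  \<open>z\<^sub>j = P\<^sub>V G\<^sub>j\<close> is the inner product of \<open>G\<close> with \<open>offset\<close>, so that the mean over \<open>G\<close> is a Gaussian in \<open>offset\<close>.
\<close>

definition offset :: "'n set \<Rightarrow> 'n \<Rightarrow> ('n \<Rightarrow> real^'n) \<Rightarrow> real^'n^'n \<Rightarrow> real^'n \<Rightarrow> real^'n^'n" where
  "offset J j0 x g y = (\<chi> j. if j \<in> J then pmat V *v (transpose g *v x j - (if j = j0 then y else 0)) else 0)"

lemma continuous_on_offset: "continuous_on UNIV (\<lambda>(g, y). offset J j0 x g y)"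
proof -
  have "continuous_on UNIV (\<lambda>z. if j \<in> J then pmat V *v (transpose (fst z) *v x j - (if j = j0 then snd z else 0)) else 0)"
    for j :: 'n
    by (cases "j \<in> J"; cases "j = j0") (auto intro!: continuous_intros)
  then show ?thesis unfolding offset_def split_beta' by (intro continuous_on_vec_lambda)
qed

lemma offset_measurable [measurable (raw)]:
  assumes "g \<in> borel_measurable M" "y \<in> borel_measurable M"
  shows "(\<lambda>z. offset J j0 x (g z) (y z)) \<in> borel_measurable M"
  by (rule borel_measurable_continuous_Pair[OF assms]) (use continuous_on_offset in \<open>simp add: split_beta'\<close>)

lemma offset_inner:
  assumes g: "orthogonal_matrix g" and y: "y \<in> V" and j0: "j0 \<in> J" and z: "\<And>j. j \<in> J \<Longrightarrow> z j = closest_point V (G $ j)"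
  shows "G \<bullet> offset J j0 x g y = (\<Sum>j\<in>J. (g *v z j) \<bullet> x j) - z j0 \<bullet> y"
proof -
  have "G \<bullet> offset J j0 x g y = (\<Sum>j\<in>UNIV. if j \<in> J then G $ j \<bullet> (pmat V *v (transpose g *v x j - (if j = j0 then y else 0))) else 0)"
    unfolding inner_vec_def[of G] offset_def by (intro sum.cong) auto
  also have "\<dots> = (\<Sum>j\<in>J. G $ j \<bullet> (pmat V *v (transpose g *v x j - (if j = j0 then y else 0))))"
    by (simp add: sum.If_cases)
  also have "\<dots> = (\<Sum>j\<in>J. (g *v z j) \<bullet> x j - (if j = j0 then z j0 \<bullet> y else 0))"
  proof (rule sum.cong[OF refl])
    fix j assume j: "j \<in> J"
    have "G $ j \<bullet> (pmat V *v w) = z j \<bullet> w" for w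
      by (simp add: matrix_closest_point_mult[OF sV] closest_point_subspace_self_adjoint[OF sV] z[OF j])
    moreover have "z j \<bullet> (transpose g *v x j) = (g *v z j) \<bullet> x j"
      using orthogonal_matrix_inner(2)[of "transpose g" "z j" "x j"] g by simp
    ultimately show "G $ j \<bullet> (pmat V *v (transpose g *v x j - (if j = j0 then y else 0)))
        = (g *v z j) \<bullet> x j - (if j = j0 then z j0 \<bullet> y else 0)"
      by (simp add: inner_diff_right)
  qed
  also have "\<dots> = (\<Sum>j\<in>J. (g *v z j) \<bullet> x j) - z j0 \<bullet> y"
    using j0 by (simp add: sum_subtractf)
  finally show ?thesis .
qed

lemma T_integrable:
  fixes \<theta> :: "(real^'n^'n) \<times> (real^'n) \<Rightarrow> real"
  assumes \<nu>: "haar W \<nu>" and [measurable]: "\<theta> \<in> borel_measurable (\<nu> \<Otimes>\<^sub>M subspace_lborel V)"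
  shows "integrable (\<nu> \<Otimes>\<^sub>M subspace_lborel V) (\<lambda>(g, y). T g y * iexp (\<theta> (g, y)))"
proof -
  note [measurable] = haar_measurable_ident[OF \<nu>]
  obtain h where h: "integrable (subspace_lborel V) h"
    "\<And>g y. g \<in> orthogonal_group W \<Longrightarrow> y \<in> V \<Longrightarrow> norm (T g y) \<le> h y"
    by (rule T_bound) blast
  show ?thesis
  proof (rule integrable_pair_bounded[OF _ _ _ h(1)])
    show "prob_space \<nu>" using \<nu> by (simp add: haar_def)
    show "sigma_finite_measure (subspace_lborel V)" by (rule sigma_finite_subspace_lborel[OF sV])
    show "(\<lambda>(g, y). T g y * iexp (\<theta> (g, y))) \<in> borel_measurable (\<nu> \<Otimes>\<^sub>M subspace_lborel V)"
      unfolding split_beta' by measurable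
    show "AE y in subspace_lborel V. norm (T g y * iexp (\<theta> (g, y))) \<le> h y" if "g \<in> space \<nu>" for g
      using AE_subspace_lborel[OF sV]
    proof eventually_elim
      case (elim y)
      show ?case using h(2)[OF _ elim, of g] that by (simp add: norm_mult haar_space[OF \<nu>])
    qed
  qed
qed

text \<open>If the projections of the rows in J onto V are independent, this is
  \<open>phase_average_zero\<close>. Any other G is a limit of such matrices, and T dominates all
  the integrands.\<close>

lemma phase_integral_zero:
  fixes x :: "'n \<Rightarrow> real^'n" and G :: "real^'n^'n"
  assumes J: "card J + q = dim W" "j0 \<in> J" and pq: "p \<le> q" and \<nu>: "haar W \<nu>"
  shows "(\<integral>(g, y). T g y * iexp (G \<bullet> offset J j0 x g y) \<partial>(\<nu> \<Otimes>\<^sub>M subspace_lborel V)) = 0"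
proof -
  let ?S = "subspace_lborel V"
  define \<Psi> where "\<Psi> G = (\<integral>(g, y). T g y * iexp (G \<bullet> offset J j0 x g y) \<partial>(\<nu> \<Otimes>\<^sub>M ?S))" for G
  interpret \<nu>: prob_space \<nu> using \<nu> by (simp add: haar_def)
  interpret S: sigma_finite_measure ?S by (rule sigma_finite_subspace_lborel[OF sV])
  interpret P: pair_sigma_finite \<nu> ?S ..
  note [measurable] = haar_measurable_ident[OF \<nu>]
  have \<theta>m: "(\<lambda>(g, y). G \<bullet> offset J j0 x g y) \<in> borel_measurable (\<nu> \<Otimes>\<^sub>M ?S)" for G
    by measurable
  have int: "integrable (\<nu> \<Otimes>\<^sub>M ?S) (\<lambda>(g, y). T g y * iexp (G \<bullet> offset J j0 x g y))" for G
    using T_integrable[OF \<nu> \<theta>m[of G]] by simp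
  have indep: "\<Psi> G = 0" if ind: "inj_on (\<lambda>j. closest_point V (G $ j)) J" "independent ((\<lambda>j. closest_point V (G $ j)) ` J)" for G
  proof -
    define z where "z j = closest_point V (G $ j)" for j
    have z: "j \<in> J \<Longrightarrow> z j \<in> V" "inj_on z J" "independent (z ` J)" for j
      using ind closest_point_subspace_in[OF sV] by (simp_all add: z_def[abs_def])
    have "\<Psi> G = (\<integral>g. (\<integral>y. T g y * iexp (G \<bullet> offset J j0 x g y) \<partial>?S) \<partial>\<nu>)"
      unfolding \<Psi>_def by (rule P.integral_fst[OF int, symmetric])
    also have "\<dots> = (\<integral>g. iexp (\<Sum>j\<in>J. (g *v z j) \<bullet> x j) * (\<integral>y. T g y * iexp (- (z j0 \<bullet> y)) \<partial>?S) \<partial>\<nu>)"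
    proof (rule Bochner_Integration.integral_cong[OF refl])
      fix g assume "g \<in> space \<nu>"
      then have g: "orthogonal_matrix g" using orthogonal_groupD(1) by (auto simp: haar_space[OF \<nu>])
      have [measurable]: "T g \<in> borel_measurable borel" by measurable
      have "(\<integral>y. T g y * iexp (G \<bullet> offset J j0 x g y) \<partial>?S)
          = (\<integral>y. iexp (\<Sum>j\<in>J. (g *v z j) \<bullet> x j) * (T g y * iexp (- (z j0 \<bullet> y))) \<partial>?S)"
      proof (rule integral_cong_AE)
        show "AE y in ?S. T g y * iexp (G \<bullet> offset J j0 x g y)
            = iexp (\<Sum>j\<in>J. (g *v z j) \<bullet> x j) * (T g y * iexp (- (z j0 \<bullet> y)))"
          using AE_subspace_lborel[OF sV]
        proof eventually_elim
          case (elim y)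
          have "\<i> * complex_of_real (G \<bullet> offset J j0 x g y)
              = \<i> * complex_of_real (\<Sum>j\<in>J. (g *v z j) \<bullet> x j) + \<i> * complex_of_real (- (z j0 \<bullet> y))"
            unfolding offset_inner[OF g elim J(2) z_def] by (simp add: algebra_simps)
          then show ?case by (simp only: exp_add mult_ac)
        qed
      qed measurable
      then show "(\<integral>y. T g y * iexp (G \<bullet> offset J j0 x g y) \<partial>?S)
          = iexp (\<Sum>j\<in>J. (g *v z j) \<bullet> x j) * (\<integral>y. T g y * iexp (- (z j0 \<bullet> y)) \<partial>?S)"
        by (simp only: integral_mult_right_zero)
    qed
    also have "\<dots> = 0" by (rule phase_average_zero[OF z J \<nu>])
    finally show ?thesis .
  qed
  have "\<exists>G'. norm (G' - G) \<le> real CARD('n) * inverse (real (Suc k)) \<and> \<Psi> G' = 0" for k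
  proof -
    \<comment> \<open>The number of frequencies is dim W - q, at most dim W - p = dim V: this is
      where p \<le> q enters.\<close>
    have "card J \<le> dim V" using J(1) dV pq by simp
    then obtain z' where z': "\<And>j. j \<in> J \<Longrightarrow> z' j \<in> V \<and> norm (z' j - closest_point V (G $ j)) < inverse (real (Suc k))"
      "inj_on z' J" "independent (z' ` J)"
      using independent_perturbation[of J V "inverse (real (Suc k))" "\<lambda>j. closest_point V (G $ j)"]
        sV closest_point_subspace_in[OF sV] by auto
    \<comment> \<open>The correction added to a row lies in V, so the projection of the new row is
      exactly z'_j, while the component orthogonal to V is kept.\<close>
    define G' where "G' = (\<chi> j. if j \<in> J then G $ j + (z' j - closest_point V (G $ j)) else G $ j)"
    have G': "closest_point V (G' $ j) = z' j" if "j \<in> J" for j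
    proof -
      have "closest_point V (z' j) = z' j" "closest_point V (closest_point V (G $ j)) = closest_point V (G $ j)"
        using z'(1)[OF that] closest_point_subspace_in[OF sV] by (simp_all add: closest_point_self)
      then show ?thesis using that linear_closest_point[OF sV] by (simp add: G'_def linear_add linear_diff)
    qed
    have "norm (G' - G) \<le> (\<Sum>j\<in>UNIV. norm ((G' - G) $ j))" by (simp add: norm_vec_def L2_set_le_sum)
    also have "\<dots> \<le> (\<Sum>j\<in>(UNIV :: 'n set). inverse (real (Suc k)))"
      using z'(1) by (intro sum_mono) (auto simp: G'_def less_imp_le)
    finally have "norm (G' - G) \<le> real CARD('n) * inverse (real (Suc k))" by simp
    moreover have "\<Psi> G' = 0"
      using z'(2,3) by (intro indep) (simp_all add: G' cong: inj_on_cong image_cong_simp)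
    ultimately show ?thesis by blast
  qed
  then obtain Gs where Gs: "\<And>k. norm (Gs k - G) \<le> real CARD('n) * inverse (real (Suc k))" "\<And>k. \<Psi> (Gs k) = 0"
    by metis
  have "Gs \<longlonglongrightarrow> G"
  proof (rule LIM_zero_cancel, rule Lim_null_comparison)
    show "\<forall>\<^sub>F k in sequentially. norm (Gs k - G) \<le> real CARD('n) * inverse (real (Suc k))"
      using Gs(1) by simp
    show "(\<lambda>k. real CARD('n) * inverse (real (Suc k))) \<longlonglongrightarrow> 0"
      using tendsto_mult_right_zero[OF LIMSEQ_inverse_real_of_nat] .
  qed
  then have "(\<lambda>k. \<Psi> (Gs k)) \<longlonglongrightarrow> \<Psi> G"
    unfolding \<Psi>_def
  proof (intro integral_dominated_convergence)
    assume lim: "Gs \<longlonglongrightarrow> G"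
    \<comment> \<open>With 0 in place of G the phase is 1, so this is the norm of T, phrased as an
      instance of \<open>int\<close>.\<close>
    show "integrable (\<nu> \<Otimes>\<^sub>M ?S) (\<lambda>z. norm (case z of (g, y) \<Rightarrow> T g y * iexp (0 \<bullet> offset J j0 x g y)))"
      by (rule integrable_norm[OF int])
    show "AE z in \<nu> \<Otimes>\<^sub>M ?S. (\<lambda>k. case z of (g, y) \<Rightarrow> T g y * iexp (Gs k \<bullet> offset J j0 x g y))
        \<longlonglongrightarrow> (case z of (g, y) \<Rightarrow> T g y * iexp (G \<bullet> offset J j0 x g y))"
      by (intro AE_I2) (auto simp: split_beta' intro!: tendsto_intros lim)
    show "AE z in \<nu> \<Otimes>\<^sub>M ?S. norm (case z of (g, y) \<Rightarrow> T g y * iexp (Gs k \<bullet> offset J j0 x g y))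
        \<le> norm (case z of (g, y) \<Rightarrow> T g y * iexp (0 \<bullet> offset J j0 x g y))" for k
      by (intro AE_I2) (auto simp: split_beta' norm_mult)
  qed (use int in \<open>auto intro: borel_measurable_integrable\<close>)
  then have "\<Psi> G = 0" using Gs(2) LIMSEQ_unique tendsto_const by (metis (no_types, lifting) ext)
  then show ?thesis by (simp add: \<Psi>_def)
qed

text \<open>Integrate \<open>phase_integral_zero\<close> at s G against the Gaussian weight in G and
  exchange the integrals: the characteristic function of the Gaussian turns the phase into a kernel
  in the offset. Nothing but a nonzero constant is lost.\<close>

lemma gaussian_integral_zero:
  fixes x :: "'n \<Rightarrow> real^'n"
  assumes J: "card J + q = dim W" "j0 \<in> J" and pq: "p \<le> q" and \<nu>: "haar W \<nu>" and r: "r > 0"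
  shows "(\<integral>(g, y). T g y * complex_of_real (exp (- r * (norm (offset J j0 x g y))\<^sup>2)) \<partial>(\<nu> \<Otimes>\<^sub>M subspace_lborel V)) = 0"
proof -
  let ?M = "\<nu> \<Otimes>\<^sub>M subspace_lborel V" and ?L = "lborel :: (real^'n^'n) measure"
  let ?\<gamma> = "\<lambda>G::real^'n^'n. complex_of_real (exp (- (norm G)\<^sup>2 / 2))"
  let ?c = "complex_of_real (sqrt (2 * pi) ^ DIM(real^'n^'n))"
  \<comment> \<open>The scaling for which exp (- s^2 |a|^2 / 2) = exp (- r |a|^2).\<close>
  define s where "s = sqrt (2 * r)"
  have s: "s\<^sup>2 = 2 * r" using r by (simp add: s_def)
  interpret \<nu>: prob_space \<nu> using \<nu> by (simp add: haar_def)
  interpret S: sigma_finite_measure "subspace_lborel V" by (rule sigma_finite_subspace_lborel[OF sV])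
  interpret N: pair_sigma_finite \<nu> "subspace_lborel V" ..
  interpret M: sigma_finite_measure ?M by (rule sigma_finite_pair_measure) unfold_locales
  interpret P: pair_sigma_finite ?L ?M ..
  note [measurable] = haar_measurable_ident[OF \<nu>]
  define a where "a w = offset J j0 x (fst w) (snd w)" for w
  have am [measurable]: "a \<in> borel_measurable ?M" unfolding a_def by measurable
  define t where "t w = T (fst w) (snd w)" for w
  have tm [measurable]: "t \<in> borel_measurable ?M" unfolding t_def by measurable
  have t: "integrable ?M t"
    using T_integrable[OF \<nu>, of "\<lambda>_. 0"] by (simp add: t_def[abs_def] split_beta')
  have \<gamma>: "integrable ?L ?\<gamma>" by (rule integrable_of_real[OF lborel_gaussian_charfun(1)])
  have int: "integrable (?L \<Otimes>\<^sub>M ?M) (\<lambda>(G, w). ?\<gamma> G * (t w * iexp (G \<bullet> (s *\<^sub>R a w))))"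
  proof (rule Bochner_Integration.integrable_bound[OF P.integrable_pair_mult[OF \<gamma> t]])
    show "(\<lambda>(G, w). ?\<gamma> G * (t w * iexp (G \<bullet> (s *\<^sub>R a w)))) \<in> borel_measurable (?L \<Otimes>\<^sub>M ?M)"
      by measurable
    show "AE z in ?L \<Otimes>\<^sub>M ?M. norm (case z of (G, w) \<Rightarrow> ?\<gamma> G * (t w * iexp (G \<bullet> (s *\<^sub>R a w))))
        \<le> norm (case z of (G, w) \<Rightarrow> ?\<gamma> G * t w)"
      by (intro AE_I2) (auto simp: split_beta' norm_mult)
  qed
  have "0 = (\<integral>G. ?\<gamma> G * (\<integral>w. t w * iexp ((s *\<^sub>R G) \<bullet> a w) \<partial>?M) \<partial>?L)"
  proof -
    have "(\<integral>w. t w * iexp ((s *\<^sub>R G) \<bullet> a w) \<partial>?M) = 0" for G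
      using phase_integral_zero[OF J pq \<nu>, of "s *\<^sub>R G" x] by (simp only: t_def a_def split_beta')
    then show ?thesis by (simp only: mult_zero_right Bochner_Integration.integral_zero)
  qed
  also have "\<dots> = (\<integral>G. (\<integral>w. ?\<gamma> G * (t w * iexp (G \<bullet> (s *\<^sub>R a w))) \<partial>?M) \<partial>?L)"
    by (simp only: integral_mult_right_zero inner_scaleR_left inner_scaleR_right)
  also have "\<dots> = (\<integral>w. (\<integral>G. ?\<gamma> G * (t w * iexp (G \<bullet> (s *\<^sub>R a w))) \<partial>?L) \<partial>?M)"
    by (rule P.Fubini_integral[OF int, symmetric])
  also have "\<dots> = (\<integral>w. ?c * (t w * complex_of_real (exp (- r * (norm (a w))\<^sup>2))) \<partial>?M)"
  proof (rule Bochner_Integration.integral_cong[OF refl])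
    fix w
    have "(\<integral>G. ?\<gamma> G * (t w * iexp (G \<bullet> (s *\<^sub>R a w))) \<partial>?L) = (\<integral>G. t w * (?\<gamma> G * iexp (G \<bullet> (s *\<^sub>R a w))) \<partial>?L)"
      by (simp only: mult_ac)
    also have "\<dots> = t w * complex_of_real (sqrt (2 * pi) ^ DIM(real^'n^'n) * exp (- (norm (s *\<^sub>R a w))\<^sup>2 / 2))"
      unfolding integral_mult_right_zero lborel_gaussian_charfun(2) ..
    also have "- (norm (s *\<^sub>R a w))\<^sup>2 / 2 = - r * (norm (a w))\<^sup>2" by (simp add: power_mult_distrib s)
    finally show "(\<integral>G. ?\<gamma> G * (t w * iexp (G \<bullet> (s *\<^sub>R a w))) \<partial>?L) = ?c * (t w * complex_of_real (exp (- r * (norm (a w))\<^sup>2)))"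
      by (simp only: of_real_mult mult_ac)
  qed
  finally have "?c * (\<integral>w. t w * complex_of_real (exp (- r * (norm (a w))\<^sup>2)) \<partial>?M) = 0"
    by (simp only: integral_mult_right_zero)
  moreover have "?c \<noteq> 0" by simp
  ultimately have "(\<integral>w. t w * complex_of_real (exp (- r * (norm (a w))\<^sup>2)) \<partial>?M) = 0"
    by (simp only: mult_eq_0_iff simp_thms)
  then show ?thesis by (simp only: t_def a_def split_beta')
qed

section \<open>Concentration at the given plane\<close>

lemma T_continuous: "continuous_on (orthogonal_group W \<times> UNIV) (\<lambda>(g, y). T g y)"
proof -
  let ?\<phi> = "\<lambda>(g, y). (g ** pmat \<sigma> ** transpose g, g *v (v0 + y))"
  let ?F = "\<lambda>(Q, y). f (plane (range ((*v) Q)) y)"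
  have \<phi>: "?\<phi> z \<in> pmats p \<times> UNIV" if "z \<in> orthogonal_group W \<times> UNIV" for z
  proof -
    obtain g y where zgy: "z = (g, y)" by (cases z)
    then have z: "z = (g, y)" "orthogonal_matrix g"
      using that orthogonal_groupD(1)[of g W] by simp_all
    have "g ** pmat \<sigma> ** transpose g = pmat ((*v) g ` \<sigma>)"
      by (rule matrix_closest_point_orthogonal_image[OF z(2) s\<sigma>, symmetric])
    then show ?thesis using linear_grassmannian_image[OF z(2) \<sigma>] by (simp add: z(1) pmats_def)
  qed
  have "continuous_on (orthogonal_group W \<times> UNIV) (\<lambda>z. ?F (?\<phi> z))"
  proof (rule continuous_on_compose2[of "pmats p \<times> UNIV" ?F])
    show "continuous_on (pmats p \<times> UNIV) ?F"
      using f by (intro smooth_on_grassmannian_continuous) (simp add: schwartz_space_def)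
    show "continuous_on (orthogonal_group W \<times> UNIV) ?\<phi>"
      unfolding split_beta' by (intro continuous_intros)
    show "?\<phi> ` (orthogonal_group W \<times> UNIV) \<subseteq> pmats p \<times> UNIV" using \<phi> by blast
  qed
  then show ?thesis
  proof (rule continuous_on_eq)
    fix z assume "z \<in> orthogonal_group W \<times> (UNIV :: (real^'n) set)"
    from \<phi>[OF this] show "?F (?\<phi> z) = (\<lambda>(g, y). T g y) z"
      by (cases z) (simp add: T_def plane_fun_def)
  qed
qed

text \<open>Identifies the zero set of the exponent. A row with x_j = b says that g^T b, a vector of
  W, has no component in V, so it lies in \<sigma>; as the b span \<sigma>, g preserves \<sigma>.
  Then g^T x0 lies in V, and the row j0 says that it equals y.\<close>

lemma offset_zero:
  assumes B: "span B = \<sigma>" and x: "x j0 = x0" "\<And>b. b \<in> B \<Longrightarrow> \<exists>j\<in>J. j \<noteq> j0 \<and> x j = b" and x0: "x0 \<in> V"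
    and j0: "j0 \<in> J" and g: "g \<in> orthogonal_group W" and y: "y \<in> V" and zero: "offset J j0 x g y = 0"
  shows "T g y = f (plane \<sigma> (v0 + x0))"
proof -
  have go: "orthogonal_matrix g" by (rule orthogonal_groupD[OF g])
  have gT: "transpose g \<in> orthogonal_group W" by (rule orthogonal_group_transpose[OF g])
  have comp: "closest_point V (transpose g *v x j - (if j = j0 then y else 0)) = 0" if "j \<in> J" for j
    using that arg_cong[OF zero, of "\<lambda>A. A $ j"] by (simp add: offset_def matrix_closest_point_mult[OF sV])
  have cpV: "closest_point V w = closest_point W w - closest_point \<sigma> w" for w
    unfolding V_def by (rule closest_point_relative_orthogonal_comp[OF s\<sigma> W \<sigma>W])
  have gb: "transpose g *v b \<in> \<sigma>" if b: "b \<in> B" for b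
  proof -
    obtain j where j: "j \<in> J" "j \<noteq> j0" "x j = b" using x(2)[OF b] by blast
    have "b \<in> W" using b B span_superset[of B] \<sigma>W by blast
    then have "transpose g *v b \<in> W" by (rule orthogonal_group_image_subset[OF gT W])
    then have "transpose g *v b = closest_point \<sigma> (transpose g *v b)"
      using comp[OF j(1)] j(2,3) cpV[of "transpose g *v b"] by (simp add: closest_point_self)
    then show ?thesis using closest_point_subspace_in[OF s\<sigma>] by metis
  qed
  have "(*v) (transpose g) ` \<sigma> = span ((*v) (transpose g) ` B)"
    by (simp add: span_linear_image B[symmetric])
  then have sub: "(*v) (transpose g) ` \<sigma> \<subseteq> \<sigma>"
    using gb s\<sigma> span_minimal[of "(*v) (transpose g) ` B" \<sigma>] by auto
  have gT\<sigma>: "(*v) (transpose g) ` \<sigma> = \<sigma>"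
    using sub s\<sigma> dim_orthogonal_matrix_image[OF orthogonal_groupD(1)[OF gT], of \<sigma>]
    by (intro subspace_dim_equal) (auto intro: linear_subspace_image)
  have "(*v) g ` (*v) (transpose g) ` \<sigma> = \<sigma>" by (simp add: image_image orthogonal_matrix_inverse[OF go])
  then have g\<sigma>: "(*v) g ` \<sigma> = \<sigma>" unfolding gT\<sigma> .
  have "transpose g *v x0 \<in> V"
    unfolding V_def
  proof
    show "transpose g *v x0 \<in> W" using x0 VW by (intro orthogonal_group_image_subset[OF gT W]) blast
    show "transpose g *v x0 \<in> \<sigma>\<^sup>\<bottom>"
      unfolding orthogonal_comp_def orthogonal_def
    proof safe
      fix u assume "u \<in> \<sigma>"
      then have "g *v u \<in> \<sigma>" using g\<sigma> by blast
      then have "(g *v u) \<bullet> x0 = 0" using x0 by (auto simp: V_def orthogonal_comp_def orthogonal_def)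
      then show "u \<bullet> (transpose g *v x0) = 0"
        using orthogonal_matrix_inner(2)[of "transpose g" u x0] go by simp
    qed
  qed
  then have "transpose g *v x0 - y \<in> V" using y by (intro subspace_diff[OF sV])
  then have "transpose g *v x0 - y = 0"
    using comp[OF j0] by (simp add: x(1) closest_point_self)
  then have "g *v y = x0" using orthogonal_matrix_inverse(2)[OF go, of x0] by simp
  then show ?thesis
    by (simp add: T_eq[OF go] plane_image g\<sigma> matrix_vector_right_distrib v0_fixed[OF g])
qed

text \<open>Laplace's method by contradiction, with \<rho> the squared norm of the offset. The
  Gaussian integrals vanish for every r, but T equals c on the zero set of \<rho>, so it stays close
  to c where \<rho> is small, and this set has positive measure.\<close>

lemma plane_value_zero:
  assumes x0: "x0 \<in> V" and pq: "p \<le> q" "p + q + 1 \<le> dim W"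
  shows "f (plane \<sigma> (v0 + x0)) = 0"
proof (rule ccontr)
  define c where "c = f (plane \<sigma> (v0 + x0))"
  assume "f (plane \<sigma> (v0 + x0)) \<noteq> 0"
  then have c: "norm c > 0" by (simp add: c_def)
  \<comment> \<open>The vectors are rows of an n x n matrix, so J is taken inside the index type. It
    has at least p + 1 elements: j0 for the position x0 and p others for a basis of
    \<sigma>.\<close>
  have "dim W - q \<le> card (UNIV :: 'n set)" using dim_le_CARD[of W] by simp
  then obtain J :: "'n set" where "card J = dim W - q"
    by (rule obtain_subset_with_card_n) blast
  then have J: "card J + q = dim W" "card J \<ge> p + 1" using pq by simp_all
  then obtain j0 where j0: "j0 \<in> J" by fastforce
  obtain B where B: "B \<subseteq> \<sigma>" "independent B" "card B = dim \<sigma>" "span B = \<sigma>"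
    by (rule orthonormal_basis_subspace[OF s\<sigma>]) blast
  have "card B \<le> card (J - {j0})" using B(3) d\<sigma> J(2) j0 by simp
  then obtain i where i: "i ` B \<subseteq> J - {j0}" "inj_on i B"
    using card_le_inj[OF independent_imp_finite[OF B(2)], of "J - {j0}"] by auto
  \<comment> \<open>x0 at j0, the basis of \<sigma> at the positions chosen by i, and 0 at the
    remaining indices, where the row of the offset is then 0 and puts no condition on g.\<close>
  define x where "x j = (if j = j0 then x0 else if j \<in> i ` B then the_inv_into B i j else 0)" for j
  have xj0: "x j0 = x0" by (simp add: x_def)
  have xB: "\<exists>j\<in>J. j \<noteq> j0 \<and> x j = b" if "b \<in> B" for b
    using that i by (intro bexI[of _ "i b"]) (auto simp: x_def the_inv_into_f_f)
  have x\<sigma>: "x j \<in> \<sigma>" if "j \<noteq> j0" for j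
    using that B(1) i(2) subspace_0[OF s\<sigma>] by (auto simp: x_def the_inv_into_f_f)
  obtain \<nu> where \<nu>: "haar W \<nu>" using haar_exists[OF W] by blast
  let ?S = "subspace_lborel V"
  let ?M = "\<nu> \<Otimes>\<^sub>M ?S"
  interpret \<nu>: prob_space \<nu> using \<nu> by (simp add: haar_def)
  interpret S: sigma_finite_measure ?S by (rule sigma_finite_subspace_lborel[OF sV])
  interpret N: pair_sigma_finite \<nu> ?S ..
  note [measurable] = haar_measurable_ident[OF \<nu>]
  define \<rho> where "\<rho> w = (norm (offset J j0 x (fst w) (snd w)))\<^sup>2" for w
  define t where "t w = T (fst w) (snd w)" for w
  \<comment> \<open>The factor \<open>cnj c\<close> makes the value on the zero set of \<rho> real
    and positive, namely |c|^2. The threshold b is half of it, which leaves room for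
    continuity.\<close>
  define u where "u w = Re (cnj c * t w)" for w
  have \<rho>cont: "continuous_on UNIV \<rho>"
    using continuous_on_offset[of J j0 x] unfolding \<rho>_def split_beta' by (intro continuous_intros)
  have ucont: "continuous_on (orthogonal_group W \<times> UNIV) u"
    using T_continuous unfolding u_def t_def split_beta' by (intro continuous_intros)
  have [measurable]: "\<rho> \<in> borel_measurable ?M" unfolding \<rho>_def by measurable
  have [measurable]: "t \<in> borel_measurable ?M" unfolding t_def by measurable
  have tint: "integrable ?M t"
    using T_integrable[OF \<nu>, of "\<lambda>_. 0"] by (simp add: t_def[abs_def] split_beta')
  then have uint: "integrable ?M u" unfolding u_def by (intro integrable_Re integrable_mult_right)
  define b where "b = (norm c)\<^sup>2 / 2"
  have b: "b > 0" using c by (simp add: b_def)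
  have u0: "u (g, y) = 2 * b" if "g \<in> orthogonal_group W" "y \<in> V" "\<rho> (g, y) = 0" for g y
  proof -
    have "T g y = c"
      unfolding c_def using that by (intro offset_zero[OF B(4) xj0 xB x0 j0]) (simp_all add: \<rho>_def)
    moreover have "Re (cnj c * c) = (norm c)\<^sup>2"
      by (simp only: mult.commute[of "cnj c"] complex_mult_cnj cmod_power2 Re_complex_of_real)
    ultimately show ?thesis by (simp add: u_def t_def b_def)
  qed
  obtain \<delta> where \<delta>: "\<delta> > 0" "\<And>g y. g \<in> orthogonal_group W \<Longrightarrow> y \<in> V \<Longrightarrow> \<rho> (g, y) < \<delta> \<Longrightarrow> b \<le> u (g, y)"
  proof -
    \<comment> \<open>A compact set containing all pairs (g, y), y in V, with \<rho> < 1. On its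
      closed part where u \<le> b the function \<rho> has no zeros, hence a positive
      minimum.\<close>
    define D where "D = orthogonal_group W \<times> (V \<inter> cball 0 (norm x0 + 1))"
    have D: "compact D" unfolding D_def
      by (intro compact_Times compact_orthogonal_group closed_Int_compact compact_cball closed_subspace sV)
    have "closed {w \<in> D. u w \<le> b}"
      using continuous_on_subset[OF ucont, of D] compact_imp_closed[OF D]
      by (intro continuous_on_closed_Collect_le) (auto simp: D_def)
    then have K: "compact (D \<inter> {w \<in> D. u w \<le> b})" by (rule compact_Int_closed[OF D])
    have "\<exists>\<delta>>0. \<forall>w\<in>D \<inter> {w \<in> D. u w \<le> b}. \<delta> \<le> \<rho> w"
    proof (cases "D \<inter> {w \<in> D. u w \<le> b} = {}")
      case False
      then obtain w where w: "w \<in> D \<inter> {w \<in> D. u w \<le> b}" "\<And>w'. w' \<in> D \<inter> {w \<in> D. u w \<le> b} \<Longrightarrow> \<rho> w \<le> \<rho> w'"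
        using continuous_attains_inf[OF K False continuous_on_subset[OF \<rho>cont subset_UNIV]] by blast
      have "\<rho> w \<noteq> 0"
      proof
        assume "\<rho> w = 0"
        then have "u w = 2 * b" using w(1) u0[of "fst w" "snd w"] by (auto simp: D_def)
        then show False using w(1) b by simp
      qed
      moreover have "\<rho> w \<ge> 0" by (simp add: \<rho>_def)
      ultimately show ?thesis using w(2) by (intro exI[of _ "\<rho> w"]) auto
    qed (use zero_less_one in blast)
    then obtain \<delta>1 where \<delta>1: "\<delta>1 > 0" "\<And>w. w \<in> D \<Longrightarrow> u w \<le> b \<Longrightarrow> \<delta>1 \<le> \<rho> w" by blast
    \<comment> \<open>The bound 1 confines y: the row j0 of the offset is P_V (g^T x0) - y, so |y|
      \<le> |x0| + 1 and (g, y) lies in D.\<close>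
    show thesis
    proof (rule that[of "min 1 \<delta>1"])
      fix g y assume gy: "g \<in> orthogonal_group W" "y \<in> V" "\<rho> (g, y) < min 1 \<delta>1"
      have "norm (offset J j0 x g y) < 1"
      proof (rule ccontr)
        assume "\<not> norm (offset J j0 x g y) < 1"
        then have "1 \<le> (norm (offset J j0 x g y))\<^sup>2" by (simp add: one_le_power)
        then show False using gy(3) by (simp add: \<rho>_def)
      qed
      moreover have "norm (offset J j0 x g y $ j0) \<le> norm (offset J j0 x g y)"
        by (rule Finite_Cartesian_Product.norm_nth_le)
      moreover have "offset J j0 x g y $ j0 = closest_point V (transpose g *v x0) - y"
        using j0 gy(2) by (simp add: offset_def matrix_closest_point_mult[OF sV] xj0
            linear_diff[OF linear_closest_point[OF sV]] closest_point_self)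
      moreover have "norm (closest_point V (transpose g *v x0)) \<le> norm x0"
        using norm_closest_point_subspace_le[OF sV, of "transpose g *v x0"]
          orthogonal_matrix_norm[of "transpose g" x0] orthogonal_groupD(1)[OF gy(1)] by simp
      ultimately have "norm y \<le> norm x0 + 1"
        using norm_triangle_ineq2[of y "closest_point V (transpose g *v x0)"]
        by (simp add: norm_minus_commute)
      then have "(g, y) \<in> D" using gy by (simp add: D_def)
      then show "b \<le> u (g, y)" using \<delta>1(2)[of "(g, y)"] gy(3) by fastforce
    qed (use \<delta>1 in simp)
  qed
  have zero: "(\<integral>w. u w * exp (- r * \<rho> w) \<partial>?M) = 0" if r: "r > 0" for r
  proof -
    have i: "integrable ?M (\<lambda>w. t w * complex_of_real (exp (- r * \<rho> w)))"
    proof (rule Bochner_Integration.integrable_bound[OF tint])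
      have "norm (t w * complex_of_real (exp (- r * \<rho> w))) \<le> norm (t w) * 1" for w
        unfolding norm_mult using r by (intro mult_left_mono) (auto simp: \<rho>_def)
      then show "AE w in ?M. norm (t w * complex_of_real (exp (- r * \<rho> w))) \<le> norm (t w)" by simp
    qed measurable
    have "(\<integral>w. u w * exp (- r * \<rho> w) \<partial>?M) = (\<integral>w. Re (cnj c * (t w * complex_of_real (exp (- r * \<rho> w)))) \<partial>?M)"
      by (simp add: u_def algebra_simps)
    also have "\<dots> = Re (\<integral>w. cnj c * (t w * complex_of_real (exp (- r * \<rho> w))) \<partial>?M)"
      by (rule integral_Re[OF integrable_mult_right[OF i]])
    also have "(\<integral>w. cnj c * (t w * complex_of_real (exp (- r * \<rho> w))) \<partial>?M) = cnj c * (\<integral>w. t w * complex_of_real (exp (- r * \<rho> w)) \<partial>?M)"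
      by (rule integral_mult_right_zero)
    also have "(\<integral>w. t w * complex_of_real (exp (- r * \<rho> w)) \<partial>?M) = 0"
      using gaussian_integral_zero[OF J(1) j0 pq(1) \<nu> r, of x] by (simp only: t_def \<rho>_def split_beta')
    finally show ?thesis by simp
  qed
  have lower: "AE w in ?M. \<rho> w < \<delta> \<longrightarrow> b \<le> u w"
  proof -
    have V: "V \<in> sets borel" using closed_subspace[OF sV] by auto
    have "AE w in ?M. w \<in> space \<nu> \<times> V"
    proof (rule N.AE_pair_measure)
      have "{w \<in> space ?M. w \<in> space \<nu> \<times> V} = space \<nu> \<times> V" by (auto simp: space_pair_measure)
      then show "{w \<in> space ?M. w \<in> space \<nu> \<times> V} \<in> sets ?M"
        using V by (simp add: pair_measureI)
      show "AE g in \<nu>. AE y in ?S. (g, y) \<in> space \<nu> \<times> V"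
      proof (rule AE_I2)
        fix g assume "g \<in> space \<nu>"
        then show "AE y in ?S. (g, y) \<in> space \<nu> \<times> V"
          using AE_subspace_lborel[OF sV] by (auto elim: eventually_mono)
      qed
    qed
    then show ?thesis
    proof eventually_elim
      case (elim w)
      then show ?case using \<delta>(2)[of "fst w" "snd w"] by (auto simp: haar_space[OF \<nu>])
    qed
  qed
  have "emeasure ?M {w \<in> space ?M. \<rho> w < \<delta> / 2} = 0"
    by (rule laplace_concentration[OF uint _ _ \<delta>(1) b lower zero]) (simp_all add: \<rho>_def)
  moreover have "emeasure ?M {w \<in> space ?M. \<rho> w < \<delta> / 2} > 0"
  proof -
    \<comment> \<open>The point of concentration: the row j0 is P_V x0 - x0 = 0, and the other x_j
      lie in \<sigma>, which is orthogonal to V. Haar and Lebesgue measure both charge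
      neighbourhoods of this point.\<close>
    have "offset J j0 x (mat 1) x0 = 0"
    proof -
      have "closest_point V (x j) = 0" if "j \<noteq> j0" for j
        using x\<sigma>[OF that] subspace_0[OF sV]
        by (intro closest_point_subspace_eqI[OF sV]) (auto simp: V_def orthogonal_comp_def orthogonal_def)
      then show ?thesis
        by (auto simp: offset_def vec_eq_iff matrix_closest_point_mult[OF sV] xj0 transpose_mat
            linear_0[OF linear_closest_point[OF sV]])
    qed
    then have mem: "(mat 1, x0) \<in> {w. \<rho> w < \<delta> / 2}" using \<delta>(1) by (simp add: \<rho>_def)
    have "open {w. \<rho> w < \<delta> / 2}" by (rule open_Collect_less[OF \<rho>cont continuous_on_const])
    then obtain A1 A2 where A: "open A1" "open A2" "(mat 1, x0) \<in> A1 \<times> A2" "A1 \<times> A2 \<subseteq> {w. \<rho> w < \<delta> / 2}"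
      using mem by (rule open_prod_elim) blast
    obtain e1 e2 where e: "e1 > 0" "ball (mat 1) e1 \<subseteq> A1" "e2 > 0" "ball x0 e2 \<subseteq> A2"
      using A(1,2,3) open_contains_ball[of A1] open_contains_ball[of A2] by (meson mem_Sigma_iff)
    let ?B1 = "ball (mat 1) e1 \<inter> orthogonal_group W" and ?B2 = "ball x0 e2"
    have B1: "?B1 \<in> sets \<nu>" using \<nu> by (auto simp: haar_def sets_restrict_space)
    have "0 < emeasure \<nu> ?B1 * emeasure ?S ?B2"
      using haar_ball_pos[OF \<nu> e(1)] subspace_lborel_ball_pos[OF sV x0 e(3)] by (simp add: ennreal_zero_less_mult_iff)
    also have "\<dots> = emeasure ?M (?B1 \<times> ?B2)"
      using B1 by (intro S.emeasure_pair_measure_Times[symmetric]) auto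
    also have "\<dots> \<le> emeasure ?M {w \<in> space ?M. \<rho> w < \<delta> / 2}"
    proof (rule emeasure_mono)
      show "?B1 \<times> ?B2 \<subseteq> {w \<in> space ?M. \<rho> w < \<delta> / 2}"
        using e A(4) by (fastforce simp: space_pair_measure haar_space[OF \<nu>])
    qed measurable
    finally show ?thesis .
  qed
  ultimately show False by simp
qed

end

section \<open>Reduction of the theorem to a hyperplane\<close>

lemma grassmannian_dim_less_imp:
  assumes "p < q" "q \<le> n - 1" "affine_grassmannian_dim p n < affine_grassmannian_dim q n"
  shows "p + q + 1 \<le> n - 1"
proof (rule ccontr)
  assume *: "\<not> p + q + 1 \<le> n - 1"
  \<comment> \<open>In these variables (p + 1)(n - p) - (q + 1)(n - q) = d (p + 1 - k), and the
    negated claim says k \<le> p + 1. All subtractions are thus replaced by sums of natural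
    numbers.\<close>
  define d k where "d = q - p" and "k = n - q"
  have d: "q = p + d" "n - p = k + d" "n - q = k" "k \<le> p + 1"
    using assms(1,2) * by (auto simp: d_def k_def)
  have "d * k \<le> d * (p + 1)" using d(4) by (rule mult_le_mono2)
  then have "(q + 1) * (n - q) \<le> (p + 1) * (n - p)"
    unfolding d(2,3) by (subst d(1)) (simp add: algebra_simps)
  then show False using assms(3) by (simp add: affine_grassmannian_dim_def)
qed

theorem theorem7p1:
  fixes p q :: nat
    and \<O> :: "(real^'n) set"
    and f :: "(real^'n) set \<Rightarrow> complex"
  assumes "p < q" and "q \<le> CARD('n) - 1"
    and "affine_grassmannian_dim p CARD('n) < affine_grassmannian_dim q CARD('n)"
    and "\<forall>l \<in> affine_grassmannian p. l \<subseteq> - \<O> \<longrightarrow>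
           (\<exists>L \<in> affine_grassmannian (CARD('n) - 1). l \<subseteq> L \<and> L \<subseteq> - \<O>)"
    and "f \<in> schwartz_space p"
    and "\<forall>\<xi> \<in> affine_grassmannian q. \<xi> \<subseteq> - \<O> \<longrightarrow> radon p f \<xi> = 0"
  shows "\<forall>l \<in> affine_grassmannian p. l \<subseteq> - \<O> \<longrightarrow> f l = 0"
proof (intro ballI impI)
  fix l :: "(real^'n) set"
  assume l: "l \<in> affine_grassmannian p" "l \<subseteq> - \<O>"
  then obtain L where L: "L \<in> affine_grassmannian (CARD('n) - 1)" "l \<subseteq> L" "L \<subseteq> - \<O>"
    using assms(4) by blast
  obtain \<sigma> y where \<sigma>l: "\<sigma> \<in> linear_grassmannian p" "y \<in> \<sigma>\<^sup>\<bottom>" "l = plane \<sigma> y"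
    by (rule affine_grassmannian_cases[OF l(1)])
  obtain W v where Wl: "W \<in> linear_grassmannian (CARD('n) - 1)" "v \<in> W\<^sup>\<bottom>" "L = plane W v"
    by (rule affine_grassmannian_cases[OF L(1)])
  have sW: "subspace W" and dW: "dim W = CARD('n) - 1" and s\<sigma>: "subspace \<sigma>"
    using Wl(1) \<sigma>l(1) by (auto simp: linear_grassmannian_def)
  have "direction l \<subseteq> direction L" using L(2) by (auto simp: direction_def)
  then have \<sigma>W: "\<sigma> \<subseteq> W"
    by (simp add: \<sigma>l(3) Wl(3) direction_plane[OF s\<sigma>] direction_plane[OF sW])
  have pq: "p + q + 1 \<le> dim W"
    unfolding dW by (rule grassmannian_dim_less_imp[OF assms(1-3)])
  \<comment> \<open>v is the foot of L, so L = v + W, and every q-plane in it avoids \<O>, where the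
    Radon transform vanishes by assumption.\<close>
  interpret radon_vanishing p q f W \<sigma> v
  proof
    fix \<eta> w assume \<eta>: "\<eta> \<in> linear_grassmannian q" "\<eta> \<subseteq> W" "w \<in> \<eta>\<^sup>\<bottom> \<inter> W"
    have "plane \<eta> (v + w) \<subseteq> plane W v"
    proof
      fix u assume "u \<in> plane \<eta> (v + w)"
      then obtain a where "a \<in> \<eta>" "u = v + (w + a)" by (auto simp: plane_def add.assoc)
      then show "u \<in> plane W v"
        using \<eta>(2,3) sW unfolding plane_def by (intro image_eqI[of _ _ "w + a"]) (auto intro: subspace_add)
    qed
    then have "plane \<eta> (v + w) \<subseteq> - \<O>" using L(3) Wl(3) by blast
    then show "radon p f (plane \<eta> (v + w)) = 0"
      using assms(6) plane_in_affine_grassmannian[OF \<eta>(1)] by blast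
  qed (fact assms(5) sW \<sigma>l(1) \<sigma>W Wl(2))+
  \<comment> \<open>l is the translate of \<sigma> by v + (y - v). Here y - v is in W because y lies
    in L = v + W, and it is orthogonal to \<sigma> because y and v both are.\<close>
  have "y \<in> plane \<sigma> y" using subspace_0[OF s\<sigma>] unfolding plane_def by (intro image_eqI[of _ _ 0]) auto
  then have "y \<in> plane W v" using L(2) \<sigma>l(3) Wl(3) by blast
  then have "y - v \<in> W" by (auto simp: plane_def)
  moreover have "v \<in> \<sigma>\<^sup>\<bottom>" using Wl(2) orthogonal_comp_anti_mono[OF \<sigma>W] by blast
  then have "y - v \<in> \<sigma>\<^sup>\<bottom>" using \<sigma>l(2) by (intro subspace_diff[OF subspace_orthogonal_comp])
  ultimately have "y - v \<in> V" by (simp add: V_def)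
  from plane_value_zero[OF this less_imp_le[OF assms(1)] pq] show "f l = 0" by (simp add: \<sigma>l(3))
qed

end
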